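(* Let $m,n,d$ be fixed integers with $m \ge n \ge 2$ and $1 \le d \le n$. Then $$\delta_q(n \times m, m(n-d+1), d) \in O\left(q^{-(d-1)(n-d+1)+1}\right) \quad \text{as } q \to +\infty.$$ Moreover, $$\lim_{q \to +\infty} \delta_q(n \times m, m(n-d+1),d) = \begin{cases} 1 & \text{if } d=1, \\ \sum_{i=0}^m \frac{(-1)^i}{i!} & \text{if } n=d=2, \\ 0 & \text{otherwise}. \end{cases}$$
   Context: Limits and $O$-estimates as $q\to+\infty$ are over the prime powers $q$. A (rank-metric) code is a non-zero $\mathbb{F}_q$-linear subspace $\mathcal{C}$ of the space $\mathbb{F}_q^{n\times m}$ of $n \times m$ matrices; its minimum distance is $d(\mathcal{C})=\min\{\mathrm{rk}(M) \mid M \in \mathcal{C}, M\ne 0\}$. With the $q$-binomial coefficient $\binom{a}{b}_q = \prod_{i=0}^{b-1} \frac{q^a-q^i}{q^b-q^i}$, for $1\le k\le mn$ and $1 \le d \le n$, $$\delta_q(n \times m, k, d):= \frac{|\{\mathcal{C} \le \mathbb{F}_q^{n\times m} \mid \dim(\mathcal{C})=k, \; d(\mathcal{C}) \ge d\}|}{\binom{mn}{k}_q}.$$ *)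

theory Defs
  imports
    "HOL-Library.Landau_Symbols"
    "HOL-Number_Theory.Prime_Powers"
    "Jordan_Normal_Form.Missing_VectorSpace"
begin

text \<open>Finite fields are HOL-Algebra records rather than types, because the order of the field has
  to vary inside a limit. A matrix is an extensional function on index pairs \<open>(i, j)\<close>, counted
  from 0.\<close>

definition mat_space :: "'a ring \<Rightarrow> nat \<Rightarrow> nat \<Rightarrow> ('a, nat \<times> nat \<Rightarrow> 'a) module" where
  "mat_space K n m = ring.func_space K ({..<n} \<times> {..<m})"

definition mat_col :: "nat \<Rightarrow> (nat \<times> nat \<Rightarrow> 'a) \<Rightarrow> nat \<Rightarrow> (nat \<Rightarrow> 'a)" where
  "mat_col n M j = (\<lambda>i\<in>{..<n}. M (i, j))"

definition mat_rank :: "'a ring \<Rightarrow> nat \<Rightarrow> nat \<Rightarrow> (nat \<times> nat \<Rightarrow> 'a) \<Rightarrow> nat" where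
  "mat_rank K n m M =
     (let V = ring.func_space K {..<n}
      in vectorspace.dim K (V\<lparr>carrier := module.span K V (mat_col n M ` {..<m})\<rparr>))"

text \<open>Meaningful only for codes other than the zero space, since \<open>Min {}\<close> is unspecified.\<close>

definition min_distance :: "'a ring \<Rightarrow> nat \<Rightarrow> nat \<Rightarrow> (nat \<times> nat \<Rightarrow> 'a) set \<Rightarrow> nat" where
  "min_distance K n m C = Min {mat_rank K n m M | M. M \<in> C \<and> M \<noteq> \<zero>\<^bsub>mat_space K n m\<^esub>}"

definition q_binomial :: "nat \<Rightarrow> nat \<Rightarrow> nat \<Rightarrow> real" where
  "q_binomial q a b = (\<Prod>i<b. (real q ^ a - real q ^ i) / (real q ^ b - real q ^ i))"

text \<open>For a field \<open>K\<close> with \<open>q\<close> elements this is \<open>\<delta>\<^sub>q(n \<times> m, k, d)\<close>, intended for \<open>1 \<le> k \<le> mn\<close>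
  and \<open>1 \<le> d \<le> n\<close>; the condition \<open>k \<ge> 1\<close> excludes the zero space from the count.\<close>

definition rank_metric_density :: "'a ring \<Rightarrow> nat \<Rightarrow> nat \<Rightarrow> nat \<Rightarrow> nat \<Rightarrow> real" where
  "rank_metric_density K n m k d =
     real (card {C. subspace K C (mat_space K n m)
                  \<and> vectorspace.dim K ((mat_space K n m)\<lparr>carrier := C\<rparr>) = k
                  \<and> min_distance K n m C \<ge> d})
     / q_binomial (card (carrier K)) (m * n) k"

definition prime_powers_at_top :: "nat filter" where
  "prime_powers_at_top = inf at_top (principal {q. primepow q})"

end

theory Submission
  imports Defs "HOL-Real_Asymp.Real_Asymp"
begin

text \<open>
  Write \<open>r = d - 1\<close> and \<open>k = m (n - r)\<close>. Counting codes through their ordered bases turns the density into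
  the number of independent \<open>k\<close>-tuples of matrices whose span has minimum distance greater than \<open>r\<close>,
  divided by the number of all independent \<open>k\<close>-tuples (\<open>density_eq\<close>). A \<open>k\<close>-tuple of vectors is a
  linear map \<open>g\<close> from \<open>k\<close>-dimensional space, and the key fact is \<open>card_prescribed\<close>: such a map can be prescribed
  freely on any independent family, so the values of a uniformly random \<open>g\<close> at non-proportional
  arguments are independent and uniform.

  For the upper bound, let \<open>Y\<close> be the number of nonzero coefficient vectors that a random \<open>g\<close> maps to a
  nonzero matrix of rank at most \<open>r\<close>. There are at least about \<open>q ^ (r (n - r) + m r)\<close> such matrices
  (\<open>card_low_rank\<close>), so \<open>Y\<close> has mean at least of order \<open>q ^ (r (n - r))\<close>. By pairwise independence its variance
  is at most \<open>q - 1\<close> times its mean, so Chebyshev's inequality bounds the probability of \<open>Y = 0\<close> by a multiple of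
  \<open>q / q ^ (r (n - r))\<close> (\<open>density_upper_bound\<close>). This is the asserted estimate for \<open>d \<ge> 2\<close>, and it
  gives the limit 0 unless \<open>n = d = 2\<close>. For \<open>d = 1\<close> the density is identically 1.

  For \<open>n = d = 2\<close> an \<open>m\<close>-tuple of \<open>2 \<times> m\<close> matrices is a pair \<open>(G, H)\<close> of linear maps of \<open>m\<close>-dimensional space,
  given by the first and by the second rows. Its span has minimum distance 2 if and only if \<open>G\<close> is
  injective and \<open>H w = \<mu> G w\<close> has no solution with \<open>w \<noteq> 0\<close> and \<open>\<mu>\<close> in the field (\<open>stack_good_iff\<close>). For fixed
  \<open>G\<close>, inclusion-exclusion over the sets \<open>S\<close> of eigenvalues \<open>\<mu>\<close> applies, in which only sets with at most \<open>m\<close>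
  elements occur. For \<open>card S = i\<close> the proportion of maps \<open>H\<close> with eigenvalues \<open>S\<close> is \<open>q ^ (- i)\<close> up to
  a factor tending to 1: eigenvectors for distinct eigenvalues are independent, so the choices of
  eigenvectors can be counted by \<open>card_prescribed\<close> (\<open>sum_prod_eigvec\<close>), and maps with a higher-dimensional
  eigenspace contribute little (\<open>sum_prod_eigvec_big\<close>). As there are about \<open>q ^ i / i!\<close> sets \<open>S\<close>, the \<open>i\<close>-th
  term of the alternating sum tends to \<open>(-1) ^ i / i!\<close>.\<close>

section \<open>Families of vectors over a field\<close>

text \<open>Finite fields as plain \<open>ring\<close> records, the type over which rank and density are defined.\<close>

locale finite_field = field R for R :: "'a ring" (structure) +
  assumes finite_carrier: "finite (carrier R)"

context ring
begin

text \<open>The linear combination \<open>\<Oplus>i. a i \<cdot> g i\<close> of a finite family of vectors. Vectors are extensional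
  functions on an index set \<open>X\<close>, and so are the coefficients \<open>a\<close>; read as matrices, \<open>lin_comb I X a g\<close> is the
  product of the row \<open>a\<close> with the matrix whose rows are the \<open>g i\<close>. Thus a family \<open>g\<close> also encodes the
  linear map \<open>a \<mapsto> lin_comb I X a g\<close>.\<close>

definition lin_comb :: "'i set \<Rightarrow> 'x set \<Rightarrow> ('i \<Rightarrow> 'a) \<Rightarrow> ('i \<Rightarrow> 'x \<Rightarrow> 'a) \<Rightarrow> 'x \<Rightarrow> 'a" where
  "lin_comb I X a g = (\<lambda>x\<in>X. \<Oplus>i\<in>I. a i \<otimes> g i x)"

text \<open>The zero vector, as an extensional function.\<close>

definition zero_vec :: "'x set \<Rightarrow> 'x \<Rightarrow> 'a" where
  "zero_vec X = (\<lambda>x\<in>X. \<zero>)"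

text \<open>Linear independence of a family (not of a set: an independent family is injective), which
  says that the linear map encoded by the family is injective.\<close>

definition lin_indep :: "'i set \<Rightarrow> 'x set \<Rightarrow> ('i \<Rightarrow> 'x \<Rightarrow> 'a) \<Rightarrow> bool" where
  "lin_indep I X g \<longleftrightarrow> (\<forall>a \<in> I \<rightarrow>\<^sub>E carrier R. lin_comb I X a g = zero_vec X \<longrightarrow> a = zero_vec I)"

text \<open>The span of a family indexed by a finite set.\<close>

definition lin_span :: "'i set \<Rightarrow> 'x set \<Rightarrow> ('i \<Rightarrow> 'x \<Rightarrow> 'a) \<Rightarrow> ('x \<Rightarrow> 'a) set" where
  "lin_span I X g = (\<lambda>a. lin_comb I X a g) ` (I \<rightarrow>\<^sub>E carrier R)"

text \<open>A linear subspace of the space of vectors on \<open>X\<close>, spelled out pointwise. It coincides with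
  \<open>subspace\<close> for the module \<open>func_space X\<close>.\<close>

definition is_subspace :: "'x set \<Rightarrow> ('x \<Rightarrow> 'a) set \<Rightarrow> bool" where
  "is_subspace X W \<longleftrightarrow> W \<subseteq> X \<rightarrow>\<^sub>E carrier R \<and> zero_vec X \<in> W \<and>
     (\<forall>u\<in>W. \<forall>v\<in>W. (\<lambda>x\<in>X. u x \<oplus> v x) \<in> W) \<and>
     (\<forall>s\<in>carrier R. \<forall>v\<in>W. (\<lambda>x\<in>X. s \<otimes> v x) \<in> W)"

end

context field
begin

lemma zero_vec_closed [simp]: "zero_vec X \<in> X \<rightarrow>\<^sub>E carrier R"
  by (auto simp: zero_vec_def)

lemma lin_comb_closed:
  assumes "a \<in> I \<rightarrow> carrier R" "g \<in> I \<rightarrow> X \<rightarrow> carrier R"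
  shows "lin_comb I X a g \<in> X \<rightarrow>\<^sub>E carrier R"
  using assms by (auto simp: lin_comb_def Pi_iff intro!: finsum_closed)

lemma lin_comb_cong:
  assumes "\<And>i. i \<in> I \<Longrightarrow> a i = a' i" "\<And>i x. i \<in> I \<Longrightarrow> x \<in> X \<Longrightarrow> g i x = g' i x"
    "a' \<in> I \<rightarrow> carrier R" "g' \<in> I \<rightarrow> X \<rightarrow> carrier R"
  shows "lin_comb I X a g = lin_comb I X a' g'"
  unfolding lin_comb_def
proof (rule restrict_ext)
  fix x assume "x \<in> X"
  then show "(\<Oplus>i\<in>I. a i \<otimes> g i x) = (\<Oplus>i\<in>I. a' i \<otimes> g' i x)"
    using assms by (intro finsum_cong') (auto simp: Pi_iff)
qed

lemma finsum_swap:
  assumes "finite I" "finite J" "\<And>i j. i \<in> I \<Longrightarrow> j \<in> J \<Longrightarrow> f i j \<in> carrier R"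
  shows "(\<Oplus>i\<in>I. \<Oplus>j\<in>J. f i j) = (\<Oplus>j\<in>J. \<Oplus>i\<in>I. f i j)"
  using assms(1,3)
proof (induction I rule: finite_induct)
  case empty
  show ?case by simp
next
  case (insert i I)
  have "(\<Oplus>i'\<in>insert i I. \<Oplus>j\<in>J. f i' j) = (\<Oplus>j\<in>J. f i j) \<oplus> (\<Oplus>j\<in>J. \<Oplus>i\<in>I. f i j)"
    using insert by (subst finsum_insert) (auto intro!: finsum_closed)
  also have "\<dots> = (\<Oplus>j\<in>J. f i j \<oplus> (\<Oplus>i\<in>I. f i j))"
    using insert assms(2) by (subst finsum_addf) (auto intro!: finsum_closed)
  also have "\<dots> = (\<Oplus>j\<in>J. \<Oplus>i\<in>insert i I. f i j)"
    using insert by (intro finsum_cong') (auto simp: finsum_insert intro!: finsum_closed)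
  finally show ?case .
qed

text \<open>Associativity of the matrix product. It lets a prescribed value of the map encoded by \<open>g\<close> on a
  linear combination be computed from its values on the terms.\<close>

lemma lin_comb_assoc:
  assumes "finite I" "finite J" and a: "a \<in> I \<rightarrow> carrier R"
    and b: "b \<in> I \<rightarrow> J \<rightarrow> carrier R" and g: "g \<in> J \<rightarrow> X \<rightarrow> carrier R"
  shows "lin_comb J X (lin_comb I J a b) g = lin_comb I X a (\<lambda>i. lin_comb J X (b i) g)"
  unfolding lin_comb_def
proof (rule restrict_ext)
  fix x assume x: "x \<in> X"
  have [simp]: "a i \<in> carrier R" "b i j \<in> carrier R" "g j x \<in> carrier R"
    if "i \<in> I" "j \<in> J" for i j
    using that a b g x by auto
  have "(\<Oplus>j\<in>J. (\<lambda>j\<in>J. \<Oplus>i\<in>I. a i \<otimes> b i j) j \<otimes> g j x) =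
        (\<Oplus>j\<in>J. (\<Oplus>i\<in>I. a i \<otimes> (b i j \<otimes> g j x)))"
    using assms x
    by (intro finsum_cong') (auto simp: finsum_ldistr m_assoc Pi_iff intro!: finsum_closed finsum_cong')
  also have "\<dots> = (\<Oplus>i\<in>I. (\<Oplus>j\<in>J. a i \<otimes> (b i j \<otimes> g j x)))"
    by (rule finsum_swap[OF assms(2,1)]) auto
  also have "\<dots> = (\<Oplus>i\<in>I. a i \<otimes> (\<lambda>x\<in>X. \<Oplus>j\<in>J. b i j \<otimes> g j x) x)"
    using assms x by (intro finsum_cong') (auto simp: finsum_rdistr Pi_iff intro!: finsum_closed)
  finally show "(\<Oplus>j\<in>J. (\<lambda>j\<in>J. \<Oplus>i\<in>I. a i \<otimes> b i j) j \<otimes> g j x) =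
     (\<Oplus>i\<in>I. a i \<otimes> (\<lambda>x\<in>X. \<Oplus>j\<in>J. b i j \<otimes> g j x) x)" .
qed

lemma lin_comb_add:
  assumes "finite I" "a \<in> I \<rightarrow> carrier R" "b \<in> I \<rightarrow> carrier R" "g \<in> I \<rightarrow> X \<rightarrow> carrier R"
  shows "lin_comb I X (\<lambda>i\<in>I. a i \<oplus> b i) g = (\<lambda>x\<in>X. lin_comb I X a g x \<oplus> lin_comb I X b g x)"
proof -
  have "(\<Oplus>i\<in>I. (\<lambda>i\<in>I. a i \<oplus> b i) i \<otimes> g i x) = (\<Oplus>i\<in>I. a i \<otimes> g i x) \<oplus> (\<Oplus>i\<in>I. b i \<otimes> g i x)"
    if "x \<in> X" for x
  proof -
    have "(\<Oplus>i\<in>I. (\<lambda>i\<in>I. a i \<oplus> b i) i \<otimes> g i x) = (\<Oplus>i\<in>I. a i \<otimes> g i x \<oplus> b i \<otimes> g i x)"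
      using assms that by (intro finsum_cong') (auto simp: l_distr Pi_iff)
    also have "\<dots> = (\<Oplus>i\<in>I. a i \<otimes> g i x) \<oplus> (\<Oplus>i\<in>I. b i \<otimes> g i x)"
      using assms that by (intro finsum_addf) (auto simp: Pi_iff)
    finally show ?thesis .
  qed
  then show ?thesis by (auto simp: lin_comb_def)
qed

lemma lin_comb_smult:
  assumes "finite I" "s \<in> carrier R" "a \<in> I \<rightarrow> carrier R" "g \<in> I \<rightarrow> X \<rightarrow> carrier R"
  shows "lin_comb I X (\<lambda>i\<in>I. s \<otimes> a i) g = (\<lambda>x\<in>X. s \<otimes> lin_comb I X a g x)"
proof -
  have "(\<Oplus>i\<in>I. (\<lambda>i\<in>I. s \<otimes> a i) i \<otimes> g i x) = s \<otimes> (\<Oplus>i\<in>I. a i \<otimes> g i x)"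
    if "x \<in> X" for x
    using assms that
    by (subst finsum_rdistr) (auto simp: Pi_iff m_assoc intro!: finsum_cong')
  then show ?thesis by (auto simp: lin_comb_def)
qed

lemma lin_comb_zero [simp]:
  assumes "g \<in> I \<rightarrow> X \<rightarrow> carrier R"
  shows "lin_comb I X (zero_vec I) g = zero_vec X"
  unfolding lin_comb_def zero_vec_def
proof (rule restrict_ext)
  fix x assume "x \<in> X"
  then have "(\<Oplus>i\<in>I. (\<lambda>x\<in>I. \<zero>) i \<otimes> g i x) = (\<Oplus>i\<in>I. \<zero>)"
    using assms by (intro finsum_cong') (auto simp: Pi_iff)
  then show "(\<Oplus>i\<in>I. (\<lambda>x\<in>I. \<zero>) i \<otimes> g i x) = \<zero>" by simp
qed

lemma lin_comb_insert:
  assumes "finite I" "j \<notin> I" "a \<in> insert j I \<rightarrow> carrier R" "g \<in> insert j I \<rightarrow> X \<rightarrow> carrier R"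
  shows "lin_comb (insert j I) X a g = (\<lambda>x\<in>X. a j \<otimes> g j x \<oplus> lin_comb I X a g x)"
  using assms by (auto simp: lin_comb_def Pi_iff intro!: restrict_ext finsum_insert)

lemma lin_comb_unit:
  assumes "finite I" "j \<in> I" "g \<in> I \<rightarrow> X \<rightarrow>\<^sub>E carrier R"
  shows "lin_comb I X (\<lambda>i\<in>I. if i = j then \<one> else \<zero>) g = g j"
proof -
  have "lin_comb I X (\<lambda>i\<in>I. if i = j then \<one> else \<zero>) g x = g j x" for x
  proof (cases "x \<in> X")
    case True
    have gc: "g i x \<in> carrier R" if "i \<in> I" for i
      using assms(3) that True by auto
    have "(\<Oplus>i\<in>I. (\<lambda>i\<in>I. if i = j then \<one> else \<zero>) i \<otimes> g i x) = (\<Oplus>i\<in>I. if j = i then g i x else \<zero>)"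
      using assms True gc by (intro finsum_cong') auto
    also have "\<dots> = g j x"
      using assms True gc by (intro finsum_singleton) auto
    finally show ?thesis using True by (simp add: lin_comb_def)
  next
    case False
    then show ?thesis using assms by (auto simp: lin_comb_def Pi_iff PiE_def extensional_def)
  qed
  then show ?thesis by blast
qed

lemma is_subspace_all: "is_subspace X (X \<rightarrow>\<^sub>E carrier R)"
  by (auto simp: is_subspace_def zero_vec_def)

lemma is_subspace_lin_comb:
  assumes W: "is_subspace X W" and "finite I" "a \<in> I \<rightarrow> carrier R" "g \<in> I \<rightarrow> W"
  shows "lin_comb I X a g \<in> W"
  using assms(2-)
proof (induction I rule: finite_induct)
  case empty
  have "lin_comb {} X a g = zero_vec X" by (simp add: lin_comb_def zero_vec_def)
  then show ?case using W by (simp only: is_subspace_def)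
next
  case (insert i I)
  have gX: "g \<in> insert i I \<rightarrow> X \<rightarrow> carrier R"
    using insert.prems W by (fastforce simp: is_subspace_def Pi_iff)
  have "lin_comb (insert i I) X a g = (\<lambda>x\<in>X. (\<lambda>x\<in>X. a i \<otimes> g i x) x \<oplus> lin_comb I X a g x)"
    using insert gX by (subst lin_comb_insert) (auto intro: restrict_ext)
  moreover have "(\<lambda>x\<in>X. a i \<otimes> g i x) \<in> W" "lin_comb I X a g \<in> W"
    using insert W by (auto simp: is_subspace_def)
  ultimately show ?case using W unfolding is_subspace_def by metis
qed

lemma lin_spanI: "a \<in> I \<rightarrow>\<^sub>E carrier R \<Longrightarrow> lin_comb I X a g \<in> lin_span I X g"
  by (simp add: lin_span_def)

lemma is_subspace_lin_span:
  assumes "finite I" "g \<in> I \<rightarrow> X \<rightarrow> carrier R"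
  shows "is_subspace X (lin_span I X g)"
  unfolding is_subspace_def
proof (intro conjI ballI)
  show "lin_span I X g \<subseteq> X \<rightarrow>\<^sub>E carrier R"
    unfolding lin_span_def using assms by (intro image_subsetI lin_comb_closed) auto
  show "zero_vec X \<in> lin_span I X g"
    unfolding lin_span_def using assms by (intro image_eqI[of _ _ "zero_vec I"]) auto
next
  fix u v assume "u \<in> lin_span I X g" "v \<in> lin_span I X g"
  then obtain a b where ab: "a \<in> I \<rightarrow>\<^sub>E carrier R" "b \<in> I \<rightarrow>\<^sub>E carrier R"
    and [simp]: "u = lin_comb I X a g" "v = lin_comb I X b g"
    by (auto simp: lin_span_def)
  have "(\<lambda>i\<in>I. a i \<oplus> b i) \<in> I \<rightarrow>\<^sub>E carrier R"
    using ab by auto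
  then have "lin_comb I X (\<lambda>i\<in>I. a i \<oplus> b i) g \<in> lin_span I X g" by (rule lin_spanI)
  also have "lin_comb I X (\<lambda>i\<in>I. a i \<oplus> b i) g = (\<lambda>x\<in>X. u x \<oplus> v x)"
    using assms ab by (subst lin_comb_add) auto
  finally show "(\<lambda>x\<in>X. u x \<oplus> v x) \<in> lin_span I X g" .
next
  fix s v assume s: "s \<in> carrier R" and "v \<in> lin_span I X g"
  then obtain a where ab: "a \<in> I \<rightarrow>\<^sub>E carrier R" and [simp]: "v = lin_comb I X a g"
    by (auto simp: lin_span_def)
  have "(\<lambda>i\<in>I. s \<otimes> a i) \<in> I \<rightarrow>\<^sub>E carrier R"
    using ab s by auto
  then have "lin_comb I X (\<lambda>i\<in>I. s \<otimes> a i) g \<in> lin_span I X g" by (rule lin_spanI)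
  also have "lin_comb I X (\<lambda>i\<in>I. s \<otimes> a i) g = (\<lambda>x\<in>X. s \<otimes> v x)"
    using assms ab s by (subst lin_comb_smult) auto
  finally show "(\<lambda>x\<in>X. s \<otimes> v x) \<in> lin_span I X g" .
qed

lemma lin_indep_inj:
  assumes ind: "lin_indep I X g" and I: "finite I" and g: "g \<in> I \<rightarrow> X \<rightarrow> carrier R"
  shows "inj_on (\<lambda>a. lin_comb I X a g) (I \<rightarrow>\<^sub>E carrier R)"
proof (rule inj_onI)
  fix a b assume a: "a \<in> I \<rightarrow>\<^sub>E carrier R" and b: "b \<in> I \<rightarrow>\<^sub>E carrier R"
    and eq: "lin_comb I X a g = lin_comb I X b g"
  define b' where "b' = (\<lambda>i\<in>I. \<ominus> \<one> \<otimes> b i)"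
  have b': "b' \<in> I \<rightarrow>\<^sub>E carrier R" using b by (auto simp: b'_def)
  have cl: "lin_comb I X b g \<in> X \<rightarrow>\<^sub>E carrier R"
    using b g by (intro lin_comb_closed) auto
  have "lin_comb I X (\<lambda>i\<in>I. a i \<oplus> b' i) g = (\<lambda>x\<in>X. lin_comb I X a g x \<oplus> lin_comb I X b' g x)"
    using a b' I g by (intro lin_comb_add) auto
  also have "lin_comb I X b' g = (\<lambda>x\<in>X. \<ominus> \<one> \<otimes> lin_comb I X b g x)"
    unfolding b'_def using b I g by (intro lin_comb_smult) auto
  also have "(\<lambda>x\<in>X. lin_comb I X a g x \<oplus> (\<lambda>x\<in>X. \<ominus> \<one> \<otimes> lin_comb I X b g x) x) = zero_vec X"
    unfolding eq zero_vec_def using cl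
    by (intro restrict_ext) (auto simp: l_minus r_neg dest!: PiE_mem)
  finally have "lin_comb I X (\<lambda>i\<in>I. a i \<oplus> b' i) g = zero_vec X" .
  moreover have "(\<lambda>i\<in>I. a i \<oplus> b' i) \<in> I \<rightarrow>\<^sub>E carrier R"
    using a b' by auto
  ultimately have "(\<lambda>i\<in>I. a i \<oplus> b' i) = zero_vec I"
    using ind unfolding lin_indep_def by blast
  then have "(\<lambda>i\<in>I. a i \<oplus> b' i) i = zero_vec I i" for i by (rule fun_cong)
  then have *: "a i \<oplus> b' i = \<zero>" if "i \<in> I" for i
    using that by (metis (no_types, lifting) restrict_apply' zero_vec_def)
  show "a = b"
  proof (rule PiE_ext[OF a b])
    fix i assume i: "i \<in> I"
    have cl: "a i \<in> carrier R" "b i \<in> carrier R" using PiE_mem[OF a i] PiE_mem[OF b i] .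
    then have "b' i = \<ominus> b i" using i by (simp add: b'_def l_minus)
    with *[OF i] cl show "a i = b i"
      by (simp add: a_minus_def[symmetric])
  qed
qed

end

section \<open>Counting independent families, subspaces and linear maps over a finite field\<close>

context finite_field
begin

declare finite_carrier [simp]

lemma zero_vec_apply [simp]: "x \<in> X \<Longrightarrow> zero_vec X x = \<zero>"
  by (simp add: zero_vec_def)

lemma mem_lin_span:
  assumes "finite I" "i \<in> I" "g \<in> I \<rightarrow> X \<rightarrow>\<^sub>E carrier R"
  shows "g i \<in> lin_span I X g"
proof -
  have "(\<lambda>l\<in>I. if l = i then \<one> else \<zero>) \<in> I \<rightarrow>\<^sub>E carrier R" by auto
  then have "lin_comb I X (\<lambda>l\<in>I. if l = i then \<one> else \<zero>) g \<in> lin_span I X g" by (rule lin_spanI)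
  then show ?thesis by (simp only: lin_comb_unit[OF assms])
qed

abbreviation "q \<equiv> card (carrier R)"

lemma q_ge_2: "q \<ge> 2"
proof -
  have "card {\<zero>, \<one>} \<le> q"
    by (rule card_mono[OF finite_carrier]) auto
  then show ?thesis by simp
qed

lemma finite_vecs: "finite X \<Longrightarrow> finite (X \<rightarrow>\<^sub>E carrier R)"
  using finite_carrier by (auto intro: finite_PiE)

lemma card_vecs: "finite X \<Longrightarrow> card (X \<rightarrow>\<^sub>E carrier R) = q ^ card X"
  by (simp add: card_funcsetE)

lemma card_lin_span:
  assumes "lin_indep I X g" "finite I" "g \<in> I \<rightarrow> X \<rightarrow> carrier R"
  shows "card (lin_span I X g) = q ^ card I"
  unfolding lin_span_def using lin_indep_inj[OF assms] assms(2)
  by (simp add: card_image card_vecs)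

lemma lin_span_cong:
  assumes "\<And>i. i \<in> I \<Longrightarrow> g i = g' i" "g' \<in> I \<rightarrow> X \<rightarrow> carrier R"
  shows "lin_span I X g = lin_span I X g'"
  unfolding lin_span_def
  by (rule image_cong[OF refl], rule lin_comb_cong) (use assms in auto)

lemma lin_indep_cong:
  assumes "\<And>i. i \<in> I \<Longrightarrow> g i = g' i" "g' \<in> I \<rightarrow> X \<rightarrow> carrier R"
  shows "lin_indep I X g = lin_indep I X g'"
proof -
  have "lin_comb I X a g = lin_comb I X a g'" if "a \<in> I \<rightarrow>\<^sub>E carrier R" for a
    by (rule lin_comb_cong) (use assms that in auto)
  then show ?thesis by (auto simp: lin_indep_def)
qed

text \<open>Every counting statement below adds one vector at a time, so this is the only criterion for
  independence that they need.\<close>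

lemma lin_indep_insert:
  assumes I: "finite I" and j: "j \<notin> I" and g: "g \<in> insert j I \<rightarrow> X \<rightarrow>\<^sub>E carrier R"
  shows "lin_indep (insert j I) X g \<longleftrightarrow> lin_indep I X g \<and> g j \<notin> lin_span I X g"
proof (intro iffI conjI notI)
  have gP: "g \<in> insert j I \<rightarrow> X \<rightarrow> carrier R" "g \<in> I \<rightarrow> X \<rightarrow> carrier R"
    using g by auto
  have gj: "g j x \<in> carrier R" if "x \<in> X" for x using g that by auto
  {
    assume ind: "lin_indep (insert j I) X g"
    show "lin_indep I X g"
      unfolding lin_indep_def
    proof (intro ballI impI)
      fix a assume a: "a \<in> I \<rightarrow>\<^sub>E carrier R" and eq: "lin_comb I X a g = zero_vec X"
      define a' where "a' = a(j := \<zero>)"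
      have a': "a' \<in> insert j I \<rightarrow>\<^sub>E carrier R" using a by (auto simp: a'_def PiE_iff extensional_def)
      have "lin_comb I X a' g = lin_comb I X a g"
        by (rule lin_comb_cong) (use a j gP in \<open>auto simp: a'_def\<close>)
      then have "lin_comb (insert j I) X a' g = (\<lambda>x\<in>X. a' j \<otimes> g j x \<oplus> zero_vec X x)"
        using lin_comb_insert[OF I j _ gP(1), of a'] a' eq by auto
      also have "\<dots> = zero_vec X"
        using gj by (auto simp: a'_def zero_vec_def)
      finally have "a' = zero_vec (insert j I)" using ind a' by (auto simp: lin_indep_def)
      then have "a' i = zero_vec (insert j I) i" for i by simp
      then have "a i = \<zero>" if "i \<in> I" for i
        using that j by (metis a'_def fun_upd_other insertCI zero_vec_apply)
      then show "a = zero_vec I"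
        using a by (intro PiE_ext[OF a]) (auto simp: zero_vec_def)
    qed
  next
    assume ind: "lin_indep (insert j I) X g" and "g j \<in> lin_span I X g"
    then obtain a where a: "a \<in> I \<rightarrow>\<^sub>E carrier R" and eq: "g j = lin_comb I X a g"
      by (auto simp: lin_span_def)
    define a' where "a' = a(j := \<ominus> \<one>)"
    have a': "a' \<in> insert j I \<rightarrow>\<^sub>E carrier R" using a by (auto simp: a'_def PiE_iff extensional_def)
    have "lin_comb I X a' g = lin_comb I X a g"
      by (rule lin_comb_cong) (use a j gP in \<open>auto simp: a'_def\<close>)
    then have "lin_comb (insert j I) X a' g = (\<lambda>x\<in>X. a' j \<otimes> g j x \<oplus> g j x)"
      using lin_comb_insert[OF I j _ gP(1), of a'] a' eq by auto
    also have "\<dots> = zero_vec X"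
      unfolding zero_vec_def by (rule restrict_ext) (use gj in \<open>simp add: a'_def l_minus l_neg\<close>)
    finally have "a' = zero_vec (insert j I)" using ind a' by (auto simp: lin_indep_def)
    then have "a' j = \<zero>" by (simp add: zero_vec_def)
    then show False by (simp add: a'_def)
  next
    assume *: "lin_indep I X g \<and> g j \<notin> lin_span I X g"
    show "lin_indep (insert j I) X g"
      unfolding lin_indep_def
    proof (intro ballI impI)
      fix a assume a: "a \<in> insert j I \<rightarrow>\<^sub>E carrier R" and eq: "lin_comb (insert j I) X a g = zero_vec X"
      define b where "b = restrict a I"
      have b: "b \<in> I \<rightarrow>\<^sub>E carrier R" using a by (auto simp: b_def)
      have aj: "a j \<in> carrier R" using a by auto
      have "lin_comb I X b g = lin_comb I X a g"
        by (rule lin_comb_cong) (use a gP in \<open>auto simp: b_def\<close>)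
      moreover have "a \<in> insert j I \<rightarrow> carrier R" using a by auto
      ultimately have "(\<lambda>x\<in>X. a j \<otimes> g j x \<oplus> lin_comb I X b g x) = zero_vec X"
        using lin_comb_insert[OF I j _ gP(1), of a] eq by simp
      then have "(\<lambda>x\<in>X. a j \<otimes> g j x \<oplus> lin_comb I X b g x) x = zero_vec X x" for x by simp
      then have eq': "a j \<otimes> g j x \<oplus> lin_comb I X b g x = \<zero>" if "x \<in> X" for x
        using that by (metis (no_types, lifting) restrict_apply' zero_vec_apply)
      have lb: "lin_comb I X b g \<in> X \<rightarrow>\<^sub>E carrier R" using b gP by (intro lin_comb_closed) auto
      have lbx: "lin_comb I X b g x \<in> carrier R" if "x \<in> X" for x using PiE_mem[OF lb that] .
      show "a = zero_vec (insert j I)"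
      proof (cases "a j = \<zero>")
        case True
        have "lin_comb I X b g = zero_vec X"
          by (rule PiE_ext[OF lb zero_vec_closed]) (use eq' gj lbx in \<open>simp add: True zero_vec_def\<close>)
        then have "b = zero_vec I" using * b by (auto simp: lin_indep_def)
        then have "b i = zero_vec I i" for i by simp
        then have "a i = \<zero>" if "i \<in> I" for i
          using that by (metis b_def restrict_apply' zero_vec_apply)
        then show ?thesis using True
          by (intro PiE_ext[OF a zero_vec_closed]) (auto simp: zero_vec_def)
      next
        case False
        have inv: "inv (a j) \<in> carrier R" "inv (a j) \<otimes> a j = \<one>"
          using False aj by (auto simp: field_Units)
        define d where "d = (\<lambda>i\<in>I. (\<ominus> (inv (a j))) \<otimes> b i)"
        have d: "d \<in> I \<rightarrow>\<^sub>E carrier R" using b inv by (auto simp: d_def)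
        have "g j x = (\<ominus> (inv (a j))) \<otimes> lin_comb I X b g x" if "x \<in> X" for x
        proof -
          have "a j \<otimes> g j x = \<ominus> lin_comb I X b g x"
            using eq'[OF that] lbx[OF that] gj[OF that] aj
            by (metis m_closed minus_equality)
          then have "inv (a j) \<otimes> (a j \<otimes> g j x) = inv (a j) \<otimes> (\<ominus> lin_comb I X b g x)" by simp
          then show ?thesis
            using inv aj gj[OF that] lbx[OF that] by (simp add: m_assoc[symmetric] l_minus r_minus)
        qed
        then have "g j = (\<lambda>x\<in>X. (\<ominus> (inv (a j))) \<otimes> lin_comb I X b g x)"
          using g by (intro extensionalityI[of _ X]) (auto simp: PiE_def)
        also have "\<dots> = lin_comb I X d g"
          unfolding d_def using I inv b gP by (intro lin_comb_smult[symmetric]) auto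
        finally have "g j \<in> lin_span I X g" using d by (simp add: lin_spanI)
        then show ?thesis using * by simp
      qed
    qed
  }
qed

lemma is_subspace_finite:
  assumes "is_subspace X W" "finite X"
  shows "finite W"
proof (rule finite_subset)
  show "W \<subseteq> X \<rightarrow>\<^sub>E carrier R" using assms(1) by (simp add: is_subspace_def)
qed (rule finite_vecs[OF assms(2)])

lemma lin_span_subset:
  assumes "is_subspace X W" "finite I" "g \<in> I \<rightarrow> W"
  shows "lin_span I X g \<subseteq> W"
  using assms unfolding lin_span_def by (intro image_subsetI is_subspace_lin_comb) auto

text \<open>The next vector has to avoid the span of the previous ones. The subtraction of natural numbers is
  exact as long as there is an independent family of \<open>i\<close> vectors in \<open>W\<close>, since its span has \<open>q ^ i\<close>
  elements; otherwise both sides vanish.\<close>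

lemma card_lin_indep:
  assumes W: "is_subspace X W" and X: "finite X" and J: "finite J"
  shows "card {g \<in> J \<rightarrow>\<^sub>E W. lin_indep J X g} = (\<Prod>i<card J. card W - q ^ i)"
  using J
proof (induction J rule: finite_induct)
  case empty
  have eq: "{g \<in> {} \<rightarrow>\<^sub>E W. lin_indep {} X g} = {\<lambda>_. undefined}"
    by (auto simp: lin_indep_def zero_vec_def)
  show ?case unfolding eq by simp
next
  case (insert j J)
  let ?A = "{g \<in> J \<rightarrow>\<^sub>E W. lin_indep J X g}"
  let ?f = "\<lambda>(g, v). g(j := v)"
  have WX: "W \<subseteq> X \<rightarrow>\<^sub>E carrier R" using W by (simp add: is_subspace_def)
  have finW: "finite W" using is_subspace_finite[OF W X] .
  have cong: "lin_indep J X (g(j := v)) = lin_indep J X g" "lin_span J X (g(j := v)) = lin_span J X g"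
    if "g \<in> J \<rightarrow> W" for g v
    by (rule lin_indep_cong lin_span_cong; use that WX insert.hyps in fastforce)+
  have "{g \<in> insert j J \<rightarrow>\<^sub>E W. lin_indep (insert j J) X g} = ?f ` (SIGMA g:?A. W - lin_span J X g)"
  proof (intro equalityI subsetI)
    fix g assume "g \<in> {g \<in> insert j J \<rightarrow>\<^sub>E W. lin_indep (insert j J) X g}"
    then have g: "g \<in> insert j J \<rightarrow>\<^sub>E W" and ind: "lin_indep (insert j J) X g" by auto
    let ?g = "g(j := undefined)"
    have g': "?g \<in> J \<rightarrow>\<^sub>E W" using g insert.hyps by (auto simp: PiE_iff extensional_def)
    have "g \<in> insert j J \<rightarrow> X \<rightarrow>\<^sub>E carrier R" using g WX by auto
    from lin_indep_insert[OF insert.hyps this] ind have i: "lin_indep J X g" "g j \<notin> lin_span J X g" by auto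
    have "lin_indep J X ?g" "g j \<notin> lin_span J X ?g" 
      using i cong[of g undefined] g by auto
    then have "(?g, g j) \<in> (SIGMA g:?A. W - lin_span J X g)" using g' g by auto
    then show "g \<in> ?f ` (SIGMA g:?A. W - lin_span J X g)"
      by (rule rev_image_eqI) auto
  next
    fix h assume "h \<in> ?f ` (SIGMA g:?A. W - lin_span J X g)"
    then obtain g v where h: "h = g(j := v)" and g: "g \<in> J \<rightarrow>\<^sub>E W" and i: "lin_indep J X g"
      and v: "v \<in> W" "v \<notin> lin_span J X g" by auto
    have hW: "h \<in> insert j J \<rightarrow>\<^sub>E W" using g v by (auto simp: h PiE_iff extensional_def)
    have "h \<in> insert j J \<rightarrow> X \<rightarrow>\<^sub>E carrier R" using hW WX by auto
    from lin_indep_insert[OF insert.hyps this] i v cong[of g v] g hW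
    show "h \<in> {g \<in> insert j J \<rightarrow>\<^sub>E W. lin_indep (insert j J) X g}" by (auto simp: h)
  qed
  moreover have "inj_on ?f (SIGMA g:?A. W - lin_span J X g)"
  proof (rule inj_onI, clarify)
    fix g v g' v' assume g: "g \<in> J \<rightarrow>\<^sub>E W" "g' \<in> J \<rightarrow>\<^sub>E W" and eq: "g(j := v) = g'(j := v')"
    have "g i = g' i" if "i \<in> J" for i
      using fun_cong[OF eq, of i] that insert.hyps by (auto split: if_splits)
    then show "g = g' \<and> v = v'" using PiE_ext[OF g] fun_cong[OF eq, of j] by auto
  qed
  ultimately have "card {g \<in> insert j J \<rightarrow>\<^sub>E W. lin_indep (insert j J) X g} =
      card (SIGMA g:?A. W - lin_span J X g)"
    by (simp add: card_image)
  also have "\<dots> = (\<Sum>g\<in>?A. card (W - lin_span J X g))"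
    using finW insert.hyps finite_PiE[OF insert.hyps(1), of "\<lambda>_. W"] by (intro card_SigmaI) simp_all
  also have "\<dots> = (\<Sum>g\<in>?A. card W - q ^ card J)"
  proof (rule sum.cong[OF refl])
    fix g assume g: "g \<in> ?A"
    then have "lin_span J X g \<subseteq> W" using W insert.hyps by (intro lin_span_subset) auto
    moreover have "card (lin_span J X g) = q ^ card J"
      using g WX insert.hyps by (intro card_lin_span) auto
    ultimately show "card (W - lin_span J X g) = card W - q ^ card J"
      using finW by (simp add: card_Diff_subset finite_subset)
  qed
  also have "\<dots> = (\<Prod>i<card (insert j J). card W - q ^ i)"
    using insert by (simp add: mult.commute)
  finally show ?case .
qed

text \<open>Subspaces of dimension \<open>k\<close> are counted through their ordered bases: each has the same number of
  them, and this number is the denominator of the \<open>q\<close>-binomial coefficient.\<close>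

lemma card_subspaces:
  assumes X: "finite X"
  shows "card {C. is_subspace X C \<and> card C = q ^ k \<and> P C} * (\<Prod>i<k. q ^ k - q ^ i) =
    card {g \<in> {..<k} \<rightarrow>\<^sub>E (X \<rightarrow>\<^sub>E carrier R). lin_indep {..<k} X g \<and> P (lin_span {..<k} X g)}"
    (is "card ?A * _ = card ?B")
proof -
  let ?F = "\<lambda>C. {g \<in> {..<k} \<rightarrow>\<^sub>E C. lin_indep {..<k} X g}"
  have finA: "finite ?A"
    by (rule finite_subset[of _ "Pow (X \<rightarrow>\<^sub>E carrier R)"]) (use X finite_vecs in \<open>auto simp: is_subspace_def\<close>)
  have sp: "lin_span {..<k} X g = C" if "C \<in> ?A" "g \<in> ?F C" for C g
  proof -
    have "lin_span {..<k} X g \<subseteq> C" using that by (intro lin_span_subset) auto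
    moreover have "card (lin_span {..<k} X g) = q ^ card {..<k}"
      using that by (intro card_lin_span) (auto simp: is_subspace_def)
    ultimately show ?thesis
      using that is_subspace_finite[OF _ X] by (intro card_subset_eq) auto
  qed
  have "?B = (\<Union>C\<in>?A. ?F C)"
  proof (intro equalityI subsetI)
    fix g assume g: "g \<in> ?B"
    let ?C = "lin_span {..<k} X g"
    have gX: "g \<in> {..<k} \<rightarrow> X \<rightarrow> carrier R" using g by auto
    have "?C \<in> ?A" using g is_subspace_lin_span[OF _ gX] card_lin_span[OF _ _ gX] by auto
    moreover have "g \<in> ?F ?C"
    proof -
      have "g i \<in> ?C" if "i < k" for i
        by (rule mem_lin_span) (use g that in auto)
      then show ?thesis using g by (auto simp: PiE_iff)
    qed
    ultimately show "g \<in> (\<Union>C\<in>?A. ?F C)" by blast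
  next
    fix g assume "g \<in> (\<Union>C\<in>?A. ?F C)"
    then obtain C where C: "C \<in> ?A" "g \<in> ?F C" by blast
    moreover have "C \<subseteq> X \<rightarrow>\<^sub>E carrier R" using C by (auto simp: is_subspace_def)
    ultimately show "g \<in> ?B" using sp[OF C] by (auto simp: PiE_iff)
  qed
  moreover have "card (\<Union>C\<in>?A. ?F C) = (\<Sum>C\<in>?A. card (?F C))"
  proof (rule card_UN_disjoint[OF finA])
    show "\<forall>C\<in>?A. finite (?F C)"
    proof
      fix C assume "C \<in> ?A"
      then have "finite C" using is_subspace_finite[OF _ X] by auto
      then have "finite ({..<k} \<rightarrow>\<^sub>E C)" by (intro finite_PiE) auto
      then show "finite (?F C)" by simp
    qed
    show "\<forall>C\<in>?A. \<forall>D\<in>?A. C \<noteq> D \<longrightarrow> ?F C \<inter> ?F D = {}"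
    proof (intro ballI impI)
      fix C D assume CD: "C \<in> ?A" "D \<in> ?A" "C \<noteq> D"
      show "?F C \<inter> ?F D = {}"
      proof (rule ccontr)
        assume "?F C \<inter> ?F D \<noteq> {}"
        then obtain g where "g \<in> ?F C" "g \<in> ?F D" by (meson Int_iff ex_in_conv)
        from sp[OF CD(1) this(1)] sp[OF CD(2) this(2)] CD(3) show False by simp
      qed
    qed
  qed
  moreover have "(\<Sum>C\<in>?A. card (?F C)) = (\<Sum>C\<in>?A. \<Prod>i<k. q ^ k - q ^ i)"
    by (rule sum.cong[OF refl]) (use X in \<open>auto simp: card_lin_indep\<close>)
  ultimately show ?thesis by simp
qed

lemma lin_indep_extend:
  assumes I: "finite I" and J: "J \<subseteq> I" and c: "c \<in> J \<rightarrow> I \<rightarrow>\<^sub>E carrier R" and ind: "lin_indep J I c"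
  shows "\<exists>b. b \<in> I \<rightarrow> I \<rightarrow>\<^sub>E carrier R \<and> lin_indep I I b \<and> (\<forall>j\<in>J. b j = c j)"
proof -
  have "finite D \<Longrightarrow> D \<subseteq> I - J \<Longrightarrow>
    \<exists>b. b \<in> J \<union> D \<rightarrow> I \<rightarrow>\<^sub>E carrier R \<and> lin_indep (J \<union> D) I b \<and> (\<forall>j\<in>J. b j = c j)" for D
  proof (induction D rule: finite_induct)
    case empty
    then show ?case using c ind by auto
  next
    case (insert x D)
    then obtain b where b: "b \<in> J \<union> D \<rightarrow> I \<rightarrow>\<^sub>E carrier R" "lin_indep (J \<union> D) I b"
      "\<And>j. j \<in> J \<Longrightarrow> b j = c j" by auto
    have fin: "finite (J \<union> D)" using insert J I finite_subset by blast
    have bP: "b \<in> J \<union> D \<rightarrow> I \<rightarrow> carrier R" using b by auto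
    have "J \<union> D \<subset> I" using insert J by blast
    then have "card (J \<union> D) < card I" using I psubset_card_mono by blast
    then have "q ^ card (J \<union> D) < q ^ card I" using q_ge_2 by (intro power_strict_increasing) auto
    then have "card (lin_span (J \<union> D) I b) < card (I \<rightarrow>\<^sub>E carrier R)"
      using card_lin_span[OF b(2) fin bP] card_vecs[OF I] by simp
    moreover have "lin_span (J \<union> D) I b \<subseteq> I \<rightarrow>\<^sub>E carrier R"
      by (rule lin_span_subset[OF is_subspace_all fin]) (use b in auto)
    ultimately obtain v where v: "v \<in> I \<rightarrow>\<^sub>E carrier R" "v \<notin> lin_span (J \<union> D) I b"
      by (metis less_irrefl subsetI subset_antisym)
    let ?b = "b(x := v)"
    have x: "x \<notin> J \<union> D" using insert by auto
    have cong: "lin_indep (J \<union> D) I ?b = lin_indep (J \<union> D) I b" "lin_span (J \<union> D) I ?b = lin_span (J \<union> D) I b"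
      by (rule lin_indep_cong lin_span_cong; use x bP in fastforce)+
    have bC: "?b \<in> insert x (J \<union> D) \<rightarrow> I \<rightarrow>\<^sub>E carrier R"
    proof
      fix i assume "i \<in> insert x (J \<union> D)"
      then show "?b i \<in> I \<rightarrow>\<^sub>E carrier R"
        using v(1) funcset_mem[OF b(1), of i] by (cases "i = x") simp_all
    qed
    have "lin_indep (insert x (J \<union> D)) I ?b"
      using lin_indep_insert[OF fin x bC] cong b v by simp
    moreover have "\<forall>j\<in>J. ?b j = c j" using b x by auto
    ultimately show ?case unfolding Un_insert_right using bC by (intro exI[of _ ?b] conjI)
  qed
  from this[of "I - J"] I J show ?thesis by (simp add: Un_absorb1)
qed

text \<open>A linear map \<open>g\<close> may be prescribed freely on an independent family \<open>c\<close>. Indeed, after extending \<open>c\<close>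
  to a basis \<open>b\<close>, the map that sends \<open>g\<close> to its values on \<open>b\<close> is injective on a finite set, hence
  bijective. In probabilistic terms, the values of a uniformly random linear map at independent
  arguments are independent and uniform.\<close>

lemma card_prescribed:
  assumes I: "finite I" and X: "finite X" and J: "J \<subseteq> I"
    and c: "c \<in> J \<rightarrow> I \<rightarrow>\<^sub>E carrier R" and ind: "lin_indep J I c"
    and y: "y \<in> J \<rightarrow> X \<rightarrow>\<^sub>E carrier R"
  shows "card {g \<in> I \<rightarrow>\<^sub>E (X \<rightarrow>\<^sub>E carrier R). \<forall>j\<in>J. lin_comb I X (c j) g = y j} =
     q ^ (card X * (card I - card J))"
proof -
  let ?V = "X \<rightarrow>\<^sub>E carrier R"
  obtain b where b: "b \<in> I \<rightarrow> I \<rightarrow>\<^sub>E carrier R" "lin_indep I I b" "\<And>j. j \<in> J \<Longrightarrow> b j = c j"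
    using lin_indep_extend[OF I J c ind] by blast
  have bP: "b \<in> I \<rightarrow> I \<rightarrow> carrier R" using b by auto
  have span: "lin_span I I b = I \<rightarrow>\<^sub>E carrier R"
    using card_lin_span[OF b(2) I bP] I card_vecs[OF I] finite_vecs[OF I] b(1)
    by (intro card_subset_eq lin_span_subset[OF is_subspace_all]) auto
  define \<Phi> where "\<Phi> = (\<lambda>g. \<lambda>i\<in>I. lin_comb I X (b i) g)"
  have inj: "inj_on \<Phi> (I \<rightarrow>\<^sub>E ?V)"
  proof (rule inj_onI)
    fix g g' assume g: "g \<in> I \<rightarrow>\<^sub>E ?V" and g': "g' \<in> I \<rightarrow>\<^sub>E ?V" and eq: "\<Phi> g = \<Phi> g'"
    have gP: "g \<in> I \<rightarrow> X \<rightarrow> carrier R" "g' \<in> I \<rightarrow> X \<rightarrow> carrier R" using g g' by auto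
    have eq': "lin_comb I X (b i) g = lin_comb I X (b i) g'" if "i \<in> I" for i
      using fun_cong[OF eq, of i] that by (simp add: \<Phi>_def)
    show "g = g'"
    proof (rule PiE_ext[OF g g'])
      fix l assume l: "l \<in> I"
      let ?e = "\<lambda>i\<in>I. if i = l then \<one> else \<zero>"
      have "?e \<in> lin_span I I b" unfolding span by auto
      then obtain a where a: "a \<in> I \<rightarrow>\<^sub>E carrier R" "?e = lin_comb I I a b" by (auto simp: lin_span_def)
      have "g l = lin_comb I X ?e g" using g l by (intro lin_comb_unit[OF I, symmetric]) auto
      also have "\<dots> = lin_comb I X a (\<lambda>i. lin_comb I X (b i) g)"
        unfolding a(2) using a(1) bP gP by (intro lin_comb_assoc I) auto
      also have "\<dots> = lin_comb I X a (\<lambda>i. lin_comb I X (b i) g')"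
      proof (rule lin_comb_cong)
        show "(\<lambda>i. lin_comb I X (b i) g') \<in> I \<rightarrow> X \<rightarrow> carrier R"
        proof
          fix i assume "i \<in> I"
          then have "lin_comb I X (b i) g' \<in> ?V" using bP gP by (intro lin_comb_closed) auto
          then show "lin_comb I X (b i) g' \<in> X \<rightarrow> carrier R" by (simp add: PiE_def)
        qed
      qed (use a eq' in auto)
      also have "\<dots> = lin_comb I X ?e g'"
        unfolding a(2) using a(1) bP gP by (intro lin_comb_assoc[symmetric] I) auto
      also have "\<dots> = g' l" using g' l by (intro lin_comb_unit[OF I]) auto
      finally show "g l = g' l" .
    qed
  qed
  have sub: "\<Phi> ` (I \<rightarrow>\<^sub>E ?V) \<subseteq> I \<rightarrow>\<^sub>E ?V"
  proof (rule image_subsetI)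
    fix g assume "g \<in> I \<rightarrow>\<^sub>E ?V"
    then show "\<Phi> g \<in> I \<rightarrow>\<^sub>E ?V"
      unfolding \<Phi>_def restrict_PiE_iff using bP by (intro ballI lin_comb_closed) auto
  qed
  have finV: "finite (I \<rightarrow>\<^sub>E ?V)" using I X finite_vecs by (intro finite_PiE) auto
  have surj: "\<Phi> ` (I \<rightarrow>\<^sub>E ?V) = I \<rightarrow>\<^sub>E ?V" by (rule endo_inj_surj[OF finV sub inj])
  let ?S = "{g \<in> I \<rightarrow>\<^sub>E ?V. \<forall>j\<in>J. lin_comb I X (c j) g = y j}"
  have P: "(\<forall>j\<in>J. lin_comb I X (c j) g = y j) \<longleftrightarrow> (\<forall>j\<in>J. \<Phi> g j = y j)" for g
    using J b(3) by (auto simp: \<Phi>_def)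
  have "?S = {g \<in> I \<rightarrow>\<^sub>E ?V. \<forall>j\<in>J. \<Phi> g j = y j}" using P by blast
  then have "\<Phi> ` ?S = {z \<in> \<Phi> ` (I \<rightarrow>\<^sub>E ?V). \<forall>j\<in>J. z j = y j}" by blast
  also have "\<dots> = (\<Pi>\<^sub>E i\<in>I. if i \<in> J then {y i} else ?V)"
    unfolding surj
  proof (intro equalityI subsetI)
    fix z assume z: "z \<in> {z \<in> I \<rightarrow>\<^sub>E ?V. \<forall>j\<in>J. z j = y j}"
    then show "z \<in> (\<Pi>\<^sub>E i\<in>I. if i \<in> J then {y i} else ?V)"
      by (simp only: mem_Collect_eq PiE_iff[of _ I]) auto
  next
    fix z assume z: "z \<in> (\<Pi>\<^sub>E i\<in>I. if i \<in> J then {y i} else ?V)"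
    then have zi: "z i \<in> (if i \<in> J then {y i} else ?V)" if "i \<in> I" for i
      using that by (rule PiE_mem)
    have zj: "z j = y j" if "j \<in> J" for j using zi[of j] that J by auto
    have "z i \<in> ?V" if "i \<in> I" for i
      using zi[OF that] y zj by (cases "i \<in> J") auto
    then show "z \<in> {z \<in> I \<rightarrow>\<^sub>E ?V. \<forall>j\<in>J. z j = y j}"
      using zj z by (simp only: mem_Collect_eq PiE_iff[of _ I]) auto
  qed
  finally have "card (\<Phi> ` ?S) = (\<Prod>i\<in>I. card (if i \<in> J then {y i} else ?V))"
    using I by (simp add: card_PiE)
  also have "\<dots> = (\<Prod>i\<in>I. if i \<in> J then 1 else q ^ card X)"
    using X by (intro prod.cong) (auto simp: card_vecs)
  also have "\<dots> = (q ^ card X) ^ card (I - J)"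
    using I by (simp add: prod.If_cases Diff_eq)
  also have "card (I - J) = card I - card J"
    using J I by (simp add: card_Diff_subset finite_subset)
  finally have "card (\<Phi> ` ?S) = q ^ (card X * (card I - card J))" by (simp add: power_mult)
  moreover have "card (\<Phi> ` ?S) = card ?S"
    by (rule card_image, rule inj_on_subset[OF inj]) auto
  ultimately show ?thesis by simp
qed

end

section \<open>Dimension, rank and density\<close>

text \<open>All dimensions are expressed by cardinalities.\<close>

lemma (in vectorspace) card_eq_power_dim:
  assumes "finite (carrier V)"
  shows "card (carrier V) = card (carrier K) ^ dim"
proof -
  have "gen_set (carrier V)"
    using span_is_subset2[of "carrier V"] in_own_span[of "carrier V"] by blast
  then have "fin_dim" unfolding fin_dim_def using assms by blast
  then obtain A where A: "finite A" "basis A" using finite_basis_exists by blast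
  then have AV: "A \<subseteq> carrier V" by (simp add: basis_def)
  have ex1: "\<exists>!a. a \<in> A \<rightarrow>\<^sub>E carrier K \<and> lincomb a A = v" if "v \<in> carrier V" for v
    using basis_criterion[OF A(1) AV] A(2) that by blast
  have "bij_betw (\<lambda>a. lincomb a A) (A \<rightarrow>\<^sub>E carrier K) (carrier V)"
    unfolding bij_betw_def
  proof (intro conjI inj_onI equalityI subsetI)
    fix a b assume ab: "a \<in> A \<rightarrow>\<^sub>E carrier K" "b \<in> A \<rightarrow>\<^sub>E carrier K" "lincomb a A = lincomb b A"
    have "lincomb a A \<in> carrier V" using AV ab by (intro lincomb_closed) auto
    from ex1[OF this] ab show "a = b" by metis
  next
    fix v assume "v \<in> (\<lambda>a. lincomb a A) ` (A \<rightarrow>\<^sub>E carrier K)"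
    then obtain a where a: "v = lincomb a A" "a \<in> A \<rightarrow>\<^sub>E carrier K" by blast
    show "v \<in> carrier V" unfolding a(1) using AV a(2) by (intro lincomb_closed) auto
  next
    fix v assume "v \<in> carrier V"
    from ex1[OF this] show "v \<in> (\<lambda>a. lincomb a A) ` (A \<rightarrow>\<^sub>E carrier K)" by blast
  qed
  then have "card (carrier V) = card (A \<rightarrow>\<^sub>E carrier K)" by (metis bij_betw_same_card)
  also have "\<dots> = card (carrier K) ^ card A" using A by (simp add: card_funcsetE)
  also have "card A = dim" using dim_basis[OF A] by simp
  finally show ?thesis .
qed

context finite_field
begin

lemma func_space_vectorspace: "vectorspace R (func_space X)"
  using func_space_is_module[of X] field_axioms
  by (simp add: vectorspace_def)

lemma func_space_simps:
  "carrier (func_space X) = X \<rightarrow>\<^sub>E carrier R" "\<zero>\<^bsub>func_space X\<^esub> = zero_vec X"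
  "u \<oplus>\<^bsub>func_space X\<^esub> v = (\<lambda>x\<in>X. u x \<oplus> v x)" "s \<odot>\<^bsub>func_space X\<^esub> v = (\<lambda>x\<in>X. s \<otimes> v x)"
  by (simp_all add: func_space_def zero_vec_def)

lemma submodule_iff_is_subspace: "submodule R W (func_space X) \<longleftrightarrow> is_subspace X W"
  unfolding submodule_def is_subspace_def func_space_simps
  using func_space_is_module[of X] by blast

lemma subspace_iff_is_subspace: "subspace R W (func_space X) \<longleftrightarrow> is_subspace X W"
  unfolding subspace_def submodule_iff_is_subspace using func_space_vectorspace by blast

lemma card_is_subspace:
  assumes "is_subspace X W" "finite X"
  shows "card W = q ^ vectorspace.dim R ((func_space X)\<lparr>carrier := W\<rparr>)"
proof -
  interpret V: vectorspace R "func_space X" by (rule func_space_vectorspace)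
  interpret W: vectorspace R "(func_space X)\<lparr>carrier := W\<rparr>"
    using assms(1) by (intro V.subspace_is_vs) (simp add: subspace_iff_is_subspace)
  show ?thesis using W.card_eq_power_dim is_subspace_finite[OF assms] by simp
qed

lemma dim_eq_iff:
  assumes "is_subspace X W" "finite X"
  shows "vectorspace.dim R ((func_space X)\<lparr>carrier := W\<rparr>) = k \<longleftrightarrow> card W = q ^ k"
  using card_is_subspace[OF assms] q_ge_2 by (simp add: power_inject_exp)

text \<open>The column space of an \<open>n \<times> m\<close> matrix, whose dimension is the rank by definition.\<close>

definition colspan :: "nat \<Rightarrow> nat \<Rightarrow> (nat \<times> nat \<Rightarrow> 'a) \<Rightarrow> (nat \<Rightarrow> 'a) set" where
  "colspan n m M = module.span R (func_space {..<n}) (mat_col n M ` {..<m})"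

lemma mat_col_closed:
  "M \<in> {..<n} \<times> {..<m} \<rightarrow>\<^sub>E carrier R \<Longrightarrow> j < m \<Longrightarrow> mat_col n M j \<in> {..<n} \<rightarrow>\<^sub>E carrier R"
  by (auto simp: mat_col_def)

lemma colspan:
  assumes M: "M \<in> {..<n} \<times> {..<m} \<rightarrow>\<^sub>E carrier R"
  shows "is_subspace {..<n} (colspan n m M)" (is ?A)
    and "j < m \<Longrightarrow> mat_col n M j \<in> colspan n m M" (is "_ \<Longrightarrow> ?B")
    and "card (colspan n m M) = q ^ mat_rank R n m M" (is ?C)
    and "is_subspace {..<n} W \<Longrightarrow> (\<And>j. j < m \<Longrightarrow> mat_col n M j \<in> W) \<Longrightarrow> colspan n m M \<subseteq> W"
proof -
  interpret V: vectorspace R "func_space {..<n}" by (rule func_space_vectorspace)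
  have sub: "mat_col n M ` {..<m} \<subseteq> carrier (func_space {..<n})"
    unfolding func_space_simps using mat_col_closed[OF M] by auto
  show A: ?A
    using V.span_is_submodule[OF sub] by (simp add: submodule_iff_is_subspace colspan_def)
  show ?B if "j < m"
    using V.in_own_span[OF sub] that by (auto simp: colspan_def)
  show ?C
    using card_is_subspace[OF A] by (simp add: mat_rank_def colspan_def Let_def)
  show "colspan n m M \<subseteq> W" if "is_subspace {..<n} W" "\<And>j. j < m \<Longrightarrow> mat_col n M j \<in> W" 
    unfolding colspan_def
    by (rule V.span_is_subset) (use that in \<open>auto simp: submodule_iff_is_subspace\<close>)
qed

lemma mat_rank_le:
  assumes M: "M \<in> {..<n} \<times> {..<m} \<rightarrow>\<^sub>E carrier R"
    and W: "is_subspace {..<n} W" "card W \<le> q ^ r" and col: "\<And>j. j < m \<Longrightarrow> mat_col n M j \<in> W"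
  shows "mat_rank R n m M \<le> r"
proof -
  have "card (colspan n m M) \<le> card W"
    using colspan(4)[OF M W(1) col] is_subspace_finite[OF W(1)] by (intro card_mono) auto
  then have "q ^ mat_rank R n m M \<le> q ^ r" using colspan(3)[OF M] W(2) by simp
  then show ?thesis using q_ge_2 by (simp add: power_le_imp_le_exp)
qed

lemma mat_rank_pos:
  assumes M: "M \<in> {..<n} \<times> {..<m} \<rightarrow>\<^sub>E carrier R" and nz: "M \<noteq> zero_vec ({..<n} \<times> {..<m})"
  shows "mat_rank R n m M \<ge> 1"
proof (rule ccontr)
  assume "\<not> mat_rank R n m M \<ge> 1"
  then have "card (colspan n m M) = 1" using colspan(3)[OF M] by simp
  then obtain z where z: "colspan n m M = {z}" by (auto simp: card_1_singleton_iff)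
  moreover have "zero_vec {..<n} \<in> colspan n m M" using colspan(1)[OF M] by (simp add: is_subspace_def)
  ultimately have col: "mat_col n M j = zero_vec {..<n}" if "j < m" for j
    using colspan(2)[OF M that] by auto
  have "M = zero_vec ({..<n} \<times> {..<m})"
  proof (rule PiE_ext[OF M zero_vec_closed])
    fix p assume "p \<in> {..<n} \<times> {..<m}"
    then obtain i j where p: "p = (i, j)" "i < n" "j < m" by auto
    then have "mat_col n M j i = zero_vec {..<n} i" using col by simp
    then show "M p = zero_vec ({..<n} \<times> {..<m}) p" using p by (simp add: mat_col_def)
  qed
  with nz show False by simp
qed

lemma mat_space_eq: "mat_space R n m = func_space ({..<n} \<times> {..<m})"
  by (simp add: mat_space_def)

lemma min_distance_ge_iff:
  assumes C: "is_subspace ({..<n} \<times> {..<m}) C" "card C > 1"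
  shows "min_distance R n m C \<ge> d \<longleftrightarrow>
    (\<forall>M\<in>C. M \<noteq> zero_vec ({..<n} \<times> {..<m}) \<longrightarrow> d \<le> mat_rank R n m M)"
proof -
  let ?X = "{..<n} \<times> {..<m}"
  let ?S = "{mat_rank R n m M | M. M \<in> C \<and> M \<noteq> zero_vec ?X}"
  have fin: "finite C" using is_subspace_finite[OF C(1)] by simp
  have "\<not> C \<subseteq> {zero_vec ?X}" using card_mono[of "{zero_vec ?X}" C] C(2) by auto
  then have ne: "?S \<noteq> {}" by auto
  have "finite ?S" using fin by (simp add: setcompr_eq_image)
  then have "min_distance R n m C \<ge> d \<longleftrightarrow> (\<forall>s\<in>?S. d \<le> s)"
    unfolding min_distance_def mat_space_eq func_space_simps using ne by (rule Min_ge_iff)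
  then show ?thesis by blast
qed

text \<open>For \<open>k \<le> m * n\<close> the denominator is the number of all independent \<open>k\<close>-tuples of matrices, so the density
  is the proportion of those whose span has minimum distance at least \<open>d\<close>.\<close>

lemma density_eq:
  assumes k: "k \<ge> 1"
  shows "rank_metric_density R n m k d =
    real (card {g \<in> {..<k} \<rightarrow>\<^sub>E ({..<n} \<times> {..<m} \<rightarrow>\<^sub>E carrier R). lin_indep {..<k} ({..<n} \<times> {..<m}) g \<and>
      (\<forall>M \<in> lin_span {..<k} ({..<n} \<times> {..<m}) g. M \<noteq> zero_vec ({..<n} \<times> {..<m}) \<longrightarrow> d \<le> mat_rank R n m M)})
    / (\<Prod>i<k. real q ^ (m * n) - real q ^ i)"
    (is "_ = real (card ?B) / _")
proof -
  let ?X = "{..<n} \<times> {..<m}"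
  let ?P = "\<lambda>C. \<forall>M\<in>C. M \<noteq> zero_vec ?X \<longrightarrow> d \<le> mat_rank R n m M"
  have qk: "q ^ k > 1" using k q_ge_2 by (intro one_less_power) auto
  have "{C. subspace R C (mat_space R n m)
          \<and> vectorspace.dim R ((mat_space R n m)\<lparr>carrier := C\<rparr>) = k
          \<and> min_distance R n m C \<ge> d} = {C. is_subspace ?X C \<and> card C = q ^ k \<and> ?P C}" (is "?L = ?A")
    unfolding mat_space_eq subspace_iff_is_subspace
  proof (rule Collect_cong)
    fix C
    show "is_subspace ?X C \<and> vectorspace.dim R ((func_space ?X)\<lparr>carrier := C\<rparr>) = k \<and> min_distance R n m C \<ge> d
      \<longleftrightarrow> is_subspace ?X C \<and> card C = q ^ k \<and> ?P C"
    proof (cases "is_subspace ?X C \<and> card C = q ^ k")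
      case True
      then show ?thesis
        using dim_eq_iff[of ?X C k] min_distance_ge_iff[of n m C d] qk by simp
    next
      case False
      then show ?thesis using dim_eq_iff[of ?X C k] by auto
    qed
  qed
  then have dens: "rank_metric_density R n m k d = real (card ?A) / q_binomial q (m * n) k"
    unfolding rank_metric_density_def by simp
  have pos: "real q ^ k - real q ^ i > 0" if "i < k" for i
    using that q_ge_2 by simp
  have "(\<Prod>i<k. real q ^ k - real q ^ i) > 0"
    by (rule prod_pos) (use pos in auto)
  then have nz: "(\<Prod>i<k. real q ^ k - real q ^ i) \<noteq> 0" by (rule less_imp_neq[symmetric])
  have "real (card ?B) = real (card ?A * (\<Prod>i<k. q ^ k - q ^ i))"
    using card_subspaces[of ?X k ?P] by simp
  also have "\<dots> = real (card ?A) * (\<Prod>i<k. real q ^ k - real q ^ i)"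
    using q_ge_2 by (simp add: of_nat_diff)
  finally have "real (card ?A) = real (card ?B) / (\<Prod>i<k. real q ^ k - real q ^ i)"
    using nz by (simp add: field_simps)
  then show ?thesis unfolding dens q_binomial_def prod_dividef using nz by simp
qed

lemma lin_indep_nonzero:
  assumes "lin_indep I X g" "finite I" "i \<in> I" "g \<in> I \<rightarrow> X \<rightarrow>\<^sub>E carrier R"
  shows "g i \<noteq> zero_vec X"
proof
  assume eq: "g i = zero_vec X"
  have u: "(\<lambda>l\<in>I. if l = i then \<one> else \<zero>) \<in> I \<rightarrow>\<^sub>E carrier R" (is "?u \<in> _") by auto
  have "lin_comb I X ?u g = zero_vec X" using lin_comb_unit[OF assms(2,3,4)] eq by simp
  then have "?u = zero_vec I" using assms(1) u unfolding lin_indep_def by blast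
  then have "?u i = zero_vec I i" by (rule fun_cong)
  then show False using assms(3) by simp
qed

text \<open>Matrices of rank at most \<open>r\<close>: choose the first \<open>r\<close> rows \<open>T\<close> independent and the other \<open>n - r\<close>
  rows as arbitrary combinations of them, with coefficients \<open>L\<close>. The columns lie in the graph of \<open>L\<close>,
  which has \<open>q ^ r\<close> elements.\<close>

lemma card_low_rank:
  assumes r: "1 \<le> r" "r \<le> n" 
  shows "q ^ (r * (n - r)) * (\<Prod>i<r. q ^ m - q ^ i) \<le>
    card {M \<in> {..<n} \<times> {..<m} \<rightarrow>\<^sub>E carrier R. M \<noteq> zero_vec ({..<n} \<times> {..<m}) \<and> mat_rank R n m M \<le> r}"
    (is "_ \<le> card ?S")
proof -
  let ?X = "{..<n} \<times> {..<m}"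
  let ?T = "{T \<in> {..<r} \<rightarrow>\<^sub>E ({..<m} \<rightarrow>\<^sub>E carrier R). lin_indep {..<r} {..<m} T}"
  let ?L = "{r..<n} \<rightarrow>\<^sub>E ({..<r} \<rightarrow>\<^sub>E carrier R)"
  define f where "f = (\<lambda>(L, T). \<lambda>(i, j)\<in>?X. if i < r then T i j else lin_comb {..<r} {..<m} (L i) T j)"
  have f_app: "f (L, T) (i, j) = (if i < r then T i j else lin_comb {..<r} {..<m} (L i) T j)"
    if "i < n" "j < m" for L T i j using that by (simp add: f_def)
  have lcC: "lin_comb {..<r} {..<m} (L i) T \<in> {..<m} \<rightarrow>\<^sub>E carrier R"
    if "L \<in> ?L" "T \<in> ?T" "r \<le> i" "i < n" for L T i
    using that by (intro lin_comb_closed) auto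
  have f_closed: "f (L, T) \<in> ?X \<rightarrow>\<^sub>E carrier R" if LT: "L \<in> ?L" "T \<in> ?T" for L T
  proof (rule PiE_I)
    fix p assume "p \<in> ?X"
    then obtain i j where p: "p = (i, j)" "i < n" "j < m" by auto
    show "f (L, T) p \<in> carrier R"
    proof (cases "i < r")
      case True
      then show ?thesis using LT p by (auto simp: f_app)
    next
      case False
      then show ?thesis using PiE_mem[OF lcC[OF LT, of i], of j] p by (simp add: f_app)
    qed
  qed (simp add: f_def)
  have sub: "f ` (?L \<times> ?T) \<subseteq> ?S"
  proof (rule image_subsetI)
    fix x assume "x \<in> ?L \<times> ?T"
    then obtain L T where x: "x = (L, T)" and L: "L \<in> ?L"
      and T: "T \<in> {..<r} \<rightarrow>\<^sub>E ({..<m} \<rightarrow>\<^sub>E carrier R)" and ind: "lin_indep {..<r} {..<m} T" by blast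
    have cl: "f (L, T) \<in> ?X \<rightarrow>\<^sub>E carrier R" using f_closed L T ind by blast
    have Tc: "T i j \<in> carrier R" if "i < r" "j < m" for i j using T that by auto
    have Lc: "L i l \<in> carrier R" if "r \<le> i" "i < n" "l < r" for i l using L that by auto
    have "f (L, T) \<noteq> zero_vec ?X"
    proof
      assume z: "f (L, T) = zero_vec ?X"
      have "T 0 j = zero_vec {..<m} j" if "j \<in> {..<m}" for j
        using fun_cong[OF z, of "(0, j)"] that r by (simp add: f_app)
      then have "T 0 = zero_vec {..<m}"
        using T r by (intro PiE_ext[of _ _ "\<lambda>_. carrier R", OF _ zero_vec_closed]) auto
      then show False using lin_indep_nonzero[OF ind, of 0] T r by auto
    qed
    moreover have "mat_rank R n m (f (L, T)) \<le> r"
    proof (rule mat_rank_le[OF cl])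
      define G where "G = (\<lambda>l. \<lambda>i\<in>{..<n}. if i < r then (if i = l then \<one> else \<zero>) else L i l)"
      have G: "G \<in> {..<r} \<rightarrow> {..<n} \<rightarrow> carrier R" using Lc by (auto simp: G_def)
      let ?W = "lin_span {..<r} {..<n} G"
      show "is_subspace {..<n} ?W" using G by (intro is_subspace_lin_span) auto
      have "card ?W \<le> card ({..<r} \<rightarrow>\<^sub>E carrier R)"
        unfolding lin_span_def by (rule card_image_le[OF finite_vecs]) simp
      then show "card ?W \<le> q ^ r" by (simp add: card_vecs)
      fix j assume j: "j < m"
      have a: "(\<lambda>l\<in>{..<r}. T l j) \<in> {..<r} \<rightarrow>\<^sub>E carrier R" using Tc j by auto
      have "mat_col n (f (L, T)) j = lin_comb {..<r} {..<n} (\<lambda>l\<in>{..<r}. T l j) G"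
        unfolding mat_col_def lin_comb_def
      proof (rule restrict_ext)
        fix i assume i: "i \<in> {..<n}"
        show "f (L, T) (i, j) = (\<Oplus>l\<in>{..<r}. (\<lambda>l\<in>{..<r}. T l j) l \<otimes> G l i)"
        proof (cases "i < r")
          case True
          have "(\<Oplus>l\<in>{..<r}. (\<lambda>l\<in>{..<r}. T l j) l \<otimes> G l i) = (\<Oplus>l\<in>{..<r}. if i = l then T l j else \<zero>)"
            using i j True Tc by (intro finsum_cong') (auto simp: G_def)
          also have "\<dots> = T i j"
            using i j True Tc by (intro finsum_singleton) auto
          finally show ?thesis using i j True by (simp add: f_app)
        next
          case False
          have "(\<Oplus>l\<in>{..<r}. (\<lambda>l\<in>{..<r}. T l j) l \<otimes> G l i) = (\<Oplus>l\<in>{..<r}. L i l \<otimes> T l j)"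
            using i j False Tc Lc by (intro finsum_cong') (auto simp: G_def m_comm)
          then show ?thesis using i j False by (simp add: f_app lin_comb_def)
        qed
      qed
      then show "mat_col n (f (L, T)) j \<in> ?W" using lin_spanI[OF a] by simp
    qed
    ultimately show "f x \<in> ?S" using cl x by simp
  qed
  have inj: "inj_on f (?L \<times> ?T)"
  proof (rule inj_onI, clarify)
    fix L T L' T'
    assume L: "L \<in> ?L" "L' \<in> ?L" and T: "T \<in> {..<r} \<rightarrow>\<^sub>E ({..<m} \<rightarrow>\<^sub>E carrier R)"
      "T' \<in> {..<r} \<rightarrow>\<^sub>E ({..<m} \<rightarrow>\<^sub>E carrier R)" and ind: "lin_indep {..<r} {..<m} T" "lin_indep {..<r} {..<m} T'"
      and eq: "f (L, T) = f (L', T')"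
    have "T i = T' i" if i: "i \<in> {..<r}" for i
    proof (rule PiE_ext[of _ "{..<m}" "\<lambda>_. carrier R"])
      fix j assume "j \<in> {..<m}"
      then show "T i j = T' i j" using fun_cong[OF eq, of "(i, j)"] i r by (simp add: f_app)
    qed (use T i in auto)
    then have TT: "T = T'" using PiE_ext[OF T] by blast
    have "L i = L' i" if i: "i \<in> {r..<n}" for i
    proof -
      have "lin_comb {..<r} {..<m} (L i) T = lin_comb {..<r} {..<m} (L' i) T"
      proof (rule PiE_ext[of _ "{..<m}" "\<lambda>_. carrier R"])
        fix j assume "j \<in> {..<m}"
        then show "lin_comb {..<r} {..<m} (L i) T j = lin_comb {..<r} {..<m} (L' i) T j"
          using fun_cong[OF eq, of "(i, j)"] i r by (simp add: f_app TT)
      qed (use lcC[of _ T i] L T ind i in auto)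
      moreover have "L i \<in> {..<r} \<rightarrow>\<^sub>E carrier R" "L' i \<in> {..<r} \<rightarrow>\<^sub>E carrier R"
        using PiE_mem[OF L(1) i] PiE_mem[OF L(2) i] by auto
      ultimately show ?thesis
        using lin_indep_inj[OF ind(1)] T(1) by (auto simp: inj_on_def)
    qed
    then have "L = L'" using PiE_ext[OF L] by blast
    with TT show "L = L' \<and> T = T'" by simp
  qed
  have "card (?L \<times> ?T) = card (f ` (?L \<times> ?T))" by (rule card_image[OF inj, symmetric])
  also have "\<dots> \<le> card ?S"
    by (rule card_mono[OF _ sub]) (use finite_vecs[of ?X] in simp)
  finally have "card (?L \<times> ?T) \<le> card ?S" .
  moreover have "card (?L \<times> ?T) = q ^ (r * (n - r)) * (\<Prod>i<r. q ^ m - q ^ i)"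
  proof -
    have "card ?T = (\<Prod>i<r. q ^ m - q ^ i)"
      using card_lin_indep[OF is_subspace_all, of "{..<m}" "{..<r}"] by (simp add: card_vecs)
    moreover have "card ?L = (q ^ r) ^ (n - r)"
      by (simp add: card_funcsetE card_vecs)
    ultimately show ?thesis by (simp only: card_cartesian_product power_mult)
  qed
  ultimately show ?thesis by simp
qed

end

section \<open>The second moment method\<close>

text \<open>Chebyshev's inequality for the number \<open>Y g\<close> of events \<open>P g c\<close> that occur at the uniformly random
  point \<open>g\<close> of \<open>G\<close>, when each event has probability \<open>p\<close> and each is almost independent of most of the
  others: with mean \<open>\<mu> = card T * p\<close>, the variance is at most \<open>a * \<mu>\<close>, so that no event occurs with
  probability at most \<open>a / \<mu>\<close>.\<close>

lemma second_moment_bound: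
  fixes P :: "'g \<Rightarrow> 'c \<Rightarrow> bool" and a p :: real
  assumes G: "finite G" and T: "finite T" and p: "p \<ge> 0" and a: "a \<ge> 0"
    and one: "\<And>c. c \<in> T \<Longrightarrow> real (card {g \<in> G. P g c}) = p * card G"
    and two: "\<And>c. c \<in> T \<Longrightarrow> (\<Sum>c'\<in>T. real (card {g \<in> G. P g c \<and> P g c'})) \<le>
                a * p * card G + card T * p\<^sup>2 * card G"
  shows "real (card {g \<in> G. \<forall>c\<in>T. \<not> P g c}) * (card T * p) \<le> a * card G"
proof -
  define Y where "Y = (\<lambda>g. \<Sum>c\<in>T. of_bool (P g c) :: real)"
  define \<mu> where "\<mu> = card T * p"
  let ?D = "real (card G)"
  let ?Q = "{g \<in> G. \<forall>c\<in>T. \<not> P g c}"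
  have cnt: "(\<Sum>g\<in>G. of_bool (R g) :: real) = card {g \<in> G. R g}" for R
    using G by (simp add: sum_of_bool_eq Int_def)
  have "(\<Sum>g\<in>G. Y g) = (\<Sum>c\<in>T. \<Sum>g\<in>G. of_bool (P g c))"
    unfolding Y_def by (rule sum.swap)
  also have "\<dots> = \<mu> * ?D" by (simp add: cnt one \<mu>_def)
  finally have sum1: "(\<Sum>g\<in>G. Y g) = \<mu> * ?D" .
  have "(\<Sum>g\<in>G. (Y g)\<^sup>2) = (\<Sum>g\<in>G. \<Sum>c\<in>T. \<Sum>c'\<in>T. of_bool (P g c \<and> P g c'))"
    unfolding Y_def power2_eq_square sum_product by (simp add: of_bool_conj)
  also have "\<dots> = (\<Sum>c\<in>T. \<Sum>g\<in>G. \<Sum>c'\<in>T. of_bool (P g c \<and> P g c'))"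
    by (rule sum.swap)
  also have "\<dots> = (\<Sum>c\<in>T. \<Sum>c'\<in>T. \<Sum>g\<in>G. of_bool (P g c \<and> P g c'))"
    by (intro sum.cong refl sum.swap)
  also have "\<dots> = (\<Sum>c\<in>T. \<Sum>c'\<in>T. real (card {g \<in> G. P g c \<and> P g c'}))"
    by (simp only: cnt)
  also have "\<dots> \<le> (\<Sum>c\<in>T. a * p * ?D + card T * p\<^sup>2 * ?D)"
    by (intro sum_mono two)
  also have "\<dots> = a * \<mu> * ?D + \<mu>\<^sup>2 * ?D"
    by (simp add: \<mu>_def algebra_simps power2_eq_square)
  finally have sum2: "(\<Sum>g\<in>G. (Y g)\<^sup>2) \<le> a * \<mu> * ?D + \<mu>\<^sup>2 * ?D" .
  have "real (card ?Q) * \<mu>\<^sup>2 = (\<Sum>g\<in>?Q. (Y g - \<mu>)\<^sup>2)"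
    by (simp add: Y_def)
  also have "\<dots> \<le> (\<Sum>g\<in>G. (Y g - \<mu>)\<^sup>2)"
    using G by (intro sum_mono2) auto
  also have "\<dots> = (\<Sum>g\<in>G. (Y g)\<^sup>2) - 2 * \<mu> * (\<Sum>g\<in>G. Y g) + \<mu>\<^sup>2 * ?D"
  proof -
    have "(\<Sum>g\<in>G. (Y g - \<mu>)\<^sup>2) = (\<Sum>g\<in>G. (Y g)\<^sup>2 - 2 * \<mu> * Y g + \<mu>\<^sup>2)"
      by (intro sum.cong refl) (simp add: power2_diff)
    also have "\<dots> = (\<Sum>g\<in>G. (Y g)\<^sup>2) - (\<Sum>g\<in>G. 2 * \<mu> * Y g) + (\<Sum>g\<in>G. \<mu>\<^sup>2)"
      by (simp only: sum.distrib sum_subtractf)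
    also have "(\<Sum>g\<in>G. 2 * \<mu> * Y g) = 2 * \<mu> * (\<Sum>g\<in>G. Y g)"
      by (rule sum_distrib_left[symmetric])
    also have "(\<Sum>g\<in>G. \<mu>\<^sup>2) = \<mu>\<^sup>2 * ?D" by simp
    finally show ?thesis .
  qed
  also have "\<dots> \<le> a * \<mu> * ?D"
    using sum2 by (simp add: sum1 algebra_simps power2_eq_square)
  finally have *: "real (card ?Q) * \<mu>\<^sup>2 \<le> a * \<mu> * ?D" .
  show ?thesis
  proof (cases "\<mu> = 0")
    case True
    then have "card T * p = 0" by (simp add: \<mu>_def)
    then show ?thesis using a by (simp only: mult_zero_right) simp
  next
    case False
    moreover have "\<mu> \<ge> 0" using p by (simp add: \<mu>_def)
    ultimately have "\<mu> > 0" by linarith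
    moreover have "\<mu> * (real (card ?Q) * \<mu>) \<le> \<mu> * (a * ?D)"
      using * by (simp add: power2_eq_square ac_simps)
    ultimately have "real (card ?Q) * \<mu> \<le> a * ?D"
      by (rule mult_left_le_imp_le[rotated])
    then show ?thesis by (simp add: \<mu>_def)
  qed
qed

lemma card_vimage_sum:
  assumes "finite G" "finite S"
  shows "card {g \<in> G. h g \<in> S} = (\<Sum>u\<in>S. card {g \<in> G. h g = u})"
proof -
  have "{g \<in> G. h g \<in> S} = (\<Union>u\<in>S. {g \<in> G. h g = u})" by auto
  also have "card \<dots> = (\<Sum>u\<in>S. card {g \<in> G. h g = u})"
    using assms by (intro card_UN_disjoint) auto
  finally show ?thesis .
qed

context finite_field
begin

lemma lin_indep_empty: "lin_indep {} X g"
  by (auto simp: lin_indep_def zero_vec_def)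

lemma lin_span_empty: "lin_span {} X g = {zero_vec X}"
  by (simp add: lin_span_def lin_comb_def zero_vec_def)

lemma lin_span_single:
  assumes "g j \<in> X \<rightarrow> carrier R"
  shows "lin_span {j} X g = (\<lambda>s. \<lambda>x\<in>X. s \<otimes> g j x) ` carrier R"
proof -
  have lin_comb: "lin_comb {j} X a g = (\<lambda>x\<in>X. a j \<otimes> g j x)" if "a \<in> {j} \<rightarrow>\<^sub>E carrier R" for a
  proof -
    have aj: "a j \<in> carrier R" using that by auto
    have "(\<Oplus>i\<in>{j}. a i \<otimes> g i x) = a j \<otimes> g j x" if "x \<in> X" for x
      using aj assms that by (simp add: Pi_iff)
    then show ?thesis unfolding lin_comb_def by (intro restrict_ext)
  qed
  show ?thesis
  proof (intro equalityI subsetI)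
    fix v assume "v \<in> lin_span {j} X g"
    then show "v \<in> (\<lambda>s. \<lambda>x\<in>X. s \<otimes> g j x) ` carrier R"
      unfolding lin_span_def using lin_comb by (auto simp: PiE_mem)
  next
    fix v assume "v \<in> (\<lambda>s. \<lambda>x\<in>X. s \<otimes> g j x) ` carrier R"
    then obtain s where s: "s \<in> carrier R" "v = (\<lambda>x\<in>X. s \<otimes> g j x)" by blast
    have a: "(\<lambda>i\<in>{j}. s) \<in> {j} \<rightarrow>\<^sub>E carrier R" using s by auto
    have "v = lin_comb {j} X (\<lambda>i\<in>{j}. s) g" using lin_comb[OF a] s by simp
    then show "v \<in> lin_span {j} X g" using lin_spanI[OF a] by simp
  qed
qed

lemma lin_indep_single:
  assumes "g j \<in> X \<rightarrow>\<^sub>E carrier R" "g j \<noteq> zero_vec X"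
  shows "lin_indep {j} X g"
  using lin_indep_insert[of "{}" j g X] assms by (simp add: lin_indep_empty lin_span_empty)

lemma lin_indep_pair:
  assumes "i \<noteq> j" "g i \<in> X \<rightarrow>\<^sub>E carrier R" "g i \<noteq> zero_vec X" "g j \<in> X \<rightarrow>\<^sub>E carrier R"
    "g j \<notin> (\<lambda>s. \<lambda>x\<in>X. s \<otimes> g i x) ` carrier R"
  shows "lin_indep {j, i} X g"
proof -
  have "g \<in> insert j {i} \<rightarrow> X \<rightarrow>\<^sub>E carrier R" using assms by auto
  moreover have "lin_span {i} X g = (\<lambda>s. \<lambda>x\<in>X. s \<otimes> g i x) ` carrier R"
    by (rule lin_span_single) (use assms in auto)
  ultimately show ?thesis
    using lin_indep_insert[of "{i}" j g X] lin_indep_single[of g i X] assms by simp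
qed

lemma card_tuples: 
  "finite X \<Longrightarrow> card ({..<k} \<rightarrow>\<^sub>E (X \<rightarrow>\<^sub>E carrier R)) = q ^ (card X * k)"
  by (simp add: card_funcsetE card_vecs power_mult)

lemma card_tuples_one:
  fixes k :: nat
  assumes X: "finite X" and S: "S \<subseteq> X \<rightarrow>\<^sub>E carrier R"
    and k: "k \<ge> 1" and c: "c \<in> {..<k} \<rightarrow>\<^sub>E carrier R" "c \<noteq> zero_vec {..<k}"
  shows "card {g \<in> {..<k} \<rightarrow>\<^sub>E (X \<rightarrow>\<^sub>E carrier R). lin_comb {..<k} X c g \<in> S} = card S * q ^ (card X * (k - 1))"
    (is "card {g \<in> ?G. _} = _")
proof -
  have finS: "finite S" using S finite_vecs[OF X] by (rule finite_subset)
  have finG: "finite ?G" using X by (intro finite_PiE finite_vecs) auto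
  have ind: "lin_indep {0} {..<k} (\<lambda>_::nat. c)" using c by (intro lin_indep_single) auto
  have "card {g \<in> ?G. lin_comb {..<k} X c g = u} = q ^ (card X * (k - 1))" if "u \<in> S" for u
    using card_prescribed[OF _ X _ _ ind, of "\<lambda>_. u"] k c S that by auto
  then show ?thesis by (simp add: card_vimage_sum[OF finG finS])
qed

lemma card_tuples_two:
  fixes k :: nat
  assumes X: "finite X" and S: "S \<subseteq> X \<rightarrow>\<^sub>E carrier R"
    and k: "k \<ge> 2" and c: "c \<in> {..<k} \<rightarrow>\<^sub>E carrier R" "c \<noteq> zero_vec {..<k}" "c' \<in> {..<k} \<rightarrow>\<^sub>E carrier R"
      "c' \<notin> (\<lambda>s. \<lambda>x\<in>{..<k}. s \<otimes> c x) ` carrier R"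
  shows "card {g \<in> {..<k} \<rightarrow>\<^sub>E (X \<rightarrow>\<^sub>E carrier R). lin_comb {..<k} X c g \<in> S \<and> lin_comb {..<k} X c' g \<in> S} =
    (card S)\<^sup>2 * q ^ (card X * (k - 2))"
    (is "card {g \<in> ?G. _} = _")
proof -
  have finS: "finite S" using S finite_vecs[OF X] by (rule finite_subset)
  have finG: "finite ?G" using X by (intro finite_PiE finite_vecs) auto
  define cc where "cc = (\<lambda>i::nat. if i = 0 then c else c')"
  have cc: "cc 0 = c" "cc 1 = c'" by (auto simp: cc_def)
  have ind: "lin_indep {1, 0} {..<k} cc" by (rule lin_indep_pair) (use c cc in simp_all)
  have "card {g \<in> ?G. (lin_comb {..<k} X c g, lin_comb {..<k} X c' g) = uv} = q ^ (card X * (k - 2))"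
    if uv: "uv \<in> S \<times> S" for uv
  proof -
    obtain u v where uv': "uv = (u, v)" "u \<in> S" "v \<in> S" using uv by auto
    have "{g \<in> ?G. (lin_comb {..<k} X c g, lin_comb {..<k} X c' g) = uv} =
      {g \<in> ?G. \<forall>j\<in>{1, 0}. lin_comb {..<k} X (cc j) g = (if j = 0 then u else v)}"
      using uv' cc by auto
    also have "card \<dots> = q ^ (card X * (card {..<k} - card {1, 0::nat}))"
    proof (rule card_prescribed[OF _ X _ _ ind])
      show "cc \<in> {1, 0} \<rightarrow> {..<k} \<rightarrow>\<^sub>E carrier R" using c by (auto simp: cc_def simp del: PiE_iff)
      show "(\<lambda>j. if j = 0 then u else v) \<in> {1, 0} \<rightarrow> X \<rightarrow>\<^sub>E carrier R" using uv' S by auto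
    qed (use k in auto)
    finally show ?thesis by (simp add: numeral_2_eq_2)
  qed
  then have fib: "(\<Sum>uv\<in>S \<times> S. card {g \<in> ?G. (lin_comb {..<k} X c g, lin_comb {..<k} X c' g) = uv}) =
      (\<Sum>uv\<in>S \<times> S. q ^ (card X * (k - 2)))"
    by (rule sum.cong[OF refl])
  have "card {g \<in> ?G. lin_comb {..<k} X c g \<in> S \<and> lin_comb {..<k} X c' g \<in> S} =
      card {g \<in> ?G. (lin_comb {..<k} X c g, lin_comb {..<k} X c' g) \<in> S \<times> S}"
    by (simp only: mem_Times_iff fst_conv snd_conv)
  also have "\<dots> = (\<Sum>uv\<in>S \<times> S. card {g \<in> ?G. (lin_comb {..<k} X c g, lin_comb {..<k} X c' g) = uv})"
    by (rule card_vimage_sum[OF finG finite_cartesian_product[OF finS finS]])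
  also have "\<dots> = (card S)\<^sup>2 * q ^ (card X * (k - 2))"
    unfolding fib by (simp add: card_cartesian_product power2_eq_square)
  finally show ?thesis .
qed

text \<open>The second moment bound for a random linear map \<open>g\<close> on \<open>k\<close>-dimensional space and the events that
  \<open>g\<close> maps a given nonzero \<open>c\<close> into \<open>S\<close>. Events for non-proportional arguments are independent; the
  \<open>q - 1\<close> arguments proportional to \<open>c\<close> account for the factor \<open>q - 1\<close>.\<close>

lemma card_avoiding_le:
  fixes k :: nat
  assumes X: "finite X" and S: "S \<subseteq> X \<rightarrow>\<^sub>E carrier R" and k: "k \<ge> 2"
  shows "real (card {g \<in> {..<k} \<rightarrow>\<^sub>E (X \<rightarrow>\<^sub>E carrier R).
      \<forall>c \<in> {..<k} \<rightarrow>\<^sub>E carrier R. c \<noteq> zero_vec {..<k} \<longrightarrow> lin_comb {..<k} X c g \<notin> S})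
    * ((real q ^ k - 1) * (real (card S) / real q ^ card X)) \<le> (real q - 1) * real q ^ (card X * k)"
    (is "real (card ?Q) * _ \<le> _")
proof -
  let ?G = "{..<k} \<rightarrow>\<^sub>E (X \<rightarrow>\<^sub>E carrier R)"
  let ?T = "({..<k} \<rightarrow>\<^sub>E carrier R) - {zero_vec {..<k}}"
  let ?N = "real q ^ card X"
  define p where "p = real (card S) / ?N"
  have q0: "real q > 0" using q_ge_2 by simp
  have finS: "finite S" using S finite_vecs[OF X] by (rule finite_subset)
  have finG: "finite ?G" using X by (intro finite_PiE finite_vecs) auto
  have finT: "finite ?T" using finite_vecs[of "{..<k}"] by simp
  have cT: "real (card ?T) = real q ^ k - 1"
  proof -
    have "card ?T = q ^ k - 1" by (simp add: card_Diff_subset card_vecs)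
    then show ?thesis using q_ge_2 by (simp add: of_nat_diff)
  qed
  have cG: "real (card ?G) = ?N ^ k" using card_tuples[OF X, of k] by (simp add: power_mult)
  have N1: "?N ^ (k - 1) = ?N ^ k / ?N" "?N ^ (k - 2) = ?N ^ k / ?N\<^sup>2"
  proof -
    have N0: "?N \<noteq> 0" using zero_less_power[OF q0, of "card X"] by (rule less_imp_neq[symmetric])
    show "?N ^ (k - 1) = ?N ^ k / ?N" using power_diff[OF N0, of 1 k] k by simp
    show "?N ^ (k - 2) = ?N ^ k / ?N\<^sup>2" using power_diff[OF N0, of 2 k] k by simp
  qed
  have finA: "finite {g \<in> ?G. Q g}" for Q using finG by (rule rev_finite_subset) blast
  have one: "real (card {g \<in> ?G. lin_comb {..<k} X c g \<in> S}) = p * real (card ?G)" if "c \<in> ?T" for c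
  proof -
    have "real (card {g \<in> ?G. lin_comb {..<k} X c g \<in> S}) = real (card S * q ^ (card X * (k - 1)))"
      using card_tuples_one[OF X S, of k c] that k by simp
    also have "\<dots> = real (card S) * ?N ^ (k - 1)" by (simp only: of_nat_mult of_nat_power power_mult)
    also have "\<dots> = p * real (card ?G)"
      unfolding N1 cG p_def by (simp only: times_divide_eq_left times_divide_eq_right)
    finally show ?thesis .
  qed
  have "real (card {g \<in> ?G. \<forall>c\<in>?T. \<not> lin_comb {..<k} X c g \<in> S}) * (real (card ?T) * p)
      \<le> (real q - 1) * real (card ?G)"
  proof (rule second_moment_bound[OF finG finT _ _ one])
    show "p \<ge> 0" by (simp add: p_def)
    show "real q - 1 \<ge> 0" using q_ge_2 by simp
    fix c assume c: "c \<in> ?T"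
    let ?line = "(\<lambda>s. \<lambda>x\<in>{..<k}. s \<otimes> c x) ` (carrier R - {\<zero>})"
    let ?A = "{g \<in> ?G. lin_comb {..<k} X c g \<in> S}"
    let ?f = "\<lambda>c'. real (card {g \<in> ?G. lin_comb {..<k} X c g \<in> S \<and> lin_comb {..<k} X c' g \<in> S})"
    have cx: "c x \<in> carrier R" if "x < k" for x using c that by auto
    have "card ?line \<le> card (carrier R - {\<zero>})" by (rule card_image_le) simp
    also have "\<dots> = q - 1" by (simp add: card_Diff_subset)
    finally have line: "real (card ?line) \<le> real q - 1" using q_ge_2 by simp
    \<comment> \<open>The multiples of \<open>c\<close> are separated from the arguments that are independent of \<open>c\<close>.\<close>
    have split: "(\<Sum>c'\<in>?T. ?f c') = (\<Sum>c'\<in>?T \<inter> ?line. ?f c') + (\<Sum>c'\<in>?T - ?line. ?f c')"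
      by (rule sum.Int_Diff[OF finT])
    have "(\<Sum>c'\<in>?T \<inter> ?line. ?f c') \<le> (\<Sum>c'\<in>?T \<inter> ?line. p * card ?G)"
    proof (rule sum_mono)
      fix c'
      have "?f c' \<le> real (card ?A)"
        by (intro of_nat_mono card_mono finA) blast
      also have "\<dots> = p * card ?G" by (rule one[OF c])
      finally show "?f c' \<le> p * card ?G" .
    qed
    also have "\<dots> \<le> (real q - 1) * (p * card ?G)"
    proof -
      have "card (?T \<inter> ?line) \<le> card ?line" by (rule card_mono[OF _ Int_lower2]) simp
      then have "real (card (?T \<inter> ?line)) \<le> real q - 1" using line by linarith
      moreover have "p * card ?G \<ge> 0" by (simp add: p_def)
      ultimately have "real (card (?T \<inter> ?line)) * (p * card ?G) \<le> (real q - 1) * (p * card ?G)"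
        by (rule mult_right_mono)
      then show ?thesis by (simp only: sum_constant)
    qed
    finally have on_line: "(\<Sum>c'\<in>?T \<inter> ?line. ?f c') \<le> (real q - 1) * (p * card ?G)" .
    have "(\<Sum>c'\<in>?T - ?line. ?f c') \<le> (\<Sum>c'\<in>?T - ?line. p\<^sup>2 * card ?G)"
    proof (rule sum_mono)
      fix c' assume c': "c' \<in> ?T - ?line"
      have "c' \<notin> (\<lambda>s. \<lambda>x\<in>{..<k}. s \<otimes> c x) ` carrier R"
      proof
        assume "c' \<in> (\<lambda>s. \<lambda>x\<in>{..<k}. s \<otimes> c x) ` carrier R"
        then obtain s where s: "s \<in> carrier R" "c' = (\<lambda>x\<in>{..<k}. s \<otimes> c x)" by blast
        have "s = \<zero>"
        proof (rule ccontr)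
          assume "s \<noteq> \<zero>"
          then have "s \<in> carrier R - {\<zero>}" using s(1) by blast
          then have "c' \<in> ?line" unfolding s(2) by (rule imageI)
          then show False using c' by blast
        qed
        then have "s \<otimes> c x = \<zero>" if "x \<in> {..<k}" for x using cx that by simp
        then have "c' = zero_vec {..<k}" unfolding s(2) zero_vec_def by (intro restrict_ext)
        then show False using c' by blast
      qed
      then have "card {g \<in> ?G. lin_comb {..<k} X c g \<in> S \<and> lin_comb {..<k} X c' g \<in> S} =
          (card S)\<^sup>2 * q ^ (card X * (k - 2))"
        using c c' by (intro card_tuples_two[OF X S k]; blast)
      then have "?f c' = real ((card S)\<^sup>2 * q ^ (card X * (k - 2)))" by (rule arg_cong)
      also have "\<dots> = (real (card S))\<^sup>2 * ?N ^ (k - 2)" by (simp only: of_nat_mult of_nat_power power_mult)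
      also have "\<dots> = p\<^sup>2 * card ?G"
        unfolding N1 cG p_def power_divide by (simp only: times_divide_eq_left times_divide_eq_right)
      finally show "?f c' \<le> p\<^sup>2 * card ?G" by simp
    qed
    also have "\<dots> \<le> card ?T * (p\<^sup>2 * card ?G)"
    proof -
      have "card (?T - ?line) \<le> card ?T" by (rule card_mono[OF finT Diff_subset])
      then have "real (card (?T - ?line)) \<le> real (card ?T)" by (rule of_nat_mono)
      then have "real (card (?T - ?line)) * (p\<^sup>2 * card ?G) \<le> real (card ?T) * (p\<^sup>2 * card ?G)"
        by (rule mult_right_mono) simp
      then show ?thesis by (simp only: sum_constant)
    qed
    finally have off_line: "(\<Sum>c'\<in>?T - ?line. ?f c') \<le> card ?T * (p\<^sup>2 * card ?G)" .
    show "(\<Sum>c'\<in>?T. ?f c') \<le> (real q - 1) * p * card ?G + card ?T * p\<^sup>2 * card ?G"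
      unfolding split mult.assoc by (rule add_mono[OF on_line off_line])
  qed
  moreover have "?Q = {g \<in> ?G. \<forall>c\<in>?T. \<not> lin_comb {..<k} X c g \<in> S}"
    by (rule Collect_cong) (simp only: Ball_def Diff_iff singleton_iff, blast)
  ultimately show ?thesis by (simp only: cG cT p_def power_mult)
qed

end

section \<open>Bounds for the density\<close>

context finite_field
begin

lemma half_power_le:
  assumes "i < M"
  shows "real q ^ M / 2 \<le> real q ^ M - real q ^ i"
proof -
  have "2 * real q ^ i \<le> real q * real q ^ i"
    using q_ge_2 by (intro mult_right_mono) auto
  also have "\<dots> = real q ^ Suc i" by simp
  also have "\<dots> \<le> real q ^ M" using assms q_ge_2 by (intro power_increasing) auto
  finally show ?thesis by simp
qed

lemma half_power_prod_le:
  assumes "k \<le> M"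
  shows "(real q ^ M / 2) ^ k \<le> (\<Prod>i<k. real q ^ M - real q ^ i)"
proof -
  have "(\<Prod>i<k. real q ^ M / 2) \<le> (\<Prod>i<k. real q ^ M - real q ^ i)"
    by (rule prod_mono) (use half_power_le assms in auto)
  then show ?thesis by simp
qed

lemma real_prod_diff:
  assumes "k \<le> M"
  shows "real (\<Prod>i<k. q ^ M - q ^ i) = (\<Prod>i<k. real q ^ M - real q ^ i)"
  unfolding of_nat_prod
proof (rule prod.cong[OF refl])
  fix i assume "i \<in> {..<k}"
  then have "q ^ i \<le> q ^ M" using assms q_ge_2 by (intro power_increasing) auto
  then show "real (q ^ M - q ^ i) = real q ^ M - real q ^ i" by (simp add: of_nat_diff)
qed

text \<open>For \<open>d = 1\<close> the only code in question is the full matrix space.\<close>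

lemma density_trivial:
  assumes "m \<ge> 1" "n \<ge> 1"
  shows "rank_metric_density R n m (m * n) 1 = 1"
proof -
  let ?X = "{..<n} \<times> {..<m}" and ?k = "m * n"
  let ?V = "?X \<rightarrow>\<^sub>E carrier R"
  have k: "?k \<ge> 1" using assms by simp
  have "{g \<in> {..<?k} \<rightarrow>\<^sub>E ?V. lin_indep {..<?k} ?X g \<and>
      (\<forall>M \<in> lin_span {..<?k} ?X g. M \<noteq> zero_vec ?X \<longrightarrow> 1 \<le> mat_rank R n m M)} =
      {g \<in> {..<?k} \<rightarrow>\<^sub>E ?V. lin_indep {..<?k} ?X g}"
  proof (rule Collect_cong)
    fix g
    have "1 \<le> mat_rank R n m M"
      if g: "g \<in> {..<?k} \<rightarrow>\<^sub>E ?V" and "M \<in> lin_span {..<?k} ?X g" "M \<noteq> zero_vec ?X" for M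
    proof -
      have "lin_span {..<?k} ?X g \<subseteq> ?V" by (rule lin_span_subset[OF is_subspace_all]) (use g in auto)
      then show ?thesis using mat_rank_pos[of M n m] that by blast
    qed
    then show "(g \<in> {..<?k} \<rightarrow>\<^sub>E ?V \<and> lin_indep {..<?k} ?X g \<and>
      (\<forall>M \<in> lin_span {..<?k} ?X g. M \<noteq> zero_vec ?X \<longrightarrow> 1 \<le> mat_rank R n m M)) =
      (g \<in> {..<?k} \<rightarrow>\<^sub>E ?V \<and> lin_indep {..<?k} ?X g)" by blast
  qed
  then have eq: "rank_metric_density R n m ?k 1 =
      real (card {g \<in> {..<?k} \<rightarrow>\<^sub>E ?V. lin_indep {..<?k} ?X g}) / (\<Prod>i<?k. real q ^ ?k - real q ^ i)"
    by (simp only: density_eq[OF k])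
  have "card {g \<in> {..<?k} \<rightarrow>\<^sub>E ?V. lin_indep {..<?k} ?X g} = (\<Prod>i<?k. q ^ ?k - q ^ i)"
    using card_lin_indep[OF is_subspace_all, of ?X "{..<?k}"]
    by (simp add: card_vecs card_cartesian_product mult.commute[of n m])
  then have "real (card {g \<in> {..<?k} \<rightarrow>\<^sub>E ?V. lin_indep {..<?k} ?X g}) = (\<Prod>i<?k. real q ^ ?k - real q ^ i)"
    by (simp only: real_prod_diff[OF le_refl])
  then have num: "real (card {g \<in> {..<?k} \<rightarrow>\<^sub>E ?V. lin_indep {..<?k} ?X g}) = (\<Prod>i<?k. real q ^ ?k - real q ^ i)" .
  have pos: "(\<Prod>i<?k. real q ^ ?k - real q ^ i) > 0"
  proof (rule prod_pos)
    fix i assume "i \<in> {..<?k}"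
    then show "0 < real q ^ ?k - real q ^ i" using q_ge_2 by simp
  qed
  show ?thesis unfolding eq num by (rule divide_self[OF less_imp_neq[OF pos, symmetric]])
qed

text \<open>A code of minimum distance greater than \<open>r\<close> avoids the set of nonzero matrices of rank at most
  \<open>r\<close>. The expected number of nonzero coefficient vectors that a random tuple maps into this set is at
  least \<open>q ^ (r * (n - r)) / 2 ^ (r + 1)\<close>. The powers of 2 absorb all factors of the form
  \<open>1 - q ^ i / q ^ M\<close> with \<open>i < M\<close>.\<close>

lemma density_upper_bound:
  assumes r: "1 \<le> r" "r < n" and nm: "n \<le> m"
  shows "rank_metric_density R n m (m * (n - r)) (Suc r) * real q ^ (r * (n - r))
    \<le> 2 ^ (m * (n - r) + r + 1) * real q"
proof -
  let ?X = "{..<n} \<times> {..<m}" and ?k = "m * (n - r)"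
  let ?V = "?X \<rightarrow>\<^sub>E carrier R"
  let ?S = "{M \<in> ?V. M \<noteq> zero_vec ?X \<and> mat_rank R n m M \<le> r}"
  let ?B = "{g \<in> {..<?k} \<rightarrow>\<^sub>E ?V. lin_indep {..<?k} ?X g \<and>
      (\<forall>M \<in> lin_span {..<?k} ?X g. M \<noteq> zero_vec ?X \<longrightarrow> Suc r \<le> mat_rank R n m M)}"
  let ?Q = "{g \<in> {..<?k} \<rightarrow>\<^sub>E ?V. \<forall>c \<in> {..<?k} \<rightarrow>\<^sub>E carrier R. c \<noteq> zero_vec {..<?k} \<longrightarrow> lin_comb {..<?k} ?X c g \<notin> ?S}"
  let ?x = "real q"
  have x0: "?x > 0" using q_ge_2 by simp
  have "n - r \<ge> 1" "m \<ge> 2" using assms by auto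
  moreover have "m * 1 \<le> ?k" using \<open>n - r \<ge> 1\<close> by (rule mult_le_mono2)
  ultimately have k2: "?k \<ge> 2" by linarith
  have kmn: "?k + m * r = m * n" using r by (simp flip: distrib_left)
  have finX: "finite ?X" by simp
  have cX: "card ?X = m * n" by (simp add: card_cartesian_product)
  have SV: "?S \<subseteq> ?V" by blast
  have "?B \<subseteq> ?Q"
  proof
    fix g assume g: "g \<in> ?B"
    have "lin_comb {..<?k} ?X c g \<notin> ?S" if c: "c \<in> {..<?k} \<rightarrow>\<^sub>E carrier R" for c
    proof
      let ?M = "lin_comb {..<?k} ?X c g"
      assume "?M \<in> ?S"
      then have M: "?M \<noteq> zero_vec ?X" "mat_rank R n m ?M \<le> r" by blast+
      have "\<forall>M \<in> lin_span {..<?k} ?X g. M \<noteq> zero_vec ?X \<longrightarrow> Suc r \<le> mat_rank R n m M" using g by blast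
      from bspec[OF this lin_spanI[OF c]] M(1) have "Suc r \<le> mat_rank R n m ?M" by (rule mp)
      then show False using M(2) by linarith
    qed
    then show "g \<in> ?Q" using g by blast
  qed
  moreover have "finite ?Q"
  proof (rule finite_subset)
    show "finite ({..<?k} \<rightarrow>\<^sub>E ?V)" by (intro finite_PiE finite_vecs) auto
  qed blast
  ultimately have BQ: "real (card ?B) \<le> real (card ?Q)" by (intro of_nat_mono card_mono)
  have S_ge: "?x ^ (r * (n - r)) * (?x ^ m / 2) ^ r \<le> real (card ?S)"
  proof -
    have "?x ^ (r * (n - r)) * (?x ^ m / 2) ^ r \<le> ?x ^ (r * (n - r)) * (\<Prod>i<r. ?x ^ m - ?x ^ i)"
      using half_power_prod_le[of r m] assms by (intro mult_left_mono) auto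
    also have "\<dots> = real (q ^ (r * (n - r)) * (\<Prod>i<r. q ^ m - q ^ i))"
      using real_prod_diff[of r m] assms by simp
    also have "\<dots> \<le> real (card ?S)"
      using card_low_rank[of r n m] r by (intro of_nat_mono) simp
    finally show ?thesis .
  qed
  have mu_ge: "?x ^ (r * (n - r)) / 2 ^ (r + 1) \<le> (?x ^ ?k - 1) * (real (card ?S) / ?x ^ (m * n))"
  proof -
    have gen: "c / 2 ^ (r + 1) = (a / 2) * ((c * (b / 2 ^ r)) / (a * b))"
      if "a \<noteq> 0" "b \<noteq> 0" for a b c :: real
      using that by (simp add: field_simps)
    have "?x ^ (r * (n - r)) / 2 ^ (r + 1) =
        (?x ^ ?k / 2) * ((?x ^ (r * (n - r)) * (?x ^ (m * r) / 2 ^ r)) / (?x ^ ?k * ?x ^ (m * r)))"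
      by (rule gen) (use zero_less_power[OF x0] in \<open>simp_all only: less_imp_neq[symmetric] not_False_eq_True\<close>)
    also have "?x ^ ?k * ?x ^ (m * r) = ?x ^ (m * n)" by (simp only: kmn flip: power_add)
    also have "?x ^ (m * r) / 2 ^ r = (?x ^ m / 2) ^ r" by (simp only: power_divide power_mult)
    also have "(?x ^ ?k / 2) * ((?x ^ (r * (n - r)) * (?x ^ m / 2) ^ r) / ?x ^ (m * n))
        \<le> (?x ^ ?k - 1) * (real (card ?S) / ?x ^ (m * n))"
    proof (rule mult_mono)
      show "?x ^ (r * (n - r)) * (?x ^ m / 2) ^ r / ?x ^ (m * n) \<le> real (card ?S) / ?x ^ (m * n)"
        by (rule divide_right_mono[OF S_ge]) simp
      show "0 \<le> ?x ^ (r * (n - r)) * (?x ^ m / 2) ^ r / ?x ^ (m * n)" by simp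
      show "?x ^ ?k / 2 \<le> ?x ^ ?k - 1" using half_power_le[of 0 ?k] r nm by simp
      then show "0 \<le> ?x ^ ?k - 1" using zero_less_power[OF x0, of ?k] by linarith
    qed
    finally show ?thesis .
  qed
  have "real (card ?Q) * (?x ^ (r * (n - r)) / 2 ^ (r + 1)) \<le>
      real (card ?Q) * ((?x ^ ?k - 1) * (real (card ?S) / ?x ^ (m * n)))"
    by (rule mult_left_mono[OF mu_ge]) simp
  also have "\<dots> \<le> (?x - 1) * ?x ^ (m * n * ?k)"
    using card_avoiding_le[OF finX SV k2] unfolding cX .
  also have "\<dots> \<le> ?x * ?x ^ (m * n * ?k)" by (intro mult_right_mono) auto
  finally have "2 ^ (r + 1) * (real (card ?Q) * (?x ^ (r * (n - r)) / 2 ^ (r + 1))) \<le>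
      2 ^ (r + 1) * (?x * ?x ^ (m * n * ?k))"
    by (rule mult_left_mono) simp
  then have Q_le: "real (card ?Q) * ?x ^ (r * (n - r)) \<le> 2 ^ (r + 1) * (?x * (?x ^ (m * n)) ^ ?k)"
    unfolding power_mult[of ?x "m * n" ?k] by simp
  have den: "(?x ^ (m * n) / 2) ^ ?k \<le> (\<Prod>i<?k. ?x ^ (m * n) - ?x ^ i)"
    by (rule half_power_prod_le) (use kmn in linarith)
  have den0: "(?x ^ (m * n) / 2) ^ ?k > 0" using x0 by simp
  have "rank_metric_density R n m ?k (Suc r) = real (card ?B) / (\<Prod>i<?k. ?x ^ (m * n) - ?x ^ i)"
    by (rule density_eq) (use k2 in linarith)
  also have "\<dots> \<le> real (card ?Q) / (?x ^ (m * n) / 2) ^ ?k"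
    using den0 den BQ by (intro frac_le) auto
  finally have "rank_metric_density R n m ?k (Suc r) * ?x ^ (r * (n - r)) \<le>
      real (card ?Q) / (?x ^ (m * n) / 2) ^ ?k * ?x ^ (r * (n - r))"
    using x0 by (intro mult_right_mono) auto
  also have "\<dots> = (real (card ?Q) * ?x ^ (r * (n - r))) / (?x ^ (m * n) / 2) ^ ?k" by simp
  also have "\<dots> \<le> 2 ^ (r + 1) * (?x * (?x ^ (m * n)) ^ ?k) / (?x ^ (m * n) / 2) ^ ?k"
    using den0 by (intro divide_right_mono Q_le) auto
  also have "\<dots> = 2 ^ (?k + r + 1) * ?x"
  proof -
    have gen: "2 ^ (r + 1) * (?x * N) / (N / 2 ^ ?k) = 2 ^ (?k + r + 1) * ?x" if "N \<noteq> 0" for N :: real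
      using that by (simp add: power_add)
    have "(?x ^ (m * n)) ^ ?k \<noteq> 0"
      using zero_less_power[OF zero_less_power[OF x0], of "m * n" ?k] by (rule less_imp_neq[symmetric])
    then show ?thesis unfolding power_divide by (rule gen)
  qed
  finally show ?thesis .
qed

end

section \<open>Eigenvectors of pencils\<close>

context finite_field
begin

text \<open>Eigenvectors of the pencil formed by the maps \<open>G\<close> and \<open>H\<close>: nonzero \<open>w\<close> whose image under \<open>H\<close> is
  \<open>\<mu>\<close> times its image under \<open>G\<close>. For injective \<open>G\<close> between spaces of equal dimension these are the
  eigenvectors of \<open>H\<close> followed by the inverse of \<open>G\<close>; working with the pencil avoids inverses.\<close>

definition eigvec :: "'i set \<Rightarrow> 'x set \<Rightarrow> ('i \<Rightarrow> 'x \<Rightarrow> 'a) \<Rightarrow> ('i \<Rightarrow> 'x \<Rightarrow> 'a) \<Rightarrow> 'a \<Rightarrow> ('i \<Rightarrow> 'a) set" where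
  "eigvec I X G H \<mu> = {w \<in> I \<rightarrow>\<^sub>E carrier R. w \<noteq> zero_vec I \<and> lin_comb I X w H = (\<lambda>x\<in>X. \<mu> \<otimes> lin_comb I X w G x)}"

lemma eigvecD:
  assumes "w \<in> eigvec I X G H \<mu>"
  shows "w \<in> I \<rightarrow>\<^sub>E carrier R" "w \<noteq> zero_vec I" "lin_comb I X w H = (\<lambda>x\<in>X. \<mu> \<otimes> lin_comb I X w G x)"
  using assms unfolding eigvec_def by blast+

lemma eigvecI:
  assumes "w \<in> I \<rightarrow>\<^sub>E carrier R" "w \<noteq> zero_vec I" "lin_comb I X w H = (\<lambda>x\<in>X. \<mu> \<otimes> lin_comb I X w G x)"
  shows "w \<in> eigvec I X G H \<mu>"
  using assms unfolding eigvec_def by blast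

text \<open>An eigenvector in the span of independent eigenvectors involves only those with the same
  eigenvalue.\<close>

lemma eigen_coeff_zero:
  assumes I: "finite I" and J: "finite J" and G: "G \<in> I \<rightarrow> X \<rightarrow> carrier R" and H: "H \<in> I \<rightarrow> X \<rightarrow> carrier R"
    and indG: "lin_indep I X G" and c: "c \<in> J \<rightarrow> I \<rightarrow>\<^sub>E carrier R" and indc: "lin_indep J I c"
    and e: "e \<in> J \<rightarrow> carrier R" and ce: "\<And>j. j \<in> J \<Longrightarrow> lin_comb I X (c j) H = (\<lambda>x\<in>X. e j \<otimes> lin_comb I X (c j) G x)"
    and \<mu>: "\<mu> \<in> carrier R" and a: "a \<in> J \<rightarrow>\<^sub>E carrier R"
    and w: "lin_comb I X (lin_comb J I a c) H = (\<lambda>x\<in>X. \<mu> \<otimes> lin_comb I X (lin_comb J I a c) G x)"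
    and j: "j \<in> J" "e j \<noteq> \<mu>"
  shows "a j = \<zero>"
proof -
  have cP: "c \<in> J \<rightarrow> I \<rightarrow> carrier R" using c by auto
  have aP: "a \<in> J \<rightarrow> carrier R" using a by auto
  have aj: "a j \<in> carrier R" if "j \<in> J" for j using aP that by auto
  have ej: "e j \<in> carrier R" if "j \<in> J" for j using e that by auto
  define Gc where "Gc = (\<lambda>j. lin_comb I X (c j) G)"
  have Gc: "Gc \<in> J \<rightarrow> X \<rightarrow>\<^sub>E carrier R"
    unfolding Gc_def by (intro Pi_I lin_comb_closed) (use cP G in auto)
  then have Gcx: "Gc j x \<in> carrier R" if "j \<in> J" "x \<in> X" for j x using that by auto
  \<comment> \<open>\<open>H w - \<mu> G w = 0\<close> is the image under the injective map \<open>G\<close> of the combination with coefficients \<open>b\<close>.\<close>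
  define b where "b = (\<lambda>j\<in>J. a j \<otimes> (e j \<ominus> \<mu>))"
  have b: "b \<in> J \<rightarrow>\<^sub>E carrier R" using aj ej \<mu> by (auto simp: b_def)
  have HG: "lin_comb J X a (\<lambda>j. lin_comb I X (c j) H) = (\<lambda>x\<in>X. \<mu> \<otimes> lin_comb J X a Gc x)"
    using w lin_comb_assoc[OF J I aP cP H] lin_comb_assoc[OF J I aP cP G] by (simp add: Gc_def)
  have "lin_comb J X b Gc = zero_vec X"
    unfolding lin_comb_def zero_vec_def
  proof (rule restrict_ext)
    fix x assume x: "x \<in> X"
    have "(\<Oplus>j\<in>J. b j \<otimes> Gc j x) = (\<Oplus>j\<in>J. a j \<otimes> (e j \<otimes> Gc j x) \<oplus> (\<ominus> \<mu>) \<otimes> (a j \<otimes> Gc j x))"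
    proof (rule finsum_cong'[OF refl])
      show "(\<lambda>j. a j \<otimes> (e j \<otimes> Gc j x) \<oplus> (\<ominus> \<mu>) \<otimes> (a j \<otimes> Gc j x)) \<in> J \<rightarrow> carrier R"
        using aj ej \<mu> Gcx x by auto
      fix j assume j: "j \<in> J"
      show "b j \<otimes> Gc j x = a j \<otimes> (e j \<otimes> Gc j x) \<oplus> (\<ominus> \<mu>) \<otimes> (a j \<otimes> Gc j x)"
        using aj[OF j] ej[OF j] \<mu> Gcx[OF j x] j
        by (simp add: b_def a_minus_def l_distr r_distr m_assoc l_minus r_minus m_lcomm)
    qed
    also have "\<dots> = (\<Oplus>j\<in>J. a j \<otimes> (e j \<otimes> Gc j x)) \<oplus> (\<Oplus>j\<in>J. (\<ominus> \<mu>) \<otimes> (a j \<otimes> Gc j x))"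
      by (rule finsum_addf) (use aj ej \<mu> Gcx x in auto)
    also have "(\<Oplus>j\<in>J. (\<ominus> \<mu>) \<otimes> (a j \<otimes> Gc j x)) = (\<ominus> \<mu>) \<otimes> (\<Oplus>j\<in>J. a j \<otimes> Gc j x)"
      by (rule finsum_rdistr[symmetric]) (use J aj \<mu> Gcx x in auto)
    also have "(\<Oplus>j\<in>J. a j \<otimes> (e j \<otimes> Gc j x)) = lin_comb J X a (\<lambda>j. lin_comb I X (c j) H) x"
      unfolding lin_comb_def[of J] restrict_apply'[OF x]
      by (rule finsum_cong'[OF refl]) (use aj ej Gcx x ce in \<open>auto simp: Gc_def\<close>)
    also have "\<dots> = \<mu> \<otimes> (\<Oplus>j\<in>J. a j \<otimes> Gc j x)"
      unfolding HG using x by (simp add: lin_comb_def)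
    also have "\<mu> \<otimes> (\<Oplus>j\<in>J. a j \<otimes> Gc j x) \<oplus> (\<ominus> \<mu>) \<otimes> (\<Oplus>j\<in>J. a j \<otimes> Gc j x) = \<zero>"
    proof -
      have "(\<Oplus>j\<in>J. a j \<otimes> Gc j x) \<in> carrier R" by (rule finsum_closed) (use aj Gcx x in auto)
      then show ?thesis using \<mu> by (simp add: l_minus r_neg)
    qed
    finally show "(\<Oplus>j\<in>J. b j \<otimes> Gc j x) = \<zero>" .
  qed
  then have "lin_comb I X (lin_comb J I b c) G = zero_vec X"
    using lin_comb_assoc[OF J I _ cP G, of b] b by (auto simp: Gc_def)
  moreover have "lin_comb J I b c \<in> I \<rightarrow>\<^sub>E carrier R" by (rule lin_comb_closed) (use b cP in auto)
  ultimately have "lin_comb J I b c = zero_vec I" using indG unfolding lin_indep_def by blast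
  then have "b = zero_vec J" using indc b unfolding lin_indep_def by blast
  then have "b j = zero_vec J j" by (rule fun_cong)
  then have "a j \<otimes> (e j \<ominus> \<mu>) = \<zero>" using j by (simp add: b_def)
  moreover have "e j \<ominus> \<mu> \<noteq> \<zero>" using j ej[OF j(1)] \<mu> by simp
  ultimately show ?thesis using aj[OF j(1)] ej[OF j(1)] \<mu> integral by blast
qed

lemma eigvec_lin_indep:
  assumes I: "finite I" and J: "finite J" and G: "G \<in> I \<rightarrow> X \<rightarrow> carrier R" and H: "H \<in> I \<rightarrow> X \<rightarrow> carrier R"
    and indG: "lin_indep I X G" and e: "e \<in> J \<rightarrow> carrier R" "inj_on e J"
    and c: "\<And>j. j \<in> J \<Longrightarrow> c j \<in> eigvec I X G H (e j)"
  shows "lin_indep J I c"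
  using J e c
proof (induction J rule: finite_induct)
  case empty
  show ?case by (rule lin_indep_empty)
next
  case (insert k J)
  have cE: "c j \<in> eigvec I X G H (e j)" if "j \<in> insert k J" for j using insert.prems that by blast
  have c: "c \<in> insert k J \<rightarrow> I \<rightarrow>\<^sub>E carrier R" using eigvecD(1)[OF cE] by blast
  then have cJ: "c \<in> J \<rightarrow> I \<rightarrow>\<^sub>E carrier R" "c \<in> J \<rightarrow> I \<rightarrow> carrier R" by auto
  have eJ: "e \<in> J \<rightarrow> carrier R" "e k \<in> carrier R" "inj_on e J" using insert.prems by auto
  have ind: "lin_indep J I c" using insert.IH[OF eJ(1,3)] cE by blast
  have "c k \<notin> lin_span J I c"
  proof
    assume "c k \<in> lin_span J I c"
    then obtain a where a: "a \<in> J \<rightarrow>\<^sub>E carrier R" "c k = lin_comb J I a c" unfolding lin_span_def by blast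
    have "a j = zero_vec J j" if j: "j \<in> J" for j
    proof -
      have "e j \<noteq> e k" using insert.prems(2) insert.hyps(2) j by (auto simp: inj_on_def)
      have "a j = \<zero>"
        by (rule eigen_coeff_zero[OF I insert.hyps(1) G H indG cJ(1) ind eJ(1) eigvecD(3)[OF cE] eJ(2) a(1) _ j])
           (use eigvecD(3)[OF cE, of k] a(2) \<open>e j \<noteq> e k\<close> in auto)
      then show ?thesis using j by simp
    qed
    then have "a = zero_vec J" by (rule PiE_ext[OF a(1) zero_vec_closed])
    then have "c k = zero_vec I" using a(2) lin_comb_zero[OF cJ(2)] by simp
    then show False using eigvecD(2)[OF cE, of k] by simp
  qed
  then show ?case using lin_indep_insert[OF insert.hyps c] ind by blast
qed

text \<open>Eigenvectors for distinct eigenvalues stay independent when one eigenspace contributes a second,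
  non-proportional vector.\<close>

lemma eigvec_lin_indep_insert:
  assumes I: "finite I" and J: "finite J" and G: "G \<in> I \<rightarrow> X \<rightarrow> carrier R" and H: "H \<in> I \<rightarrow> X \<rightarrow> carrier R"
    and indG: "lin_indep I X G" and e: "e \<in> J \<rightarrow> carrier R" "inj_on e J"
    and c: "\<And>j. j \<in> J \<Longrightarrow> c j \<in> eigvec I X G H (e j)"
    and k: "k \<notin> J" "l \<in> J" "c k \<in> eigvec I X G H (e l)"
    and line: "c k \<notin> (\<lambda>s. \<lambda>x\<in>I. s \<otimes> c l x) ` carrier R"
  shows "lin_indep (insert k J) I c"
proof -
  have ind: "lin_indep J I c" by (rule eigvec_lin_indep[OF I J G H indG e c])
  have cc: "c \<in> insert k J \<rightarrow> I \<rightarrow>\<^sub>E carrier R" using eigvecD(1)[OF c] eigvecD(1)[OF k(3)] by blast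
  then have cJ: "c \<in> J \<rightarrow> I \<rightarrow>\<^sub>E carrier R" "c \<in> J \<rightarrow> I \<rightarrow> carrier R" by auto
  have el: "e l \<in> carrier R" using e k by auto
  have "c k \<notin> lin_span J I c"
  proof
    assume "c k \<in> lin_span J I c"
    then obtain a where a: "a \<in> J \<rightarrow>\<^sub>E carrier R" "c k = lin_comb J I a c" unfolding lin_span_def by blast
    have al: "a l \<in> carrier R" using a(1) k(2) by auto
    have cl: "c l x \<in> carrier R" if "x \<in> I" for x using cJ k(2) that by auto
    have a0: "a j = \<zero>" if j: "j \<in> J" "j \<noteq> l" for j
    proof -
      have "e j \<noteq> e l" using e(2) k(2) j by (auto simp: inj_on_def)
      then show ?thesis
        by (intro eigen_coeff_zero[OF I J G H indG cJ(1) ind e(1) eigvecD(3)[OF c] el a(1) _ j(1)])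
           (use eigvecD(3)[OF k(3)] a(2) in auto)
    qed
    have "c k = (\<lambda>x\<in>I. a l \<otimes> c l x)"
      unfolding a(2) lin_comb_def
    proof (rule restrict_ext)
      fix x assume x: "x \<in> I"
      have "(\<Oplus>j\<in>J. a j \<otimes> c j x) = (\<Oplus>j\<in>J. if l = j then a l \<otimes> c l x else \<zero>)"
      proof (rule finsum_cong'[OF refl])
        show "(\<lambda>j. if l = j then a l \<otimes> c l x else \<zero>) \<in> J \<rightarrow> carrier R" using al cl x by auto
        fix j assume j: "j \<in> J"
        have "c j x \<in> carrier R" using cJ j x by auto
        then show "a j \<otimes> c j x = (if l = j then a l \<otimes> c l x else \<zero>)"
          using a0[OF j] by (cases "l = j") auto
      qed
      also have "\<dots> = a l \<otimes> c l x"
        using finsum_singleton[OF k(2) J, of "\<lambda>_. a l \<otimes> c l x"] al cl x by auto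
      finally show "(\<Oplus>j\<in>J. a j \<otimes> c j x) = a l \<otimes> c l x" .
    qed
    then have "c k \<in> (\<lambda>s. \<lambda>x\<in>I. s \<otimes> c l x) ` carrier R" using al by (rule image_eqI)
    then show False using line by blast
  qed
  then show ?thesis using lin_indep_insert[OF J k(1) cc] ind by blast
qed

lemma eigvec_scale:
  assumes I: "finite I" and G: "G \<in> I \<rightarrow> X \<rightarrow> carrier R" and H: "H \<in> I \<rightarrow> X \<rightarrow> carrier R"
    and \<mu>: "\<mu> \<in> carrier R" and w: "w \<in> eigvec I X G H \<mu>" and s: "s \<in> carrier R - {\<zero>}"
  shows "(\<lambda>i\<in>I. s \<otimes> w i) \<in> eigvec I X G H \<mu>"
proof (rule eigvecI)
  have s': "s \<in> carrier R" "s \<noteq> \<zero>" using s by auto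
  have wc: "w i \<in> carrier R" if "i \<in> I" for i using PiE_mem[OF eigvecD(1)[OF w] that] .
  have wP: "w \<in> I \<rightarrow> carrier R" using wc by auto
  show "(\<lambda>i\<in>I. s \<otimes> w i) \<in> I \<rightarrow>\<^sub>E carrier R" using wc s' by auto
  show "(\<lambda>i\<in>I. s \<otimes> w i) \<noteq> zero_vec I"
  proof
    assume eq: "(\<lambda>i\<in>I. s \<otimes> w i) = zero_vec I"
    have "w i = zero_vec I i" if i: "i \<in> I" for i
    proof -
      have "(\<lambda>i\<in>I. s \<otimes> w i) i = zero_vec I i" unfolding eq ..
      then have "s \<otimes> w i = \<zero>" using i by simp
      then show ?thesis using integral[OF _ s'(1) wc[OF i]] s'(2) i by simp
    qed
    then have "w = zero_vec I" by (rule PiE_ext[OF eigvecD(1)[OF w] zero_vec_closed])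
    then show False using eigvecD(2)[OF w] by simp
  qed
  have LG: "lin_comb I X w G x \<in> carrier R" if "x \<in> X" for x
    using PiE_mem[OF lin_comb_closed[OF wP G] that] .
  show "lin_comb I X (\<lambda>i\<in>I. s \<otimes> w i) H = (\<lambda>x\<in>X. \<mu> \<otimes> lin_comb I X (\<lambda>i\<in>I. s \<otimes> w i) G x)"
    unfolding lin_comb_smult[OF I s'(1) wP H] lin_comb_smult[OF I s'(1) wP G] eigvecD(3)[OF w]
    by (rule restrict_ext) (use LG s' \<mu> in \<open>simp add: m_lcomm\<close>)
qed

lemma card_multiples:
  assumes "w \<in> I \<rightarrow>\<^sub>E carrier R" "w \<noteq> zero_vec I"
  shows "card ((\<lambda>s. \<lambda>i\<in>I. s \<otimes> w i) ` (carrier R - {\<zero>})) = q - 1"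
proof -
  have wc: "w i \<in> carrier R" if "i \<in> I" for i using PiE_mem[OF assms(1) that] .
  obtain i where i: "i \<in> I" "w i \<noteq> \<zero>"
  proof -
    have "\<not> (\<forall>i\<in>I. w i = zero_vec I i)" using PiE_ext[OF assms(1) zero_vec_closed] assms(2) by blast
    then show ?thesis using that by auto
  qed
  have "inj_on (\<lambda>s. \<lambda>i\<in>I. s \<otimes> w i) (carrier R - {\<zero>})"
  proof (rule inj_onI)
    fix s t assume st: "s \<in> carrier R - {\<zero>}" "t \<in> carrier R - {\<zero>}"
      and eq: "(\<lambda>i\<in>I. s \<otimes> w i) = (\<lambda>i\<in>I. t \<otimes> w i)"
    from fun_cong[OF eq, of i] have "s \<otimes> w i = t \<otimes> w i" using i by simp
    then show "s = t" using st i wc[OF i(1)] m_rcancel by auto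
  qed
  then have "card ((\<lambda>s. \<lambda>i\<in>I. s \<otimes> w i) ` (carrier R - {\<zero>})) = card (carrier R - {\<zero>})"
    by (rule card_image)
  then show ?thesis by (simp add: card_Diff_subset)
qed

lemma card_eigvec_ge:
  assumes I: "finite I" and G: "G \<in> I \<rightarrow> X \<rightarrow> carrier R" and H: "H \<in> I \<rightarrow> X \<rightarrow> carrier R"
    and \<mu>: "\<mu> \<in> carrier R" and ne: "eigvec I X G H \<mu> \<noteq> {}"
  shows "q - 1 \<le> card (eigvec I X G H \<mu>)"
proof -
  obtain w where w: "w \<in> eigvec I X G H \<mu>" using ne by blast
  have "(\<lambda>s. \<lambda>i\<in>I. s \<otimes> w i) ` (carrier R - {\<zero>}) \<subseteq> eigvec I X G H \<mu>"
    by (rule image_subsetI) (rule eigvec_scale[OF I G H \<mu> w])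
  moreover have "finite (eigvec I X G H \<mu>)"
    by (rule finite_subset[OF _ finite_vecs[OF I]]) (auto dest: eigvecD(1))
  ultimately show ?thesis using card_mono card_multiples[OF eigvecD(1,2)[OF w]] by metis
qed

text \<open>An eigenspace of dimension at least 2 contains at least \<open>q - 1\<close> vectors outside any given line.\<close>

lemma card_eigvec_off_line:
  assumes I: "finite I" and G: "G \<in> I \<rightarrow> X \<rightarrow> carrier R" and H: "H \<in> I \<rightarrow> X \<rightarrow> carrier R"
    and \<mu>: "\<mu> \<in> carrier R" and big: "q - 1 < card (eigvec I X G H \<mu>)"
    and v: "v \<in> eigvec I X G H \<mu>"
  shows "q - 1 \<le> card (eigvec I X G H \<mu> - (\<lambda>s. \<lambda>i\<in>I. s \<otimes> v i) ` carrier R)"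
proof -
  let ?E = "eigvec I X G H \<mu>"
  let ?L = "\<lambda>v S. (\<lambda>s. \<lambda>i\<in>I. s \<otimes> v i) ` S"
  have finE: "finite ?E"
    by (rule finite_subset[OF _ finite_vecs[OF I]]) (auto dest: eigvecD(1))
  have vc: "v i \<in> carrier R" if "i \<in> I" for i using PiE_mem[OF eigvecD(1)[OF v] that] .
  have sub: "?E \<inter> ?L v (carrier R) \<subseteq> ?L v (carrier R - {\<zero>})"
  proof
    fix w assume w: "w \<in> ?E \<inter> ?L v (carrier R)"
    then obtain s where s: "s \<in> carrier R" "w = (\<lambda>i\<in>I. s \<otimes> v i)" by blast
    have "s \<noteq> \<zero>"
    proof
      assume "s = \<zero>"
      then have "w = zero_vec I" unfolding s(2) zero_vec_def by (intro restrict_ext) (use vc in simp)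
      then show False using eigvecD(2)[of w] w by blast
    qed
    then have "s \<in> carrier R - {\<zero>}" using s(1) by blast
    then show "w \<in> ?L v (carrier R - {\<zero>})" unfolding s(2) by (rule imageI)
  qed
  have "card (?E \<inter> ?L v (carrier R)) \<le> q - 1"
    using card_mono[OF _ sub] card_multiples[OF eigvecD(1,2)[OF v]] by simp
  then have "\<not> ?E \<subseteq> ?L v (carrier R)" using big by (metis inf.absorb1 not_less)
  then obtain w where w: "w \<in> ?E" "w \<notin> ?L v (carrier R)" by blast
  have wc: "w i \<in> carrier R" if "i \<in> I" for i using PiE_mem[OF eigvecD(1)[OF w(1)] that] .
  have "?L w (carrier R - {\<zero>}) \<subseteq> ?E - ?L v (carrier R)"
  proof (rule image_subsetI, rule DiffI)
    fix s assume s: "s \<in> carrier R - {\<zero>}"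
    show "(\<lambda>i\<in>I. s \<otimes> w i) \<in> ?E" by (rule eigvec_scale[OF I G H \<mu> w(1) s])
    show "(\<lambda>i\<in>I. s \<otimes> w i) \<notin> ?L v (carrier R)"
    proof
      assume "(\<lambda>i\<in>I. s \<otimes> w i) \<in> ?L v (carrier R)"
      then obtain t where t: "t \<in> carrier R" "(\<lambda>i\<in>I. s \<otimes> w i) = (\<lambda>i\<in>I. t \<otimes> v i)" by blast
      have s': "s \<in> carrier R" "inv s \<in> carrier R" "inv s \<otimes> s = \<one>" using s by (auto simp: field_Units)
      have wi: "w i = (\<lambda>i\<in>I. (inv s \<otimes> t) \<otimes> v i) i" if i: "i \<in> I" for i
      proof -
        have "s \<otimes> w i = t \<otimes> v i" using fun_cong[OF t(2), of i] i by simp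
        then have "inv s \<otimes> (s \<otimes> w i) = inv s \<otimes> (t \<otimes> v i)" by simp
        then show ?thesis using s' t(1) vc[OF i] wc[OF i] i by (simp flip: m_assoc)
      qed
      have "w = (\<lambda>i\<in>I. (inv s \<otimes> t) \<otimes> v i)"
      proof (rule PiE_ext[OF eigvecD(1)[OF w(1)]])
        show "(\<lambda>i\<in>I. (inv s \<otimes> t) \<otimes> v i) \<in> I \<rightarrow>\<^sub>E carrier R" using s' t(1) vc by auto
      qed (rule wi)
      moreover have "inv s \<otimes> t \<in> carrier R" using s' t(1) by simp
      ultimately have "w \<in> ?L v (carrier R)" by (rule image_eqI)
      then show False using w(2) by blast
    qed
  qed
  then show ?thesis using card_multiples[OF eigvecD(1,2)[OF w(1)]] finE card_mono
    by (metis finite_Diff)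
qed

end

section \<open>Counting choices of eigenvectors\<close>

context finite_field
begin

lemma lin_indep_card_le:
  assumes "lin_indep J X c" "finite J" "finite X" "c \<in> J \<rightarrow> X \<rightarrow>\<^sub>E carrier R"
  shows "card J \<le> card X"
proof -
  have "c \<in> J \<rightarrow> X \<rightarrow> carrier R" using assms(4) by auto
  then have "card (lin_span J X c) = q ^ card J" by (rule card_lin_span[OF assms(1,2)])
  moreover have "card (lin_span J X c) \<le> card (X \<rightarrow>\<^sub>E carrier R)"
    by (rule card_mono[OF finite_vecs[OF assms(3)] lin_span_subset[OF is_subspace_all assms(2,4)]])
  ultimately have "q ^ card J \<le> q ^ card X" using card_vecs[OF assms(3)] by simp
  then show ?thesis using q_ge_2 by (simp add: power_le_imp_le_exp)
qed

lemma finite_tuples: "finite J \<Longrightarrow> finite X \<Longrightarrow> finite (J \<rightarrow>\<^sub>E (X \<rightarrow>\<^sub>E carrier R))"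
  by (intro finite_PiE finite_vecs)

lemma finite_eigvec: "finite I \<Longrightarrow> finite (eigvec I X G H \<mu>)"
  by (rule finite_subset[OF _ finite_vecs]) (auto dest: eigvecD(1))

lemma card_tuples_eigen:
  fixes i m :: nat
  assumes G: "G \<in> {..<m} \<rightarrow>\<^sub>E ({..<m} \<rightarrow>\<^sub>E carrier R)" and im: "i \<le> m"
    and c: "c \<in> {..<i} \<rightarrow>\<^sub>E ({..<m} \<rightarrow>\<^sub>E carrier R)" "lin_indep {..<i} {..<m} c" and e: "e \<in> {..<i} \<rightarrow> carrier R"
  shows "card {H \<in> {..<m} \<rightarrow>\<^sub>E ({..<m} \<rightarrow>\<^sub>E carrier R). \<forall>j\<in>{..<i}.
      lin_comb {..<m} {..<m} (c j) H = (\<lambda>x\<in>{..<m}. e j \<otimes> lin_comb {..<m} {..<m} (c j) G x)} = q ^ (m * (m - i))"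
proof -
  let ?y = "\<lambda>j. \<lambda>x\<in>{..<m}. e j \<otimes> lin_comb {..<m} {..<m} (c j) G x"
  have "?y j \<in> {..<m} \<rightarrow>\<^sub>E carrier R" if j: "j \<in> {..<i}" for j
  proof -
    have "lin_comb {..<m} {..<m} (c j) G \<in> {..<m} \<rightarrow>\<^sub>E carrier R"
      by (rule lin_comb_closed) (use c j G in auto)
    moreover have "e j \<in> carrier R" using e j by auto
    ultimately show ?thesis by auto
  qed
  then have "?y \<in> {..<i} \<rightarrow> {..<m} \<rightarrow>\<^sub>E carrier R" by blast
  moreover have "c \<in> {..<i} \<rightarrow> {..<m} \<rightarrow>\<^sub>E carrier R" using c by auto
  ultimately show ?thesis
    using card_prescribed[of "{..<m}" "{..<m}" "{..<i}" c ?y] im c(2) by simp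
qed

text \<open>The number of pairs of a map \<open>H\<close> and a choice of eigenvectors of \<open>H\<close>, one for each eigenvalue in
  \<open>S\<close>: such a choice is an independent family, and \<open>H\<close> is prescribed on it.\<close>

lemma sum_prod_eigvec:
  assumes G: "G \<in> {..<m} \<rightarrow>\<^sub>E ({..<m} \<rightarrow>\<^sub>E carrier R)" and indG: "lin_indep {..<m} {..<m} G"
    and S: "S \<subseteq> carrier R" and i: "card S = i" "i \<le> m"
  shows "(\<Sum>H \<in> {..<m} \<rightarrow>\<^sub>E ({..<m} \<rightarrow>\<^sub>E carrier R). \<Prod>\<mu>\<in>S. card (eigvec {..<m} {..<m} G H \<mu>)) =
    (\<Prod>j<i. q ^ m - q ^ j) * q ^ (m * (m - i))"
proof -
  let ?U = "{..<m}" let ?V = "{..<m} \<rightarrow>\<^sub>E carrier R" let ?HH = "?U \<rightarrow>\<^sub>E ?V"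
  have finS: "finite S" using S finite_carrier by (rule finite_subset)
  obtain e where e: "bij_betw e {..<i} S"
    using ex_bij_betw_nat_finite[OF finS] i(1) by (auto simp: lessThan_atLeast0)
  have eC: "e \<in> {..<i} \<rightarrow> carrier R" and einj: "inj_on e {..<i}"
    using e S by (auto simp: bij_betw_def)
  let ?E = "\<lambda>H j. eigvec ?U ?U G H (e j)"
  let ?C = "{c \<in> {..<i} \<rightarrow>\<^sub>E ?V. lin_indep {..<i} ?U c}"
  let ?K = "\<lambda>c. {H \<in> ?HH. \<forall>j\<in>{..<i}. lin_comb ?U ?U (c j) H = (\<lambda>x\<in>?U. e j \<otimes> lin_comb ?U ?U (c j) G x)}"
  have GP: "G \<in> ?U \<rightarrow> ?U \<rightarrow> carrier R" using G by auto
  have finH: "finite ?HH" by (rule finite_tuples) auto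
  have finC: "finite ?C"
    by (rule finite_subset[OF _ finite_tuples[of "{..<i}" ?U]]) auto
  have finP: "finite (PiE {..<i} (?E H))" for H by (intro finite_PiE finite_eigvec) auto
  have "(\<Prod>\<mu>\<in>S. card (eigvec ?U ?U G H \<mu>)) = card (PiE {..<i} (?E H))" for H
    using prod.reindex_bij_betw[OF e, of "\<lambda>\<mu>. card (eigvec ?U ?U G H \<mu>)"] by (simp add: card_PiE)
  then have "(\<Sum>H\<in>?HH. \<Prod>\<mu>\<in>S. card (eigvec ?U ?U G H \<mu>)) = (\<Sum>H\<in>?HH. card (PiE {..<i} (?E H)))"
    by simp
  also have "\<dots> = card (SIGMA H:?HH. PiE {..<i} (?E H))"
    by (rule card_SigmaI[symmetric]) (use finH finP in blast)+
  also have "(SIGMA H:?HH. PiE {..<i} (?E H)) = prod.swap ` (SIGMA c:?C. ?K c)"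
  proof (intro equalityI subsetI)
    fix p assume "p \<in> (SIGMA H:?HH. PiE {..<i} (?E H))"
    then obtain H c where p: "p = (H, c)" and H: "H \<in> ?HH" and c: "c \<in> PiE {..<i} (?E H)" by blast
    have HP: "H \<in> ?U \<rightarrow> ?U \<rightarrow> carrier R" using H by auto
    have cE: "c j \<in> ?E H j" if "j \<in> {..<i}" for j using PiE_mem[OF c that] .
    have "lin_indep {..<i} ?U c"
      by (rule eigvec_lin_indep[OF _ _ GP HP indG eC einj cE]) auto
    moreover have "c \<in> {..<i} \<rightarrow>\<^sub>E ?V"
      using c eigvecD(1)[OF cE] by (simp add: PiE_iff[of c])
    ultimately have "c \<in> ?C" by blast
    moreover have "H \<in> ?K c" using H eigvecD(3)[OF cE] by blast
    ultimately have "(c, H) \<in> (SIGMA c:?C. ?K c)" by blast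
    then show "p \<in> prod.swap ` (SIGMA c:?C. ?K c)" unfolding p by (rule rev_image_eqI) simp
  next
    fix p assume "p \<in> prod.swap ` (SIGMA c:?C. ?K c)"
    then obtain c H where p: "p = (H, c)" and c: "c \<in> {..<i} \<rightarrow>\<^sub>E ?V" "lin_indep {..<i} ?U c" and H: "H \<in> ?K c"
      by auto
    have cV: "c \<in> {..<i} \<rightarrow> ?U \<rightarrow>\<^sub>E carrier R" using c by auto
    have "c j \<in> ?E H j" if j: "j \<in> {..<i}" for j
    proof (rule eigvecI)
      show "c j \<in> ?V" using cV j by blast
      show "c j \<noteq> zero_vec ?U" by (rule lin_indep_nonzero[OF c(2) _ j cV]) simp
      show "lin_comb ?U ?U (c j) H = (\<lambda>x\<in>?U. e j \<otimes> lin_comb ?U ?U (c j) G x)" using H j by blast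
    qed
    then have "c \<in> PiE {..<i} (?E H)" using c(1) by (simp add: PiE_iff[of c])
    then show "p \<in> (SIGMA H:?HH. PiE {..<i} (?E H))" unfolding p using H by blast
  qed
  also have "card (prod.swap ` (SIGMA c:?C. ?K c)) = card (SIGMA c:?C. ?K c)"
    by (rule card_image) simp
  also have "\<dots> = (\<Sum>c\<in>?C. card (?K c))"
  proof (rule card_SigmaI[OF finC], rule ballI)
    fix c show "finite (?K c)" by (rule finite_subset[OF _ finH]) blast
  qed
  also have "\<dots> = (\<Sum>c\<in>?C. q ^ (m * (m - i)))"
    by (rule sum.cong[OF refl], rule card_tuples_eigen[OF G i(2) _ _ eC]) blast+
  also have "\<dots> = card ?C * q ^ (m * (m - i))" by simp
  also have "card ?C = (\<Prod>j<i. q ^ m - q ^ j)"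
    using card_lin_indep[OF is_subspace_all, of ?U "{..<i}"] by (simp add: card_vecs)
  finally show ?thesis .
qed

text \<open>The contribution to \<open>sum_prod_eigvec\<close> of the maps with a higher-dimensional eigenspace for \<open>\<mu>0\<close> is
  smaller by a factor of order \<open>1 / q\<close>, because each such choice of eigenvectors can be enlarged in at
  least \<open>q - 1\<close> ways to one on which \<open>H\<close> is prescribed at one more place.\<close>

lemma sum_prod_eigvec_big:
  assumes G: "G \<in> {..<m} \<rightarrow>\<^sub>E ({..<m} \<rightarrow>\<^sub>E carrier R)" and indG: "lin_indep {..<m} {..<m} G"
    and S: "S \<subseteq> carrier R" and \<mu>0: "\<mu>0 \<in> S"
  shows "(\<Sum>H \<in> {H \<in> {..<m} \<rightarrow>\<^sub>E ({..<m} \<rightarrow>\<^sub>E carrier R). q - 1 < card (eigvec {..<m} {..<m} G H \<mu>0)}.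
      \<Prod>\<mu>\<in>S. card (eigvec {..<m} {..<m} G H \<mu>)) * (q - 1) \<le> q ^ (m * m)"
proof -
  let ?U = "{..<m}" let ?V = "{..<m} \<rightarrow>\<^sub>E carrier R" let ?HH = "?U \<rightarrow>\<^sub>E ?V"
  let ?HB = "{H \<in> ?HH. q - 1 < card (eigvec ?U ?U G H \<mu>0)}"
  define i where "i = card S"
  have finS: "finite S" using S finite_carrier by (rule finite_subset)
  obtain e where e: "bij_betw e {..<i} S"
    using ex_bij_betw_nat_finite[OF finS] by (auto simp: lessThan_atLeast0 i_def)
  have eC: "e \<in> {..<i} \<rightarrow> carrier R" and einj: "inj_on e {..<i}"
    using e S by (auto simp: bij_betw_def)
  obtain l where l: "l \<in> {..<i}" "e l = \<mu>0" using e \<mu>0 by (auto simp: bij_betw_def)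
  have \<mu>C: "\<mu>0 \<in> carrier R" using S \<mu>0 by blast
  \<comment> \<open>The index \<open>i\<close> is used for the additional eigenvector, which has eigenvalue \<open>\<mu>0\<close>.\<close>
  define e' where "e' = (\<lambda>j. if j = i then \<mu>0 else e j)"
  have e'C: "e' \<in> {..<Suc i} \<rightarrow> carrier R"
  proof
    fix j assume "j \<in> {..<Suc i}"
    then have "j = i \<or> j \<in> {..<i}" by auto
    then show "e' j \<in> carrier R" using eC \<mu>C unfolding e'_def by auto
  qed
  let ?E = "\<lambda>H j. eigvec ?U ?U G H (e j)"
  let ?W = "\<lambda>H c. eigvec ?U ?U G H \<mu>0 - (\<lambda>s. \<lambda>x\<in>?U. s \<otimes> c l x) ` carrier R"
  let ?C = "{c \<in> {..<Suc i} \<rightarrow>\<^sub>E ?V. lin_indep {..<Suc i} ?U c}"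
  let ?K = "\<lambda>c. {H \<in> ?HH. \<forall>j\<in>{..<Suc i}. lin_comb ?U ?U (c j) H = (\<lambda>x\<in>?U. e' j \<otimes> lin_comb ?U ?U (c j) G x)}"
  let ?D = "SIGMA H:?HB. SIGMA c:PiE {..<i} (?E H). ?W H c"
  have GP: "G \<in> ?U \<rightarrow> ?U \<rightarrow> carrier R" using G by auto
  have finH: "finite ?HH" by (rule finite_tuples) auto
  have finHB: "finite ?HB" by (rule finite_subset[OF _ finH]) blast
  have finC: "finite ?C"
    by (rule finite_subset[OF _ finite_tuples[of "{..<Suc i}" ?U]]) auto
  have finK: "finite (?K c)" for c by (rule finite_subset[OF _ finH]) blast
  have finP: "finite (PiE {..<i} (?E H))" for H by (intro finite_PiE finite_eigvec) auto
  have finW: "finite (?W H c)" for H c by (intro finite_Diff finite_eigvec) simp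
  have "(\<Prod>\<mu>\<in>S. card (eigvec ?U ?U G H \<mu>)) = card (PiE {..<i} (?E H))" for H
    using prod.reindex_bij_betw[OF e, of "\<lambda>\<mu>. card (eigvec ?U ?U G H \<mu>)"] by (simp add: card_PiE)
  then have "(\<Sum>H\<in>?HB. \<Prod>\<mu>\<in>S. card (eigvec ?U ?U G H \<mu>)) * (q - 1) =
      (\<Sum>H\<in>?HB. \<Sum>c\<in>PiE {..<i} (?E H). q - 1)"
    by (simp add: sum_distrib_right)
  also have "\<dots> \<le> (\<Sum>H\<in>?HB. \<Sum>c\<in>PiE {..<i} (?E H). card (?W H c))"
  proof (intro sum_mono)
    fix H c assume H: "H \<in> ?HB" and c: "c \<in> PiE {..<i} (?E H)"
    have HP: "H \<in> ?U \<rightarrow> ?U \<rightarrow> carrier R" using H by auto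
    have "c l \<in> eigvec ?U ?U G H \<mu>0" using PiE_mem[OF c l(1)] l(2) by simp
    moreover have "q - 1 < card (eigvec ?U ?U G H \<mu>0)" using H by blast
    ultimately show "q - 1 \<le> card (?W H c)"
      by (intro card_eigvec_off_line[OF _ GP HP \<mu>C]) simp_all
  qed
  also have "\<dots> = (\<Sum>H\<in>?HB. card (SIGMA c:PiE {..<i} (?E H). ?W H c))"
    by (intro sum.cong refl card_SigmaI[symmetric] ballI finP finW)
  also have "\<dots> = card ?D"
    by (intro card_SigmaI[symmetric] ballI finHB finite_SigmaI finP finW)
  also have "\<dots> \<le> card (SIGMA c:?C. ?K c)"
  proof (rule card_inj_on_le[where f = "\<lambda>(H, c, w). (c(i := w), H)"])
    show "inj_on (\<lambda>(H, c, w). (c(i := w), H)) ?D"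
    proof (rule inj_onI)
      fix p p' assume "p \<in> ?D" "p' \<in> ?D"
      then obtain H c w H' c' w' where p: "p = (H, c, w)" "p' = (H', c', w')"
        and c: "c \<in> PiE {..<i} (?E H)" and c': "c' \<in> PiE {..<i} (?E H')" by blast
      assume "(\<lambda>(H, c, w). (c(i := w), H)) p = (\<lambda>(H, c, w). (c(i := w), H)) p'"
      then have eq: "c(i := w) = c'(i := w')" and HH: "H = H'" by (simp_all add: p)
      have "c j = c' j" if "j \<in> {..<i}" for j
        using fun_cong[OF eq, of j] that by simp
      then have "c = c'" using PiE_ext[OF c] c' HH by blast
      moreover have "w = w'" using fun_cong[OF eq, of i] by simp
      ultimately show "p = p'" by (simp add: p HH)
    qed
    show "(\<lambda>(H, c, w). (c(i := w), H)) ` ?D \<subseteq> (SIGMA c:?C. ?K c)"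
    proof (rule image_subsetI)
      fix p assume "p \<in> ?D"
      then obtain H c w where p: "p = (H, c, w)" and H: "H \<in> ?HH" and c: "c \<in> PiE {..<i} (?E H)"
        and w: "w \<in> eigvec ?U ?U G H \<mu>0" "w \<notin> (\<lambda>s. \<lambda>x\<in>?U. s \<otimes> c l x) ` carrier R" by blast
      let ?c = "c(i := w)"
      have HP: "H \<in> ?U \<rightarrow> ?U \<rightarrow> carrier R" using H by auto
      have cE: "?c j \<in> ?E H j" if "j \<in> {..<i}" for j using PiE_mem[OF c that] that by simp
      have cE': "?c j \<in> eigvec ?U ?U G H (e' j)" if "j \<in> {..<Suc i}" for j
        using cE[of j] w(1) that by (cases "j = i") (auto simp: e'_def)
      have "lin_indep (insert i {..<i}) ?U ?c"
        by (rule eigvec_lin_indep_insert[OF _ _ GP HP indG eC einj cE _ l(1)]) (use w l in auto)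
      then have ind: "lin_indep {..<Suc i} ?U ?c" by (simp only: lessThan_Suc)
      have "c \<in> extensional {..<i}" using c by (simp add: PiE_def)
      then have "?c j = undefined" if "j \<notin> {..<Suc i}" for j
        using that by (simp add: extensional_def)
      then have "?c \<in> extensional {..<Suc i}" unfolding extensional_def by blast
      then have "?c \<in> {..<Suc i} \<rightarrow>\<^sub>E ?V" using eigvecD(1)[OF cE'] by (simp add: PiE_iff[of ?c])
      then have cC: "?c \<in> ?C" using ind by blast
      have HK: "H \<in> ?K ?c"
      proof (rule CollectI, rule conjI[OF H], rule ballI)
        fix j assume "j \<in> {..<Suc i}"
        then show "lin_comb ?U ?U (?c j) H = (\<lambda>x\<in>?U. e' j \<otimes> lin_comb ?U ?U (?c j) G x)"
          by (rule eigvecD(3)[OF cE'])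
      qed
      have "(?c, H) \<in> (SIGMA c:?C. ?K c)" by (rule SigmaI[where A = ?C and B = ?K, OF cC HK])
      moreover have "(\<lambda>(H, c, w). (c(i := w), H)) p = (?c, H)" by (simp add: p)
      ultimately show "(\<lambda>(H, c, w). (c(i := w), H)) p \<in> (SIGMA c:?C. ?K c)" by (simp only:)
    qed
    show "finite (SIGMA c:?C. ?K c)" by (intro finite_SigmaI finC finK)
  qed
  also have "\<dots> = (\<Sum>c\<in>?C. card (?K c))"
    by (intro card_SigmaI ballI finC finK)
  also have "\<dots> \<le> q ^ (m * m)"
  proof (cases "?C = {}")
    case True
    show ?thesis unfolding True by simp
  next
    case False
    then obtain c where c: "c \<in> {..<Suc i} \<rightarrow>\<^sub>E ?V" "lin_indep {..<Suc i} ?U c" by blast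
    have "card {..<Suc i} \<le> card ?U" by (rule lin_indep_card_le[OF c(2)]) (use c(1) in auto)
    then have im: "Suc i \<le> m" by simp
    have "(\<Sum>c\<in>?C. card (?K c)) = (\<Sum>c\<in>?C. q ^ (m * (m - Suc i)))"
      by (rule sum.cong[OF refl], rule card_tuples_eigen[OF G im _ _ e'C]) blast+
    also have "\<dots> = card ?C * q ^ (m * (m - Suc i))" by simp
    also have "\<dots> \<le> q ^ (m * Suc i) * q ^ (m * (m - Suc i))"
    proof (rule mult_le_mono1)
      have "card ?C \<le> card ({..<Suc i} \<rightarrow>\<^sub>E ?V)"
        by (rule card_mono[OF finite_tuples]) auto
      then show "card ?C \<le> q ^ (m * Suc i)" using card_tuples[of ?U "Suc i"] by simp
    qed
    also have "\<dots> = q ^ (m * m)" using im by (simp flip: power_add distrib_left del: mult_Suc_right)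
    finally show ?thesis .
  qed
  finally show ?thesis .
qed

end

section \<open>Maps without eigenvalues\<close>

lemma alternating_binomial_sum:
  fixes e m :: nat
  assumes "e \<le> m"
  shows "(\<Sum>i\<le>m. (-1) ^ i * int (e choose i)) = of_bool (e = 0)"
proof -
  have "(\<Sum>i\<le>m. (-1) ^ i * int (e choose i)) = (\<Sum>i\<le>e. (-1) ^ i * int (e choose i))"
    by (rule sum.mono_neutral_right) (use assms in \<open>auto simp: binomial_eq_0\<close>)
  also have "\<dots> = of_bool (e = 0)"
    using choose_alternating_sum[of e, where ?'a = int] by (cases "e = 0") auto
  finally show ?thesis .
qed

context finite_field
begin

text \<open>The maps \<open>H\<close> that have every element of \<open>S\<close> as an eigenvalue relative to \<open>G\<close>.\<close>

definition hit :: "nat \<Rightarrow> (nat \<Rightarrow> nat \<Rightarrow> 'a) \<Rightarrow> 'a set \<Rightarrow> (nat \<Rightarrow> nat \<Rightarrow> 'a) set" where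
  "hit m G S = {H \<in> {..<m} \<rightarrow>\<^sub>E ({..<m} \<rightarrow>\<^sub>E carrier R). \<forall>\<mu>\<in>S. eigvec {..<m} {..<m} G H \<mu> \<noteq> {}}"

text \<open>The maps \<open>H\<close> without any eigenvalue relative to \<open>G\<close>.\<close>

definition spectrum_free :: "nat \<Rightarrow> (nat \<Rightarrow> nat \<Rightarrow> 'a) \<Rightarrow> (nat \<Rightarrow> nat \<Rightarrow> 'a) set" where
  "spectrum_free m G = {H \<in> {..<m} \<rightarrow>\<^sub>E ({..<m} \<rightarrow>\<^sub>E carrier R). \<forall>\<mu>\<in>carrier R. eigvec {..<m} {..<m} G H \<mu> = {}}"

lemma card_hit_upper:
  assumes G: "G \<in> {..<m} \<rightarrow>\<^sub>E ({..<m} \<rightarrow>\<^sub>E carrier R)" and indG: "lin_indep {..<m} {..<m} G"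
    and S: "S \<subseteq> carrier R" and i: "card S = i" "i \<le> m"
  shows "card (hit m G S) * (q - 1) ^ i \<le> (\<Prod>j<i. q ^ m - q ^ j) * q ^ (m * (m - i))"
proof -
  let ?U = "{..<m}" let ?HH = "?U \<rightarrow>\<^sub>E (?U \<rightarrow>\<^sub>E carrier R)"
  have finH: "finite ?HH" by (rule finite_tuples) auto
  have GP: "G \<in> ?U \<rightarrow> ?U \<rightarrow> carrier R" using G by auto
  have "card (hit m G S) * (q - 1) ^ i = (\<Sum>H\<in>hit m G S. \<Prod>\<mu>\<in>S. q - 1)"
    by (simp add: i(1))
  also have "\<dots> \<le> (\<Sum>H\<in>hit m G S. \<Prod>\<mu>\<in>S. card (eigvec ?U ?U G H \<mu>))"
  proof (intro sum_mono prod_mono conjI)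
    fix H \<mu> assume H: "H \<in> hit m G S" and \<mu>: "\<mu> \<in> S"
    have HP: "H \<in> ?U \<rightarrow> ?U \<rightarrow> carrier R" using H unfolding hit_def by auto
    show "q - 1 \<le> card (eigvec ?U ?U G H \<mu>)"
      by (rule card_eigvec_ge[OF _ GP HP]) (use H S \<mu> in \<open>auto simp: hit_def\<close>)
  qed simp
  also have "\<dots> \<le> (\<Sum>H\<in>?HH. \<Prod>\<mu>\<in>S. card (eigvec ?U ?U G H \<mu>))"
    by (rule sum_mono2[OF finH]) (auto simp: hit_def)
  also have "\<dots> = (\<Prod>j<i. q ^ m - q ^ j) * q ^ (m * (m - i))"
    by (rule sum_prod_eigvec[OF G indG S i])
  finally show ?thesis .
qed

lemma card_hit_lower:
  assumes G: "G \<in> {..<m} \<rightarrow>\<^sub>E ({..<m} \<rightarrow>\<^sub>E carrier R)" and indG: "lin_indep {..<m} {..<m} G"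
    and S: "S \<subseteq> carrier R" and i: "card S = i" "i \<le> m"
  shows "(\<Prod>j<i. q ^ m - q ^ j) * q ^ (m * (m - i)) * (q - 1) \<le>
    card (hit m G S) * (q - 1) ^ Suc i + i * q ^ (m * m)"
proof -
  let ?U = "{..<m}" let ?HH = "?U \<rightarrow>\<^sub>E (?U \<rightarrow>\<^sub>E carrier R)"
  let ?z = "\<lambda>H \<mu>. card (eigvec ?U ?U G H \<mu>)"
  let ?HB = "\<lambda>\<mu>. {H \<in> ?HH. q - 1 < ?z H \<mu>}"
  have finH: "finite ?HH" by (rule finite_tuples) auto
  have finS: "finite S" using S finite_carrier by (rule finite_subset)
  \<comment> \<open>If no eigenspace is large, the product is either 0 or bounded by that of one-dimensional ones.\<close>
  have pw: "(\<Prod>\<mu>\<in>S. ?z H \<mu>) \<le> (if H \<in> hit m G S then (q - 1) ^ i else 0) +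
      (\<Sum>\<mu>0\<in>S. if q - 1 < ?z H \<mu>0 then \<Prod>\<mu>\<in>S. ?z H \<mu> else 0)" if H: "H \<in> ?HH" for H
  proof (cases "\<exists>\<mu>0\<in>S. q - 1 < ?z H \<mu>0")
    case True
    then obtain \<mu>0 where \<mu>0: "\<mu>0 \<in> S" "q - 1 < ?z H \<mu>0" by blast
    have "(\<Prod>\<mu>\<in>S. ?z H \<mu>) = (if q - 1 < ?z H \<mu>0 then \<Prod>\<mu>\<in>S. ?z H \<mu> else 0)"
      using \<mu>0(2) by simp
    also have "\<dots> \<le> (\<Sum>\<mu>0\<in>S. if q - 1 < ?z H \<mu>0 then \<Prod>\<mu>\<in>S. ?z H \<mu> else 0)"
      by (rule member_le_sum[OF \<mu>0(1) _ finS]) simp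
    finally show ?thesis by simp
  next
    case False
    then have small: "?z H \<mu> \<le> q - 1" if "\<mu> \<in> S" for \<mu> using that by (simp add: not_less)
    show ?thesis
    proof (cases "H \<in> hit m G S")
      case True
      have "(\<Prod>\<mu>\<in>S. ?z H \<mu>) \<le> (\<Prod>\<mu>\<in>S. q - 1)" by (rule prod_mono) (use small in simp)
      then show ?thesis using True i(1) by simp
    next
      case False
      then obtain \<mu> where \<mu>: "\<mu> \<in> S" "eigvec ?U ?U G H \<mu> = {}" using H unfolding hit_def by blast
      then have "?z H \<mu> = 0" by simp
      then have "(\<Prod>\<mu>\<in>S. ?z H \<mu>) = 0" using \<mu>(1) finS by (intro prod_zero) blast+
      then show ?thesis by simp
    qed
  qed
  have "(\<Prod>j<i. q ^ m - q ^ j) * q ^ (m * (m - i)) = (\<Sum>H\<in>?HH. \<Prod>\<mu>\<in>S. ?z H \<mu>)"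
    by (rule sum_prod_eigvec[OF G indG S i, symmetric])
  also have "\<dots> \<le> (\<Sum>H\<in>?HH. (if H \<in> hit m G S then (q - 1) ^ i else 0) +
      (\<Sum>\<mu>0\<in>S. if q - 1 < ?z H \<mu>0 then \<Prod>\<mu>\<in>S. ?z H \<mu> else 0))"
    by (rule sum_mono[OF pw])
  also have "\<dots> = (\<Sum>H\<in>?HH. if H \<in> hit m G S then (q - 1) ^ i else 0) +
      (\<Sum>H\<in>?HH. \<Sum>\<mu>0\<in>S. if q - 1 < ?z H \<mu>0 then \<Prod>\<mu>\<in>S. ?z H \<mu> else 0)"
    by (rule sum.distrib)
  also have "(\<Sum>H\<in>?HH. if H \<in> hit m G S then (q - 1) ^ i else 0) = card (hit m G S) * (q - 1) ^ i"
  proof -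
    have "?HH \<inter> hit m G S = hit m G S" unfolding hit_def by blast
    then show ?thesis using finH by (simp flip: sum.inter_restrict)
  qed
  also have "(\<Sum>H\<in>?HH. \<Sum>\<mu>0\<in>S. if q - 1 < ?z H \<mu>0 then \<Prod>\<mu>\<in>S. ?z H \<mu> else 0) =
      (\<Sum>\<mu>0\<in>S. \<Sum>H\<in>?HH. if q - 1 < ?z H \<mu>0 then \<Prod>\<mu>\<in>S. ?z H \<mu> else 0)"
    by (rule sum.swap)
  also have "\<dots> = (\<Sum>\<mu>0\<in>S. \<Sum>H\<in>?HB \<mu>0. \<Prod>\<mu>\<in>S. ?z H \<mu>)"
    by (rule sum.cong[OF refl], rule sum.inter_filter[OF finH, symmetric])
  finally have le: "(\<Prod>j<i. q ^ m - q ^ j) * q ^ (m * (m - i)) \<le>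
      card (hit m G S) * (q - 1) ^ i + (\<Sum>\<mu>0\<in>S. \<Sum>H\<in>?HB \<mu>0. \<Prod>\<mu>\<in>S. ?z H \<mu>)" .
  have "(\<Sum>\<mu>0\<in>S. \<Sum>H\<in>?HB \<mu>0. \<Prod>\<mu>\<in>S. ?z H \<mu>) * (q - 1) \<le> (\<Sum>\<mu>0\<in>S. q ^ (m * m))"
    unfolding sum_distrib_right[of _ S]
    by (rule sum_mono, rule sum_prod_eigvec_big[OF G indG S])
  also have "\<dots> = i * q ^ (m * m)" using i(1) by simp
  finally have big: "(\<Sum>\<mu>0\<in>S. \<Sum>H\<in>?HB \<mu>0. \<Prod>\<mu>\<in>S. ?z H \<mu>) * (q - 1) \<le> i * q ^ (m * m)" .
  have "(\<Prod>j<i. q ^ m - q ^ j) * q ^ (m * (m - i)) * (q - 1) \<le>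
      (card (hit m G S) * (q - 1) ^ i + (\<Sum>\<mu>0\<in>S. \<Sum>H\<in>?HB \<mu>0. \<Prod>\<mu>\<in>S. ?z H \<mu>)) * (q - 1)"
    by (rule mult_le_mono1[OF le])
  also have "\<dots> = card (hit m G S) * (q - 1) ^ Suc i +
      (\<Sum>\<mu>0\<in>S. \<Sum>H\<in>?HB \<mu>0. \<Prod>\<mu>\<in>S. ?z H \<mu>) * (q - 1)"
    unfolding add_mult_distrib power_Suc by (simp only: ac_simps)
  also have "\<dots> \<le> card (hit m G S) * (q - 1) ^ Suc i + i * q ^ (m * m)"
    by (rule add_left_mono[OF big])
  finally show ?thesis .
qed

lemma card_eigenvalues_le:
  assumes G: "G \<in> {..<m} \<rightarrow>\<^sub>E ({..<m} \<rightarrow>\<^sub>E carrier R)" and indG: "lin_indep {..<m} {..<m} G"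
    and H: "H \<in> {..<m} \<rightarrow>\<^sub>E ({..<m} \<rightarrow>\<^sub>E carrier R)"
  shows "card {\<mu> \<in> carrier R. eigvec {..<m} {..<m} G H \<mu> \<noteq> {}} \<le> m"
proof -
  let ?U = "{..<m}" 
  let ?S = "{\<mu> \<in> carrier R. eigvec ?U ?U G H \<mu> \<noteq> {}}"
  have GP: "G \<in> ?U \<rightarrow> ?U \<rightarrow> carrier R" and HP: "H \<in> ?U \<rightarrow> ?U \<rightarrow> carrier R" using G H by auto
  have finS: "finite ?S" by (rule finite_subset[OF _ finite_carrier]) blast
  define c where "c = (\<lambda>\<mu>. SOME w. w \<in> eigvec ?U ?U G H \<mu>)"
  have c: "c \<mu> \<in> eigvec ?U ?U G H \<mu>" if "\<mu> \<in> ?S" for \<mu>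
    using that unfolding c_def by (simp add: some_in_eq)
  have "lin_indep ?S ?U c"
    by (rule eigvec_lin_indep[OF _ finS GP HP indG, of "\<lambda>x. x"]) (use c in auto)
  moreover have "c \<in> ?S \<rightarrow> ?U \<rightarrow>\<^sub>E carrier R" using eigvecD(1)[OF c] by blast
  ultimately have "card ?S \<le> card ?U" by (intro lin_indep_card_le[OF _ finS]) auto
  then show ?thesis by simp
qed

text \<open>Inclusion-exclusion over the set of eigenvalues. It stops at \<open>m\<close> because a map has at most \<open>m\<close>
  eigenvalues.\<close>

lemma card_spectrum_free:
  assumes G: "G \<in> {..<m} \<rightarrow>\<^sub>E ({..<m} \<rightarrow>\<^sub>E carrier R)" and indG: "lin_indep {..<m} {..<m} G"
  shows "int (card (spectrum_free m G)) =
    (\<Sum>i\<le>m. (-1) ^ i * int (\<Sum>S | S \<subseteq> carrier R \<and> card S = i. card (hit m G S)))"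
proof -
  let ?U = "{..<m}" let ?HH = "?U \<rightarrow>\<^sub>E (?U \<rightarrow>\<^sub>E carrier R)"
  let ?sp = "\<lambda>H. {\<mu> \<in> carrier R. eigvec ?U ?U G H \<mu> \<noteq> {}}"
  let ?P = "\<lambda>i. {S. S \<subseteq> carrier R \<and> card S = i}"
  have finH: "finite ?HH" by (rule finite_tuples) auto
  have finsp: "finite (?sp H)" for H by (rule finite_subset[OF _ finite_carrier]) blast
  have finP: "finite (?P i)" for i
    by (rule finite_subset[of _ "Pow (carrier R)"]) auto
  have choose: "(\<Sum>S\<in>?P i. of_bool (H \<in> hit m G S)) = card (?sp H) choose i" if H: "H \<in> ?HH" for i H
  proof -
    have "(\<Sum>S\<in>?P i. of_bool (H \<in> hit m G S)) = card {S \<in> ?P i. H \<in> hit m G S}"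
      using finP by (simp add: sum_of_bool_eq Int_def)
    also have "{S \<in> ?P i. H \<in> hit m G S} = {S. S \<subseteq> ?sp H \<and> card S = i}"
      using H unfolding hit_def by blast
    also have "card \<dots> = card (?sp H) choose i" by (rule n_subsets[OF finsp])
    finally show ?thesis .
  qed
  have "int (card (spectrum_free m G)) = (\<Sum>H\<in>?HH. of_bool (card (?sp H) = 0))"
  proof -
    have "spectrum_free m G = {H \<in> ?HH. card (?sp H) = 0}"
      using finsp unfolding spectrum_free_def by auto
    then show ?thesis using finH by (simp add: sum_of_bool_eq Int_def)
  qed
  also have "\<dots> = (\<Sum>H\<in>?HH. \<Sum>i\<le>m. (-1) ^ i * int (card (?sp H) choose i))"
    by (rule sum.cong[OF refl], rule alternating_binomial_sum[symmetric], rule card_eigenvalues_le[OF G indG])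
  also have "\<dots> = (\<Sum>i\<le>m. \<Sum>H\<in>?HH. (-1) ^ i * int (card (?sp H) choose i))"
    by (rule sum.swap)
  also have "\<dots> = (\<Sum>i\<le>m. (-1) ^ i * int (\<Sum>H\<in>?HH. card (?sp H) choose i))"
    by (simp only: sum_distrib_left of_nat_sum)
  also have "\<dots> = (\<Sum>i\<le>m. (-1) ^ i * int (\<Sum>S\<in>?P i. card (hit m G S)))"
  proof -
    have "(\<Sum>H\<in>?HH. card (?sp H) choose i) = (\<Sum>S\<in>?P i. card (hit m G S))" for i
    proof -
      have "(\<Sum>H\<in>?HH. card (?sp H) choose i) = (\<Sum>H\<in>?HH. \<Sum>S\<in>?P i. of_bool (H \<in> hit m G S))"
        by (rule sum.cong[OF refl], rule choose[symmetric])
      also have "\<dots> = (\<Sum>S\<in>?P i. \<Sum>H\<in>?HH. of_bool (H \<in> hit m G S))" by (rule sum.swap)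
      also have "\<dots> = (\<Sum>S\<in>?P i. card (hit m G S))"
      proof (rule sum.cong[OF refl])
        fix S
        have "?HH \<inter> {H. H \<in> hit m G S} = hit m G S" unfolding hit_def by blast
        then show "(\<Sum>H\<in>?HH. of_bool (H \<in> hit m G S)) = card (hit m G S)"
          using finH by (simp add: sum_of_bool_eq)
      qed
      finally show ?thesis .
    qed
    then show ?thesis by simp
  qed
  finally show ?thesis .
qed

end

section \<open>Codes of matrices with two rows\<close>

context finite_field
begin

lemma card_le_rank_one:
  assumes M: "M \<in> {..<2} \<times> {..<m} \<rightarrow>\<^sub>E carrier R"
    and ab: "a \<in> carrier R" "b \<in> carrier R" and s: "\<And>j. j < m \<Longrightarrow> s j \<in> carrier R"
    and M0: "\<And>j. j < m \<Longrightarrow> M (0, j) = s j \<otimes> a" and M1: "\<And>j. j < m \<Longrightarrow> M (1, j) = s j \<otimes> b"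
  shows "mat_rank R 2 m M \<le> 1"
proof (rule mat_rank_le[OF M])
  define v where "v = (\<lambda>i\<in>{..<2::nat}. if i = 0 then a else b)"
  let ?W = "lin_span {0::nat} {..<2} (\<lambda>_. v)"
  have v: "v \<in> {..<2} \<rightarrow> carrier R" using ab by (auto simp: v_def)
  have W: "?W = (\<lambda>s. \<lambda>x\<in>{..<2}. s \<otimes> v x) ` carrier R" by (rule lin_span_single[OF v])
  show "is_subspace {..<2} ?W" by (rule is_subspace_lin_span) (use v in auto)
  show "card ?W \<le> q ^ 1" unfolding W using card_image_le[OF finite_carrier] by simp
  fix j assume j: "j < m"
  have "mat_col 2 M j = (\<lambda>x\<in>{..<2}. s j \<otimes> v x)"
    unfolding mat_col_def
  proof (rule restrict_ext)
    fix i :: nat assume "i \<in> {..<2}"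
    then have "i = 0 \<or> i = 1" by auto
    then show "M (i, j) = s j \<otimes> v i" using M0[OF j] M1[OF j] by (auto simp: v_def)
  qed
  then show "mat_col 2 M j \<in> ?W" unfolding W using s[OF j] by blast
qed

lemma rank_two_rows:
  assumes M: "M \<in> {..<2} \<times> {..<m} \<rightarrow>\<^sub>E carrier R"
  shows "\<not> 2 \<le> mat_rank R 2 m M \<longleftrightarrow>
    (\<forall>j<m. M (0, j) = \<zero>) \<or> (\<exists>\<mu>\<in>carrier R. \<forall>j<m. M (1, j) = \<mu> \<otimes> M (0, j))"
    (is "_ \<longleftrightarrow> ?Z \<or> ?L")
proof
  have Mc: "M (i, j) \<in> carrier R" if "i < 2" "j < m" for i j using PiE_mem[OF M, of "(i, j)"] that by simp
  assume "?Z \<or> ?L"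
  then have "mat_rank R 2 m M \<le> 1"
  proof
    assume ?Z
    then show ?thesis
      by (intro card_le_rank_one[OF M, of \<zero> \<one> "\<lambda>j. M (1, j)"]) (use Mc in simp_all)
  next
    assume ?L
    then obtain \<mu> where "\<mu> \<in> carrier R" "\<And>j. j < m \<Longrightarrow> M (1, j) = \<mu> \<otimes> M (0, j)" by blast
    then show ?thesis
      by (intro card_le_rank_one[OF M, of \<one> \<mu> "\<lambda>j. M (0, j)"]) (use Mc in \<open>simp_all add: m_comm\<close>)
  qed
  then show "\<not> 2 \<le> mat_rank R 2 m M" by simp
next
  have Mc: "M (i, j) \<in> carrier R" if "i < 2" "j < m" for i j using PiE_mem[OF M, of "(i, j)"] that by simp
  assume "\<not> 2 \<le> mat_rank R 2 m M"
  then have "mat_rank R 2 m M \<le> 1" by simp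
  then have "q ^ mat_rank R 2 m M \<le> q ^ 1" using q_ge_2 by (intro power_increasing) auto
  then have small: "card (colspan 2 m M) \<le> q" using colspan(3)[OF M] by simp
  have sub: "is_subspace {..<2} (colspan 2 m M)" by (rule colspan(1)[OF M])
  show "?Z \<or> ?L"
  proof (cases ?Z)
    case False
    then obtain l where l: "l < m" "M (0, l) \<noteq> \<zero>" by blast
    let ?f = "\<lambda>s. \<lambda>x\<in>{..<2}. s \<otimes> mat_col 2 M l x"
    have col: "mat_col 2 M j i = M (i, j)" if "i < 2" for i j using that by (simp add: mat_col_def)
    have "inj_on ?f (carrier R)"
    proof (rule inj_onI)
      fix s t assume st: "s \<in> carrier R" "t \<in> carrier R" and "?f s = ?f t"
      then have "?f s 0 = ?f t 0" by simp
      then have "s \<otimes> M (0, l) = t \<otimes> M (0, l)" by (simp add: col)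
      then show "s = t" using st l Mc[of 0 l] m_rcancel by auto
    qed
    then have "card (?f ` carrier R) = q" by (rule card_image)
    moreover have "?f ` carrier R \<subseteq> colspan 2 m M"
      using sub colspan(2)[OF M l(1)] unfolding is_subspace_def by blast
    ultimately have eq: "?f ` carrier R = colspan 2 m M"
      using small is_subspace_finite[OF sub] by (intro card_seteq) auto
    define \<mu> where "\<mu> = M (1, l) \<otimes> inv M (0, l)"
    have iv: "inv M (0, l) \<in> carrier R" "inv M (0, l) \<otimes> M (0, l) = \<one>"
      using l Mc[of 0 l] by (auto simp: field_Units)
    have \<mu>: "\<mu> \<in> carrier R" using iv Mc[of 1 l] l by (simp add: \<mu>_def)
    have M1: "M (1, l) = \<mu> \<otimes> M (0, l)" using iv Mc[of 1 l] Mc[of 0 l] l by (simp add: \<mu>_def m_assoc)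
    have "M (1, j) = \<mu> \<otimes> M (0, j)" if j: "j < m" for j
    proof -
      have "mat_col 2 M j \<in> ?f ` carrier R" unfolding eq by (rule colspan(2)[OF M j])
      then obtain s where s: "s \<in> carrier R" "mat_col 2 M j = ?f s" by blast
      have fi: "mat_col 2 M j i = ?f s i" for i unfolding s(2) ..
      have "M (i, j) = s \<otimes> M (i, l)" if "i < 2" for i
        using fi[of i] that unfolding col[OF that] by (simp add: col[OF that])
      then have "M (0, j) = s \<otimes> M (0, l)" "M (1, j) = s \<otimes> M (1, l)" by simp_all
      then show ?thesis using M1 \<mu> s(1) Mc[of 0 l] l by (simp add: m_lcomm)
    qed
    then show ?thesis using \<mu> by blast
  qed blast
qed

text \<open>The family of \<open>2 \<times> m\<close> matrices with first rows \<open>G i\<close> and second rows \<open>H i\<close>.\<close>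

definition stack :: "nat \<Rightarrow> (nat \<Rightarrow> nat \<Rightarrow> 'a) \<Rightarrow> (nat \<Rightarrow> nat \<Rightarrow> 'a) \<Rightarrow> nat \<Rightarrow> nat \<times> nat \<Rightarrow> 'a" where
  "stack m G H = (\<lambda>i\<in>{..<m}. \<lambda>p\<in>{..<2} \<times> {..<m}. if fst p = 0 then G i (snd p) else H i (snd p))"

lemma stack_apply:
  assumes "i < m" "j < m"
  shows "stack m G H i (0, j) = G i j" "stack m G H i (1, j) = H i j"
  using assms by (simp_all add: stack_def)

lemma stack_closed:
  assumes G: "G \<in> {..<m} \<rightarrow>\<^sub>E ({..<m} \<rightarrow>\<^sub>E carrier R)" and H: "H \<in> {..<m} \<rightarrow>\<^sub>E ({..<m} \<rightarrow>\<^sub>E carrier R)"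
  shows "stack m G H \<in> {..<m} \<rightarrow>\<^sub>E ({..<2} \<times> {..<m} \<rightarrow>\<^sub>E carrier R)"
proof -
  have "(if fst p = 0 then G i (snd p) else H i (snd p)) \<in> carrier R"
    if "i \<in> {..<m}" "p \<in> {..<2} \<times> {..<m}" for i p
  proof -
    have "snd p \<in> {..<m}" using that by auto
    then have "G i (snd p) \<in> carrier R" "H i (snd p) \<in> carrier R"
      using PiE_mem[OF PiE_mem[OF G that(1)]] PiE_mem[OF PiE_mem[OF H that(1)]] by blast+
    then show ?thesis by simp
  qed
  then show ?thesis unfolding stack_def restrict_PiE_iff by (intro ballI)
qed

lemma lin_comb_stack:
  assumes G: "G \<in> {..<m} \<rightarrow>\<^sub>E ({..<m} \<rightarrow>\<^sub>E carrier R)" and H: "H \<in> {..<m} \<rightarrow>\<^sub>E ({..<m} \<rightarrow>\<^sub>E carrier R)"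
    and c: "c \<in> {..<m} \<rightarrow>\<^sub>E carrier R" and j: "j < m"
  shows "lin_comb {..<m} ({..<2} \<times> {..<m}) c (stack m G H) (0, j) = lin_comb {..<m} {..<m} c G j"
    and "lin_comb {..<m} ({..<2} \<times> {..<m}) c (stack m G H) (1, j) = lin_comb {..<m} {..<m} c H j"
proof -
  have cc: "c i \<in> carrier R" if "i \<in> {..<m}" for i using c that by auto
  have Gc: "G i j \<in> carrier R" "H i j \<in> carrier R" if "i \<in> {..<m}" for i using G H that j by auto
  have "(\<Oplus>i\<in>{..<m}. c i \<otimes> stack m G H i (0, j)) = (\<Oplus>i\<in>{..<m}. c i \<otimes> G i j)"
    by (rule finsum_cong'[OF refl]) (use cc Gc j in \<open>auto simp: stack_apply\<close>)
  then show "lin_comb {..<m} ({..<2} \<times> {..<m}) c (stack m G H) (0, j) = lin_comb {..<m} {..<m} c G j"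
    using j by (simp add: lin_comb_def)
  have "(\<Oplus>i\<in>{..<m}. c i \<otimes> stack m G H i (1, j)) = (\<Oplus>i\<in>{..<m}. c i \<otimes> H i j)"
    by (rule finsum_cong'[OF refl]) (use cc Gc j stack_apply[of _ m j G H] in auto)
  then show "lin_comb {..<m} ({..<2} \<times> {..<m}) c (stack m G H) (1, j) = lin_comb {..<m} {..<m} c H j"
    using j by (simp add: lin_comb_def)
qed

text \<open>In the code spanned by \<open>stack m G H\<close> the matrix with coefficients \<open>c\<close> has the rows \<open>c G\<close> and
  \<open>c H\<close>. It has rank 2 for all \<open>c \<noteq> 0\<close> if and only if \<open>c G\<close> never vanishes and \<open>c H\<close> is never a multiple
  of \<open>c G\<close>.\<close>

lemma stack_good_iff:
  assumes G: "G \<in> {..<m} \<rightarrow>\<^sub>E ({..<m} \<rightarrow>\<^sub>E carrier R)" and H: "H \<in> {..<m} \<rightarrow>\<^sub>E ({..<m} \<rightarrow>\<^sub>E carrier R)"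
  shows "lin_indep {..<m} ({..<2} \<times> {..<m}) (stack m G H) \<and>
      (\<forall>M \<in> lin_span {..<m} ({..<2} \<times> {..<m}) (stack m G H). M \<noteq> zero_vec ({..<2} \<times> {..<m}) \<longrightarrow> 2 \<le> mat_rank R 2 m M)
    \<longleftrightarrow> lin_indep {..<m} {..<m} G \<and> H \<in> spectrum_free m G" (is "?ind \<and> ?rk \<longleftrightarrow> _")
proof -
  let ?U = "{..<m}" let ?X = "{..<2::nat} \<times> ?U" let ?g = "stack m G H"
  have gX: "?g \<in> ?U \<rightarrow> ?X \<rightarrow> carrier R" using stack_closed[OF G H] by (auto simp del: restrict_PiE_iff)
  have GP: "G \<in> ?U \<rightarrow> ?U \<rightarrow> carrier R" "H \<in> ?U \<rightarrow> ?U \<rightarrow> carrier R" using G H by auto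
  have Mcl: "lin_comb ?U ?X c ?g \<in> ?X \<rightarrow>\<^sub>E carrier R" if "c \<in> ?U \<rightarrow>\<^sub>E carrier R" for c
    by (rule lin_comb_closed[OF _ gX]) (use that in auto)
  have GHcl: "lin_comb ?U ?U c G \<in> ?U \<rightarrow>\<^sub>E carrier R" "lin_comb ?U ?U c H \<in> ?U \<rightarrow>\<^sub>E carrier R"
    if "c \<in> ?U \<rightarrow>\<^sub>E carrier R" for c
  proof -
    have "c \<in> ?U \<rightarrow> carrier R" using that by auto
    then show "lin_comb ?U ?U c G \<in> ?U \<rightarrow>\<^sub>E carrier R" "lin_comb ?U ?U c H \<in> ?U \<rightarrow>\<^sub>E carrier R"
      using lin_comb_closed GP by blast+
  qed
  have rank: "\<not> 2 \<le> mat_rank R 2 m (lin_comb ?U ?X c ?g) \<longleftrightarrow>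
      lin_comb ?U ?U c G = zero_vec ?U \<or> (\<exists>\<mu>\<in>carrier R. lin_comb ?U ?U c H = (\<lambda>x\<in>?U. \<mu> \<otimes> lin_comb ?U ?U c G x))"
    if c: "c \<in> ?U \<rightarrow>\<^sub>E carrier R" for c
  proof -
    have "(\<forall>j<m. lin_comb ?U ?X c ?g (0, j) = \<zero>) \<longleftrightarrow> lin_comb ?U ?U c G = zero_vec ?U"
    proof
      assume *: "\<forall>j<m. lin_comb ?U ?X c ?g (0, j) = \<zero>"
      show "lin_comb ?U ?U c G = zero_vec ?U"
        by (rule PiE_ext[OF GHcl(1)[OF c] zero_vec_closed]) (use * lin_comb_stack(1)[OF G H c] in simp)
    next
      assume "lin_comb ?U ?U c G = zero_vec ?U"
      then show "\<forall>j<m. lin_comb ?U ?X c ?g (0, j) = \<zero>" using lin_comb_stack(1)[OF G H c] by simp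
    qed
    moreover have "(\<forall>j<m. lin_comb ?U ?X c ?g (1, j) = \<mu> \<otimes> lin_comb ?U ?X c ?g (0, j)) \<longleftrightarrow>
        lin_comb ?U ?U c H = (\<lambda>x\<in>?U. \<mu> \<otimes> lin_comb ?U ?U c G x)" if \<mu>: "\<mu> \<in> carrier R" for \<mu>
    proof
      assume *: "\<forall>j<m. lin_comb ?U ?X c ?g (1, j) = \<mu> \<otimes> lin_comb ?U ?X c ?g (0, j)"
      show "lin_comb ?U ?U c H = (\<lambda>x\<in>?U. \<mu> \<otimes> lin_comb ?U ?U c G x)"
      proof (rule PiE_ext[OF GHcl(2)[OF c]])
        show "(\<lambda>x\<in>?U. \<mu> \<otimes> lin_comb ?U ?U c G x) \<in> ?U \<rightarrow>\<^sub>E carrier R"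
          using PiE_mem[OF GHcl(1)[OF c]] \<mu> by auto
        fix j assume "j \<in> ?U"
        then show "lin_comb ?U ?U c H j = (\<lambda>x\<in>?U. \<mu> \<otimes> lin_comb ?U ?U c G x) j"
          using * lin_comb_stack[OF G H c, of j] by simp
      qed
    next
      assume *: "lin_comb ?U ?U c H = (\<lambda>x\<in>?U. \<mu> \<otimes> lin_comb ?U ?U c G x)"
      show "\<forall>j<m. lin_comb ?U ?X c ?g (1, j) = \<mu> \<otimes> lin_comb ?U ?X c ?g (0, j)"
      proof (intro allI impI)
        fix j assume j: "j < m"
        show "lin_comb ?U ?X c ?g (1, j) = \<mu> \<otimes> lin_comb ?U ?X c ?g (0, j)"
          unfolding lin_comb_stack[OF G H c j] * using j by simp
      qed
    qed
    ultimately show ?thesis unfolding rank_two_rows[OF Mcl[OF c]] by blast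
  qed
  show ?thesis
  proof
    assume L: "?ind \<and> ?rk"
    have key: "lin_comb ?U ?U c G \<noteq> zero_vec ?U \<and> (\<forall>\<mu>\<in>carrier R. lin_comb ?U ?U c H \<noteq> (\<lambda>x\<in>?U. \<mu> \<otimes> lin_comb ?U ?U c G x))"
      if c: "c \<in> ?U \<rightarrow>\<^sub>E carrier R" "c \<noteq> zero_vec ?U" for c
    proof -
      have "lin_comb ?U ?X c ?g \<noteq> zero_vec ?X" using L c unfolding lin_indep_def by blast
      moreover have "lin_comb ?U ?X c ?g \<in> lin_span ?U ?X ?g" by (rule lin_spanI[OF c(1)])
      ultimately have "2 \<le> mat_rank R 2 m (lin_comb ?U ?X c ?g)" using L by blast
      then show ?thesis using rank[OF c(1)] by blast
    qed
    have "lin_indep ?U ?U G" unfolding lin_indep_def using key by blast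
    moreover have "H \<in> spectrum_free m G"
      unfolding spectrum_free_def eigvec_def using key H by blast
    ultimately show "lin_indep ?U ?U G \<and> H \<in> spectrum_free m G" ..
  next
    assume A: "lin_indep ?U ?U G \<and> H \<in> spectrum_free m G"
    have rk2: "2 \<le> mat_rank R 2 m (lin_comb ?U ?X c ?g)" if c: "c \<in> ?U \<rightarrow>\<^sub>E carrier R" "c \<noteq> zero_vec ?U" for c
    proof (rule ccontr)
      assume "\<not> 2 \<le> mat_rank R 2 m (lin_comb ?U ?X c ?g)"
      then consider "lin_comb ?U ?U c G = zero_vec ?U"
        | \<mu> where "\<mu> \<in> carrier R" "lin_comb ?U ?U c H = (\<lambda>x\<in>?U. \<mu> \<otimes> lin_comb ?U ?U c G x)"
        using rank[OF c(1)] by blast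
      then show False
      proof cases
        case 1
        then show False using A c unfolding lin_indep_def by blast
      next
        case 2
        then have "c \<in> eigvec ?U ?U G H \<mu>" using c by (intro eigvecI)
        then show False using A 2(1) unfolding spectrum_free_def by blast
      qed
    qed
    have ?ind
      unfolding lin_indep_def
    proof (intro ballI impI, rule ccontr)
      fix c assume c: "c \<in> ?U \<rightarrow>\<^sub>E carrier R" "lin_comb ?U ?X c ?g = zero_vec ?X" "c \<noteq> zero_vec ?U"
      have "lin_comb ?U ?U c G = zero_vec ?U"
        by (rule PiE_ext[OF GHcl(1)[OF c(1)] zero_vec_closed])
           (use c(2) lin_comb_stack(1)[OF G H c(1)] in simp)
      then show False using A c unfolding lin_indep_def by blast
    qed
    moreover have ?rk
    proof (intro ballI impI)
      fix M assume "M \<in> lin_span ?U ?X ?g" and nz: "M \<noteq> zero_vec ?X"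
      then obtain c where c: "c \<in> ?U \<rightarrow>\<^sub>E carrier R" "M = lin_comb ?U ?X c ?g" unfolding lin_span_def by blast
      have "c \<noteq> zero_vec ?U" using nz lin_comb_zero[OF gX] c(2) by auto
      then show "2 \<le> mat_rank R 2 m M" unfolding c(2) by (rule rk2[OF c(1)])
    qed
    ultimately show "?ind \<and> ?rk" ..
  qed
qed

lemma density_two_rows:
  assumes m: "m \<ge> 1"
  shows "rank_metric_density R 2 m m 2 =
    (\<Sum>G | G \<in> {..<m} \<rightarrow>\<^sub>E ({..<m} \<rightarrow>\<^sub>E carrier R) \<and> lin_indep {..<m} {..<m} G. real (card (spectrum_free m G)))
      / (\<Prod>i<m. real q ^ (m * 2) - real q ^ i)"
proof -
  let ?U = "{..<m}" let ?X = "{..<2::nat} \<times> ?U" let ?HH = "?U \<rightarrow>\<^sub>E (?U \<rightarrow>\<^sub>E carrier R)"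
  let ?B = "{g \<in> ?U \<rightarrow>\<^sub>E (?X \<rightarrow>\<^sub>E carrier R). lin_indep ?U ?X g \<and>
      (\<forall>M \<in> lin_span ?U ?X g. M \<noteq> zero_vec ?X \<longrightarrow> 2 \<le> mat_rank R 2 m M)}"
  let ?I = "{G. G \<in> ?HH \<and> lin_indep ?U ?U G}"
  let ?D = "SIGMA G:?I. spectrum_free m G"
  let ?f = "\<lambda>(G, H). stack m G H"
  have finH: "finite ?HH" by (rule finite_tuples) auto
  have finI: "finite ?I" by (rule finite_subset[OF _ finH]) blast
  have sfH: "spectrum_free m G \<subseteq> ?HH" for G unfolding spectrum_free_def by blast
  have "inj_on ?f ?D"
  proof (rule inj_onI)
    fix p p' assume "p \<in> ?D" "p' \<in> ?D"
    then obtain G H G' H' where p: "p = (G, H)" "p' = (G', H')"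
      and GG: "G \<in> ?I" "H \<in> spectrum_free m G" "G' \<in> ?I" "H' \<in> spectrum_free m G'"
      by (elim SigmaE) blast
    have GH: "G \<in> ?HH" "H \<in> ?HH" "G' \<in> ?HH" "H' \<in> ?HH"
      using GG(1,3) subsetD[OF sfH GG(2)] subsetD[OF sfH GG(4)] by (simp_all only: mem_Collect_eq)
    assume "?f p = ?f p'"
    then have eq: "stack m G H = stack m G' H'" by (simp add: p)
    have e: "G i j = G' i j" "H i j = H' i j" if "i < m" "j < m" for i j
      using stack_apply[OF that, of G H] stack_apply[OF that, of G' H'] by (simp_all add: eq)
    have "G = G'"
    proof (rule PiE_ext[OF GH(1,3)])
      fix i assume i: "i \<in> ?U"
      show "G i = G' i" by (rule PiE_ext[OF PiE_mem[OF GH(1) i] PiE_mem[OF GH(3) i]]) (use e i in auto)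
    qed
    moreover have "H = H'"
    proof (rule PiE_ext[OF GH(2,4)])
      fix i assume i: "i \<in> ?U"
      show "H i = H' i" by (rule PiE_ext[OF PiE_mem[OF GH(2) i] PiE_mem[OF GH(4) i]]) (use e i in auto)
    qed
    ultimately show "p = p'" by (simp add: p)
  qed
  then have "card ?D = card (?f ` ?D)" by (rule card_image[symmetric])
  also have "?f ` ?D = ?B"
  proof (intro equalityI subsetI)
    fix g assume "g \<in> ?f ` ?D"
    then obtain G H where g: "g = stack m G H" and G: "G \<in> ?HH" "lin_indep ?U ?U G" and H: "H \<in> spectrum_free m G"
      by auto
    have HH: "H \<in> ?HH" using H sfH by blast
    show "g \<in> ?B" unfolding g using stack_good_iff[OF G(1) HH] stack_closed[OF G(1) HH] G(2) H by blast
  next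
    fix g assume g: "g \<in> ?B"
    then have gV: "g \<in> ?U \<rightarrow>\<^sub>E (?X \<rightarrow>\<^sub>E carrier R)" by blast
    have gc: "g i (a, j) \<in> carrier R" if "i < m" "a < 2" "j < m" for i a j
      using PiE_mem[OF PiE_mem[OF gV, of i], of "(a, j)"] that by simp
    define G where "G = (\<lambda>i\<in>?U. \<lambda>j\<in>?U. g i (0, j))"
    define H where "H = (\<lambda>i\<in>?U. \<lambda>j\<in>?U. g i (1, j))"
    have GH: "G \<in> ?HH" "H \<in> ?HH" using gc unfolding G_def H_def restrict_PiE_iff by simp_all
    have "stack m G H = g"
    proof (rule PiE_ext[OF stack_closed[OF GH] gV])
      fix i assume i: "i \<in> ?U"
      show "stack m G H i = g i"
      proof (rule PiE_ext[OF PiE_mem[OF stack_closed[OF GH] i] PiE_mem[OF gV i]])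
        fix p assume "p \<in> ?X"
        then obtain a j where p: "p = (a, j)" "a = 0 \<or> a = 1" "j < m" by fastforce
        then show "stack m G H i p = g i p"
          using i stack_apply[of i m j G H] by (auto simp: G_def H_def)
      qed
    qed
    then have "g = ?f (G, H)" by simp
    moreover have "(G, H) \<in> ?D"
      using stack_good_iff[OF GH] g GH(1) unfolding \<open>stack m G H = g\<close> by blast
    ultimately show "g \<in> ?f ` ?D" by (rule image_eqI)
  qed
  finally have "card ?B = card ?D" by simp
  also have "\<dots> = (\<Sum>G\<in>?I. card (spectrum_free m G))"
    by (intro card_SigmaI finI ballI finite_subset[OF sfH finH])
  finally have "real (card ?B) = (\<Sum>G\<in>?I. real (card (spectrum_free m G)))" by simp
  then show ?thesis using density_eq[OF m, of 2 m 2] by simp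
qed

end

section \<open>Asymptotics\<close>

text \<open>The main term for the number of pairs of an \<open>i\<close>-set \<open>S\<close> of scalars and a map in \<open>hit m G S\<close>, divided
  by the number \<open>q ^ (m * m)\<close> of all maps: a given \<open>S\<close> contributes about \<open>1 / (q - 1) ^ i\<close>.\<close>

definition hit_approx :: "nat \<Rightarrow> nat \<Rightarrow> real" where
  "hit_approx i q = real (q choose i) / (real q - 1) ^ i"

text \<open>An error bound for this main term. It accounts for the dependent families of \<open>i\<close> vectors and for the
  maps with an eigenspace of dimension at least 2.\<close>

definition hit_error :: "nat \<Rightarrow> nat \<Rightarrow> nat \<Rightarrow> real" where
  "hit_error m i q = hit_approx i q * (1 - (\<Prod>j<i. 1 - real q ^ j / real q ^ m) + real i / (real q - 1))"

text \<open>The factor that relates the density to the proportion of spectrum-free maps: the number of injective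
  \<open>G\<close>, times the number of all \<open>H\<close>, divided by the number of independent \<open>m\<close>-tuples in the
  \<open>2 * m\<close>-dimensional matrix space.\<close>

definition gl_ratio :: "nat \<Rightarrow> nat \<Rightarrow> real" where
  "gl_ratio m q = (\<Prod>i<m. real q ^ m - real q ^ i) * real q ^ (m * m) / (\<Prod>i<m. real q ^ (m * 2) - real q ^ i)"

context finite_field
begin

lemma sum_hit_approx:
  assumes G: "G \<in> {..<m} \<rightarrow>\<^sub>E ({..<m} \<rightarrow>\<^sub>E carrier R)" and indG: "lin_indep {..<m} {..<m} G" and i: "i \<le> m"
  shows "\<bar>real (\<Sum>S | S \<subseteq> carrier R \<and> card S = i. card (hit m G S)) / real q ^ (m * m) - hit_approx i q\<bar>
    \<le> hit_error m i q"
proof -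
  let ?P = "{S. S \<subseteq> carrier R \<and> card S = i}"
  let ?N = "real q ^ (m * m)" and ?y = "real q - 1"
  let ?p = "\<Prod>j<i. 1 - real q ^ j / real q ^ m"
  have y: "?y > 0" using q_ge_2 by simp
  have qy: "real (q - 1) = ?y" using q_ge_2 by simp
  have x0: "real q > 0" using q_ge_2 by simp
  have N: "?N > 0" using x0 by (rule zero_less_power)
  have xm: "real q ^ m > 0" using x0 by (rule zero_less_power)
  have cP: "card ?P = q choose i" by (rule n_subsets) simp
  have prod: "real ((\<Prod>j<i. q ^ m - q ^ j) * q ^ (m * (m - i))) = ?p * ?N"
  proof -
    have gen: "X - a = X * (1 - a / X)" if "X > 0" for a X :: real
      using that by (simp add: right_diff_distrib)
    have "(\<Prod>j<i. real q ^ m - real q ^ j) = (\<Prod>j<i. real q ^ m * (1 - real q ^ j / real q ^ m))"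
      by (rule prod.cong[OF refl], rule gen[OF xm])
    also have "\<dots> = real q ^ (m * i) * ?p" by (simp add: prod.distrib power_mult)
    finally have "(\<Prod>j<i. real q ^ m - real q ^ j) = real q ^ (m * i) * ?p" .
    moreover have "real q ^ (m * i) * real q ^ (m * (m - i)) = ?N"
      using i by (simp flip: power_add distrib_left)
    ultimately show ?thesis
      unfolding of_nat_mult real_prod_diff[OF i] by (simp add: ac_simps)
  qed
  have p1: "?p \<le> 1"
  proof (rule prod_le_1)
    fix j assume "j \<in> {..<i}"
    then have "real q ^ j \<le> real q ^ m" using q_ge_2 i by (intro power_increasing) auto
    then show "0 \<le> 1 - real q ^ j / real q ^ m \<and> 1 - real q ^ j / real q ^ m \<le> 1"
      using xm x0 by (simp add: divide_le_eq)
  qed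
  have upper: "real (card (hit m G S)) \<le> ?N / ?y ^ i" if S: "S \<in> ?P" for S
  proof -
    have "real (card (hit m G S) * (q - 1) ^ i) \<le> real ((\<Prod>j<i. q ^ m - q ^ j) * q ^ (m * (m - i)))"
      using card_hit_upper[OF G indG _ _ i, of S] S by (intro of_nat_mono) blast
    also have "\<dots> \<le> 1 * ?N" unfolding prod by (rule mult_right_mono[OF p1]) (use N in simp)
    finally have "real (card (hit m G S)) * ?y ^ i \<le> ?N" using qy by simp
    then show ?thesis using y by (simp add: pos_le_divide_eq)
  qed
  have lower: "?N / ?y ^ i * (?p - real i / ?y) \<le> real (card (hit m G S))" if S: "S \<in> ?P" for S
  proof -
    have "real ((\<Prod>j<i. q ^ m - q ^ j) * q ^ (m * (m - i))) * real (q - 1) \<le>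
        real (card (hit m G S)) * real (q - 1) ^ Suc i + real i * ?N"
      using of_nat_mono[OF card_hit_lower[OF G indG _ _ i, of S], where ?'a = real] S by simp
    then have le: "?p * ?N * ?y \<le> real (card (hit m G S)) * ?y ^ Suc i + real i * ?N"
      unfolding prod qy .
    have "?N / ?y ^ i * (?p - real i / ?y) = (?p * ?N * ?y - real i * ?N) / ?y ^ Suc i"
      using y by (simp add: field_simps)
    also have "\<dots> \<le> real (card (hit m G S))"
      using le y by (subst pos_divide_le_eq) auto
    finally show ?thesis .
  qed
  have "real (\<Sum>S\<in>?P. card (hit m G S)) \<le> (\<Sum>S\<in>?P. ?N / ?y ^ i)"
    unfolding of_nat_sum by (rule sum_mono[OF upper])
  then have U: "real (\<Sum>S\<in>?P. card (hit m G S)) / ?N \<le> hit_approx i q"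
    using N cP by (simp add: hit_approx_def pos_divide_le_eq)
  have "(\<Sum>S\<in>?P. ?N / ?y ^ i * (?p - real i / ?y)) \<le> real (\<Sum>S\<in>?P. card (hit m G S))"
    unfolding of_nat_sum by (rule sum_mono[OF lower])
  then have "?N * (hit_approx i q * (?p - real i / ?y)) \<le> real (\<Sum>S\<in>?P. card (hit m G S))"
    using cP by (simp add: hit_approx_def ac_simps)
  then have "hit_approx i q * (?p - real i / ?y) \<le> real (\<Sum>S\<in>?P. card (hit m G S)) / ?N"
    using N by (simp add: pos_le_divide_eq ac_simps)
  moreover have "hit_approx i q * (?p - real i / ?y) = hit_approx i q - hit_error m i q"
    by (simp add: hit_error_def algebra_simps)
  ultimately have L: "hit_approx i q - hit_error m i q \<le> real (\<Sum>S\<in>?P. card (hit m G S)) / ?N"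
    by simp
  from U L show ?thesis by (intro abs_leI) linarith+
qed

lemma card_spectrum_free_approx:
  assumes G: "G \<in> {..<m} \<rightarrow>\<^sub>E ({..<m} \<rightarrow>\<^sub>E carrier R)" and indG: "lin_indep {..<m} {..<m} G"
  shows "\<bar>real (card (spectrum_free m G)) / real q ^ (m * m) - (\<Sum>i\<le>m. (-1) ^ i * hit_approx i q)\<bar>
    \<le> (\<Sum>i\<le>m. hit_error m i q)"
proof -
  let ?A = "\<lambda>i. real (\<Sum>S | S \<subseteq> carrier R \<and> card S = i. card (hit m G S))"
  let ?N = "real q ^ (m * m)"
  have "real (card (spectrum_free m G)) = of_int (int (card (spectrum_free m G)))" by simp
  also have "\<dots> = (\<Sum>i\<le>m. (-1) ^ i * ?A i)"
    unfolding card_spectrum_free[OF G indG] by (simp only: of_int_sum of_int_mult of_int_power of_int_minus of_int_1 of_int_of_nat_eq)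
  finally have "real (card (spectrum_free m G)) / ?N = (\<Sum>i\<le>m. (-1) ^ i * (?A i / ?N))"
    by (simp only: sum_divide_distrib times_divide_eq_right)
  then have "real (card (spectrum_free m G)) / ?N - (\<Sum>i\<le>m. (-1) ^ i * hit_approx i q) =
      (\<Sum>i\<le>m. (-1) ^ i * (?A i / ?N - hit_approx i q))"
    by (simp only: sum_subtractf right_diff_distrib)
  then have "\<bar>real (card (spectrum_free m G)) / ?N - (\<Sum>i\<le>m. (-1) ^ i * hit_approx i q)\<bar> =
      \<bar>\<Sum>i\<le>m. (-1) ^ i * (?A i / ?N - hit_approx i q)\<bar>" by (rule arg_cong)
  also have "\<dots> \<le> (\<Sum>i\<le>m. \<bar>(-1) ^ i * (?A i / ?N - hit_approx i q)\<bar>)" by (rule sum_abs)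
  also have "\<dots> \<le> (\<Sum>i\<le>m. hit_error m i q)"
  proof (rule sum_mono)
    fix i assume "i \<in> {..m}"
    then have "\<bar>?A i / ?N - hit_approx i q\<bar> \<le> hit_error m i q"
      by (intro sum_hit_approx[OF G indG]) simp
    then show "\<bar>(-1) ^ i * (?A i / ?N - hit_approx i q)\<bar> \<le> hit_error m i q"
      by (simp only: abs_mult power_abs abs_minus_cancel abs_one power_one mult_1)
  qed
  finally show ?thesis .
qed

lemma density_two_rows_approx:
  assumes m: "m \<ge> 1"
  shows "\<bar>rank_metric_density R 2 m m 2 - gl_ratio m q * (\<Sum>i\<le>m. (-1) ^ i * hit_approx i q)\<bar>
    \<le> gl_ratio m q * (\<Sum>i\<le>m. hit_error m i q)"
proof -
  let ?I = "{G. G \<in> {..<m} \<rightarrow>\<^sub>E ({..<m} \<rightarrow>\<^sub>E carrier R) \<and> lin_indep {..<m} {..<m} G}"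
  let ?N = "real q ^ (m * m)" and ?D = "\<Prod>i<m. real q ^ (m * 2) - real q ^ i"
  let ?a = "\<Sum>i\<le>m. (-1) ^ i * hit_approx i q" and ?e = "\<Sum>i\<le>m. hit_error m i q"
  let ?s = "\<lambda>G. real (card (spectrum_free m G))"
  have x0: "real q > 0" using q_ge_2 by simp
  have N: "?N > 0" using x0 by (rule zero_less_power)
  have D: "?D > 0"
  proof (rule prod_pos)
    fix i assume "i \<in> {..<m}"
    then show "0 < real q ^ (m * 2) - real q ^ i" using q_ge_2 by simp
  qed
  have "card ?I = (\<Prod>i<m. q ^ m - q ^ i)"
    using card_lin_indep[OF is_subspace_all, of "{..<m}" "{..<m}"] by (simp add: card_vecs)
  then have "real (card ?I) = (\<Prod>i<m. real q ^ m - real q ^ i)" by (simp only: real_prod_diff[OF le_refl])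
  then have ratio: "gl_ratio m q = real (card ?I) * ?N / ?D" unfolding gl_ratio_def by simp
  have dens: "rank_metric_density R 2 m m 2 = (\<Sum>G\<in>?I. ?s G) / ?D"
    by (rule density_two_rows[OF m])
  have "(\<Sum>G\<in>?I. ?s G) - real (card ?I) * (?N * ?a) = (\<Sum>G\<in>?I. ?s G - ?N * ?a)"
    by (simp add: sum_subtractf)
  then have "\<bar>(\<Sum>G\<in>?I. ?s G) - real (card ?I) * (?N * ?a)\<bar> = \<bar>\<Sum>G\<in>?I. ?s G - ?N * ?a\<bar>"
    by (rule arg_cong)
  also have "\<dots> \<le> (\<Sum>G\<in>?I. \<bar>?s G - ?N * ?a\<bar>)" by (rule sum_abs)
  also have "\<dots> \<le> (\<Sum>G\<in>?I. ?N * ?e)"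
  proof (rule sum_mono)
    fix G assume "G \<in> ?I"
    then have "\<bar>?s G / ?N - ?a\<bar> \<le> ?e" by (intro card_spectrum_free_approx) blast+
    then have "?N * \<bar>?s G / ?N - ?a\<bar> \<le> ?N * ?e" by (rule mult_left_mono) (use N in simp)
    moreover have "?N * \<bar>?s G / ?N - ?a\<bar> = \<bar>?N * (?s G / ?N - ?a)\<bar>"
      using N by (simp only: abs_mult abs_of_pos)
    moreover have "?N * (?s G / ?N - ?a) = ?s G - ?N * ?a"
      using less_imp_neq[OF N] unfolding right_diff_distrib by simp
    ultimately show "\<bar>?s G - ?N * ?a\<bar> \<le> ?N * ?e" by (simp only:)
  qed
  also have "\<dots> = real (card ?I) * (?N * ?e)" by simp
  finally have "\<bar>(\<Sum>G\<in>?I. ?s G) - real (card ?I) * (?N * ?a)\<bar> / ?D \<le> real (card ?I) * (?N * ?e) / ?D"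
    by (rule divide_right_mono) (use D in simp)
  moreover have "\<bar>(\<Sum>G\<in>?I. ?s G) - real (card ?I) * (?N * ?a)\<bar> / ?D =
      \<bar>((\<Sum>G\<in>?I. ?s G) - real (card ?I) * (?N * ?a)) / ?D\<bar>"
    using D by (simp only: abs_divide abs_of_pos)
  ultimately show ?thesis
    unfolding dens ratio by (simp only: diff_divide_distrib times_divide_eq_left mult.assoc)
qed

lemma density_nonneg:
  assumes "k \<ge> 1" "k \<le> m * n"
  shows "rank_metric_density R n m k d \<ge> 0"
proof -
  have "(\<Prod>i<k. real q ^ (m * n) - real q ^ i) \<ge> 0"
  proof (rule prod_nonneg)
    fix i assume "i \<in> {..<k}"
    then show "0 \<le> real q ^ (m * n) - real q ^ i" using q_ge_2 assms by simp
  qed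
  then show ?thesis unfolding density_eq[OF assms(1)] by (rule divide_nonneg_nonneg[rotated]) simp
qed

end

lemma tendsto_power_ratio:
  assumes "i < m"
  shows "((\<lambda>q::nat. real q ^ i / real q ^ m) \<longlongrightarrow> 0) at_top"
proof -
  have "((\<lambda>q::nat. inverse (real q) ^ (m - i)) \<longlongrightarrow> 0 ^ (m - i)) at_top"
    by (intro tendsto_power) real_asymp
  moreover have "0 ^ (m - i) = (0::real)" using assms by simp
  moreover have "eventually (\<lambda>q::nat. inverse (real q) ^ (m - i) = real q ^ i / real q ^ m) at_top"
    using eventually_gt_at_top[of 0]
  proof eventually_elim
    case (elim q)
    have "real q ^ m = real q ^ (m - i) * real q ^ i" using assms by (simp flip: power_add)
    then show ?case using elim by (simp add: power_inverse divide_inverse)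
  qed
  ultimately show ?thesis using tendsto_cong by fastforce
qed

lemma tendsto_hit_approx: "((\<lambda>q. hit_approx i q) \<longlongrightarrow> 1 / fact i) at_top"
proof -
  have "((\<lambda>q::nat. (\<Prod>j<i. (real q - real j) / (real q - 1)) / fact i) \<longlongrightarrow> (\<Prod>j<i. 1) / fact i) at_top"
  proof (intro tendsto_divide tendsto_prod tendsto_const)
    fix j
    show "((\<lambda>q::nat. (real q - real j) / (real q - 1)) \<longlongrightarrow> 1) at_top" by real_asymp
  qed simp
  moreover have "hit_approx i q = (\<Prod>j<i. (real q - real j) / (real q - 1)) / fact i" for q
    unfolding hit_approx_def binomial_gbinomial gbinomial_prod_rev
    by (simp add: prod_dividef lessThan_atLeast0)
  ultimately show ?thesis by simp
qed

lemma tendsto_hit_error: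
  assumes "i \<le> m"
  shows "((\<lambda>q. hit_error m i q) \<longlongrightarrow> 0) at_top"
proof -
  have "((\<lambda>q::nat. real i / (real q - 1)) \<longlongrightarrow> 0) at_top" by real_asymp
  moreover have "((\<lambda>q::nat. \<Prod>j<i. 1 - real q ^ j / real q ^ m) \<longlongrightarrow> (\<Prod>j<i. 1 - 0)) at_top"
    by (intro tendsto_prod tendsto_diff tendsto_const tendsto_power_ratio) (use assms in auto)
  ultimately have "((\<lambda>q. hit_error m i q) \<longlongrightarrow> 1 / fact i * (1 - (\<Prod>j<i. 1 - 0) + 0)) at_top"
    unfolding hit_error_def by (intro tendsto_mult tendsto_add tendsto_diff tendsto_const tendsto_hit_approx)
  then show ?thesis by simp
qed

lemma tendsto_gl_ratio: "((\<lambda>q. gl_ratio m q) \<longlongrightarrow> 1) at_top"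
proof -
  have "((\<lambda>q::nat. \<Prod>i<m. (1 - real q ^ i / real q ^ m) / (1 - real q ^ i / real q ^ (m * 2))) \<longlongrightarrow>
      (\<Prod>i<m. (1 - 0) / (1 - 0))) at_top"
    by (intro tendsto_prod tendsto_divide tendsto_diff tendsto_const tendsto_power_ratio) auto
  moreover have "eventually (\<lambda>q::nat. (\<Prod>i<m. (1 - real q ^ i / real q ^ m) / (1 - real q ^ i / real q ^ (m * 2)))
      = gl_ratio m q) at_top"
    using eventually_gt_at_top[of 0]
  proof eventually_elim
    case (elim q)
    then have x0: "real q > 0" by simp
    have xm: "real q ^ m > 0" using x0 by (rule zero_less_power)
    have gen: "(1 - a / X) / (1 - a / (X * X)) = (X - a) * X / (X * X - a)" if "X > 0" for a X :: real
    proof -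
      have "(1 - a / X) / (1 - a / (X * X)) = ((1 - a / X) * (X * X)) / ((1 - a / (X * X)) * (X * X))"
        using that by simp
      also have "(1 - a / X) * (X * X) = (X - a) * X" using that by (simp add: field_simps)
      also have "(1 - a / (X * X)) * (X * X) = X * X - a" using that by (simp add: field_simps)
      finally show ?thesis .
    qed
    have sq: "real q ^ (m * 2) = real q ^ m * real q ^ m" by (simp add: power_mult power2_eq_square)
    have "(\<Prod>i<m. (1 - real q ^ i / real q ^ m) / (1 - real q ^ i / real q ^ (m * 2))) =
        (\<Prod>i<m. (real q ^ m - real q ^ i) * real q ^ m / (real q ^ (m * 2) - real q ^ i))"
      unfolding sq by (rule prod.cong[OF refl], rule gen[OF xm])
    also have "\<dots> = gl_ratio m q"
      by (simp add: gl_ratio_def prod_dividef prod.distrib power_mult)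
    finally show ?case .
  qed
  ultimately have "((\<lambda>q. gl_ratio m q) \<longlongrightarrow> (\<Prod>i<m. (1 - 0) / (1 - 0))) at_top"
    by (rule Lim_transform_eventually)
  then show ?thesis by simp
qed

lemma tendsto_zero_if_bounded:
  fixes f g :: "'b \<Rightarrow> real"
  assumes "eventually (\<lambda>x. \<bar>f x\<bar> \<le> g x) L" and g: "(g \<longlongrightarrow> 0) L"
  shows "(f \<longlongrightarrow> 0) L"
proof (rule tendsto_0_le[OF g, of _ 1])
  show "eventually (\<lambda>x. norm (f x) \<le> norm (g x) * 1) L"
    using assms(1) by eventually_elim simp
qed

theorem theorem5p9:
  fixes m n d :: nat and F :: "nat \<Rightarrow> 'a ring"
  assumes "m \<ge> n" and "n \<ge> 2" and "1 \<le> d" and "d \<le> n"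
    and "\<And>q. primepow q \<Longrightarrow> field (F q)"
    and "\<And>q. primepow q \<Longrightarrow> card (carrier (F q)) = q"
  shows "(\<lambda>q. rank_metric_density (F q) n m (m * (n - d + 1)) d)
           \<in> O[prime_powers_at_top](\<lambda>q. real q powi (- ((int d - 1) * (int n - int d + 1)) + 1))
       \<and> ((\<lambda>q. rank_metric_density (F q) n m (m * (n - d + 1)) d) \<longlongrightarrow>
            (if d = 1 then 1
             else if n = 2 \<and> d = 2 then \<Sum>i=0..m. (-1) ^ i / fact i
             else 0)) prime_powers_at_top"
proof -
  let ?\<delta> = "\<lambda>q. rank_metric_density (F q) n m (m * (n - d + 1)) d"
  let ?L = "prime_powers_at_top"
  have L_le: "?L \<le> at_top" unfolding prime_powers_at_top_def by (rule inf_le1)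
  have ev: "eventually P ?L" if "\<And>q. primepow q \<Longrightarrow> P q" for P
    unfolding prime_powers_at_top_def eventually_inf_principal using that by simp
  have ff: "finite_field (F q)" if "primepow q" for q
  proof -
    have "q > 0" using that primepow_gt_0_nat by blast
    then have "finite (carrier (F q))" using assms(6)[OF that] by (metis card_ge_0_finite)
    then show ?thesis
      using assms(5)[OF that] by (simp add: finite_field_def finite_field_axioms_def)
  qed
  show ?thesis
  proof (cases "d = 1")
    case True
    have one: "?\<delta> q = 1" if "primepow q" for q
      using finite_field.density_trivial[OF ff[OF that], of m n] assms(1,2) True by simp
    have "eventually (\<lambda>q. norm (?\<delta> q) \<le> 1 * norm (real q powi (- ((int d - 1) * (int n - int d + 1)) + 1))) ?L"
    proof (rule ev)
      fix q :: nat assume q: "primepow q"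
      then have q1: "q \<ge> 1" using primepow_gt_0_nat[of q] by simp
      have n1: "norm (?\<delta> q) = 1" using one[OF q] by simp
      have p1: "real q powi (- ((int d - 1) * (int n - int d + 1)) + 1) = real q" using True by simp
      show "norm (?\<delta> q) \<le> 1 * norm (real q powi (- ((int d - 1) * (int n - int d + 1)) + 1))"
        unfolding n1 p1 using q1 by simp
    qed
    then have "?\<delta> \<in> O[?L](\<lambda>q. real q powi (- ((int d - 1) * (int n - int d + 1)) + 1))" by (rule bigoI)
    moreover have "(?\<delta> \<longlongrightarrow> 1) ?L" by (rule tendsto_eventually, rule ev, rule one)
    ultimately show ?thesis using True by simp
  next
    case False
    define r where "r = d - 1"
    have r: "1 \<le> r" "r < n" "d = Suc r" "n - d + 1 = n - r" using False assms by (auto simp: r_def)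
    define K where "K = (2::real) ^ (m * (n - r) + r + 1)"
    have bound: "norm (?\<delta> q) \<le> K * (real q / real q ^ (r * (n - r)))" if q: "primepow q" for q
    proof -
      interpret finite_field "F q" by (rule ff[OF q])
      have qq: "card (carrier (F q)) = q" by (rule assms(6)[OF q])
      have x0: "real q > 0" using q primepow_gt_0_nat by simp
      have dq: "?\<delta> q = rank_metric_density (F q) n m (m * (n - r)) (Suc r)"
        unfolding r(4) unfolding r(3) ..
      have "?\<delta> q * real q ^ (r * (n - r)) \<le> K * real q"
        unfolding dq K_def using density_upper_bound[OF r(1,2) assms(1)] unfolding qq .
      then have "?\<delta> q \<le> K * real q / real q ^ (r * (n - r))"
        by (simp only: pos_le_divide_eq[OF zero_less_power[OF x0]])
      then have "?\<delta> q \<le> K * (real q / real q ^ (r * (n - r)))" by (simp only: times_divide_eq_right)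
      moreover have "?\<delta> q \<ge> 0"
      proof (rule density_nonneg)
        have "1 * 1 \<le> m * (n - d + 1)" by (rule mult_le_mono) (use assms in auto)
        then show "1 \<le> m * (n - d + 1)" by simp
        show "m * (n - d + 1) \<le> m * n" using r by simp
      qed
      ultimately show ?thesis by simp
    qed
    have powi: "real q powi (- ((int d - 1) * (int n - int d + 1)) + 1) = real q / real q ^ (r * (n - r))"
      if q: "primepow q" for q
    proof -
      have x0: "real q \<noteq> 0" using q primepow_gt_0_nat[of q] by simp
      have e: "(int d - 1) * (int n - int d + 1) = int (r * (n - r))" using r by (simp add: of_nat_diff)
      have "real q powi (- int k + 1) = real q / real q ^ k" for k
      proof -
        have "real q powi (- int k + 1) = real q powi (- int k) * real q powi 1"
          using x0 by (intro power_int_add) simp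
        also have "real q powi (- int k) = inverse (real q ^ k)" by (simp only: power_int_minus power_int_of_nat)
        finally show ?thesis by (simp add: divide_inverse)
      qed
      then show ?thesis unfolding e .
    qed
    have "eventually (\<lambda>q. norm (?\<delta> q) \<le> K * norm (real q powi (- ((int d - 1) * (int n - int d + 1)) + 1))) ?L"
    proof (rule ev)
      fix q :: nat assume q: "primepow q"
      have "real q / real q ^ (r * (n - r)) \<ge> 0" by simp
      then show "norm (?\<delta> q) \<le> K * norm (real q powi (- ((int d - 1) * (int n - int d + 1)) + 1))"
        unfolding powi[OF q] real_norm_def[of "real q / _"] using bound[OF q] by (simp only: abs_of_nonneg)
    qed
    then have bigo: "?\<delta> \<in> O[?L](\<lambda>q. real q powi (- ((int d - 1) * (int n - int d + 1)) + 1))" by (rule bigoI)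
    show ?thesis
    proof (cases "n = 2 \<and> d = 2")
      case two: True
      have m1: "m \<ge> 1" using assms by simp
      let ?a = "\<lambda>q. gl_ratio m q * (\<Sum>i\<le>m. (-1) ^ i * hit_approx i q)"
      let ?e = "\<lambda>q. gl_ratio m q * (\<Sum>i\<le>m. hit_error m i q)"
      have close: "eventually (\<lambda>q. \<bar>?\<delta> q - ?a q\<bar> \<le> ?e q) ?L"
      proof (rule ev)
        fix q :: nat assume q: "primepow q"
        show "\<bar>?\<delta> q - ?a q\<bar> \<le> ?e q"
          using finite_field.density_two_rows_approx[OF ff[OF q] m1] assms(6)[OF q] two by simp
      qed
      have a: "(?a \<longlongrightarrow> 1 * (\<Sum>i\<le>m. (-1) ^ i * (1 / fact i))) ?L"
        by (intro tendsto_mono[OF L_le] tendsto_mult tendsto_sum tendsto_const tendsto_gl_ratio tendsto_hit_approx)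
      have e: "(?e \<longlongrightarrow> 1 * (\<Sum>i\<le>m. 0)) ?L"
        by (intro tendsto_mono[OF L_le] tendsto_mult tendsto_sum tendsto_gl_ratio tendsto_hit_error) simp
      have "((\<lambda>q. ?\<delta> q - ?a q) \<longlongrightarrow> 0) ?L"
        by (rule tendsto_zero_if_bounded[OF close]) (use e in simp)
      then have "((\<lambda>q. (?\<delta> q - ?a q) + ?a q) \<longlongrightarrow> 0 + 1 * (\<Sum>i\<le>m. (-1) ^ i * (1 / fact i))) ?L"
        using a by (rule tendsto_add)
      then have "(?\<delta> \<longlongrightarrow> (\<Sum>i=0..m. (-1) ^ i / fact i)) ?L"
        by (simp add: atMost_atLeast0)
      then show ?thesis using bigo two by simp
    next
      case other: False
      \<comment> \<open>Outside the case \<open>n = d = 2\<close> the exponent in the upper bound is negative.\<close>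
      have "r * (n - r) \<ge> 2"
      proof (cases "r = 1")
        case True
        then have "n \<noteq> 2" using other r by simp
        then show ?thesis using True assms(2) by simp
      next
        case False
        then have "2 * 1 \<le> r * (n - r)" using r by (intro mult_le_mono) auto
        then show ?thesis by simp
      qed
      then have "1 < r * (n - r)" by simp
      then have "((\<lambda>q::nat. K * (real q ^ 1 / real q ^ (r * (n - r)))) \<longlongrightarrow> K * 0) at_top"
        by (intro tendsto_mult tendsto_const tendsto_power_ratio)
      then have "((\<lambda>q::nat. K * (real q / real q ^ (r * (n - r)))) \<longlongrightarrow> 0) ?L"
        using tendsto_mono[OF L_le] by simp
      then have lim: "(?\<delta> \<longlongrightarrow> 0) ?L"
        by (rule tendsto_zero_if_bounded[rotated]) (rule ev, rule bound[unfolded real_norm_def])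
      show ?thesis
        unfolding if_not_P[OF False] if_not_P[OF other] by (rule conjI[OF bigo lim])
    qed
  qed
qed

end
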